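(* Let $x_{k+1} = x_k - A_k g_k$ ($k \ge 1$) be the stochastic iteration described in the context, with $g_k = \nabla f(x_k) + \mathcal{E}_k$. Assume: (1) $x^*$ is the only critical point of $f:\mathbb{R}^n\to\mathbb{R}$; $\nabla^2 f(x)$ exists and is positive definite for every $x\in\mathbb{R}^n$, with $\sup_x \|\nabla^2 f(x)\|_2 < +\infty$ and $\sup_x \|(\nabla^2 f(x))^{-1}\|_2 < +\infty$. (2) For some positive nondecreasing sequence $N_k$ and some integer $M\ge 2$, $\sup_{x_k,k} N_k^{p/2}\, E[\|\mathcal{E}_k\|^p \mid \mathcal{F}_{k-1}] < +\infty$ for all $p\in\{2,\dots,M\}$. (3) $A_k = a_k D$ with $a_k = (k+c)^{-\alpha}$ for some $c\ge 0$ and $0<\alpha<1$, where $D$ is a symmetric positive definite matrix, and $N_k \sim N_1 k^q$ with $N_1>0$ and $q\ge 0$. (4) The function $\tilde U(x) = \lim_{k\to\infty} N_k E[\mathcal{E}_k\mathcal{E}_k^T \mid x_k = x]$ exists and is continuous in a neighborhood of $x^*$, with $\tilde U(x^* ) = \Sigma^2$ for some positive definite matrix $\Sigma^2$. (5) $f$ is $C^3$ in a neighborhood of $x^*$. Assume moreover that $\frac{1-q}{2} < \alpha < 1$, and that $M \ge 2\left\lfloor \frac{1}{\alpha+q}\right\rfloor + 2$ and $M\ge 2\left\lfloor \frac{1}{\alpha-(1-q)/2}\right\rfloor+2$. Let $S=\nabla^2 f(x^* )$ and $$\bar x_{k+1} = \frac{\sum_{i=1}^k N_i x_{i+1}}{\sum_{i=1}^k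 N_i}.$$ Then, as $k\to\infty$, $$E[(\bar x_{k+1}-x^* )(\bar x_{k+1}-x^* )^T] \sim \frac{S^{-1}\Sigma^2S^{-1}}{\sum_{i=1}^k N_i}.$$
   Context: Setting: $(\mathcal{F}_k)_{k\ge 0}$ is an increasing sequence of $\sigma$-algebras; $x_1\in\mathbb{R}^n$ is an $\mathcal{F}_0$-measurable random variable; $A_k\in\mathbb{R}^{n\times n}$ is a deterministic sequence of positive definite matrices; $g_k = \nabla f(x_k)+\mathcal{E}_k$, where $\mathcal{E}_k\in\mathbb{R}^n$ is an $\mathcal{F}_k$-measurable random variable with $E[\mathcal{E}_k\mid\mathcal{F}_{k-1}]=0$ whose conditional distribution given $\mathcal{F}_{k-1}$ is a function of $x_k$ and $k$ only, i.e. $E[g(\mathcal{E}_k)\mid\mathcal{F}_{k-1}] = E[g(\mathcal{E}_k)\mid x_k]$ for every function $g$ on $\mathbb{R}^n$. The iterates are $x_{k+1}=x_k-A_kg_k$. Notation: $\|\cdot\|$ is the Euclidean norm and $\|\cdot\|_2$ the induced $L^2$ operator norm for matrices. In hypothesis (2), since the conditional law of $\mathcal{E}_k$ depends only on $x_k$ and $k$, the supremum is over all $k\ge1$ and all values $x_k\in\mathbb{R}^n$. For scalars, $f_k\sim g_k$ means $f_k/g_k\to 1$ as $k\to\infty$; for matrices, $M_k \sim C/s_k$ with scalar $s_k$ and fixed matrix $C$ means $s_k M_k\to C$.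
   Formalization: Added because the claim fails otherwise: x_1 has a finite second moment; the limit defining Ũ in (4) is uniform on a neighborhood of x*, not merely pointwise; and M ≥ 3 instead of M ≥ 2 (this excludes only M = 2, possible only when q > 3 − 2α). *)

theory Defs
  imports "HOL-Probability.Probability"
begin

definition grad :: "(real ^ 'n \<Rightarrow> real) \<Rightarrow> real ^ 'n \<Rightarrow> real ^ 'n" where
  "grad f x = (\<chi> i. frechet_derivative f (at x) (axis i 1))"

(* The Jacobian matrix of the gradient; it is meaningful at x only if grad f is
   differentiable at x. *)
definition hessian :: "(real ^ 'n \<Rightarrow> real) \<Rightarrow> real ^ 'n \<Rightarrow> real ^ 'n ^ 'n" where
  "hessian f x = matrix (frechet_derivative (grad f) (at x))"

lemma gderiv_grad:
  fixes f :: "real ^ 'n \<Rightarrow> real"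
  assumes "f differentiable (at x)"
  shows "GDERIV f x :> grad f x"
proof -
  let ?f' = "frechet_derivative f (at x)"
  have D: "(f has_derivative ?f') (at x)"
    using assms by (simp add: frechet_derivative_works)
  then have lin: "linear ?f'"
    by (rule has_derivative_linear)
  have "?f' = (\<lambda>h. inner h (grad f x))"
  proof
    fix h :: "real ^ 'n"
    have "?f' h = ?f' (\<Sum>i\<in>UNIV. h $ i *\<^sub>R axis i 1)"
      by (simp add: basis_expansion flip: scalar_mult_eq_scaleR)
    also have "\<dots> = (\<Sum>i\<in>UNIV. h $ i * ?f' (axis i 1))"
      by (simp add: linear_sum[OF lin] linear_cmul[OF lin])
    finally show "?f' h = inner h (grad f x)"
      by (simp add: grad_def inner_vec_def)
  qed
  with D show ?thesis
    by (simp add: gderiv_def)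
qed

lemma has_derivative_grad_hessian:
  fixes f :: "real ^ 'n \<Rightarrow> real"
  assumes "grad f differentiable (at x)"
  shows "(grad f has_derivative (\<lambda>h. hessian f x *v h)) (at x)"
proof -
  have D: "(grad f has_derivative frechet_derivative (grad f) (at x)) (at x)"
    using assms by (simp add: frechet_derivative_works)
  have "matrix (frechet_derivative (grad f) (at x)) *v h = frechet_derivative (grad f) (at x) h" for h
    by (rule matrix_works) (use has_derivative_linear[OF D] in \<open>simp add: linear_matrix_vector_mul_eq\<close>)
  with D show ?thesis
    by (simp add: hessian_def)
qed

(* Directional derivatives suffice: the derivative is linear in the direction v. *)
primrec Ck_on :: "nat \<Rightarrow> ('a::euclidean_space \<Rightarrow> 'b::real_normed_vector) \<Rightarrow> 'a set \<Rightarrow> bool" where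
  "Ck_on 0 f W \<longleftrightarrow> continuous_on W f"
| "Ck_on (Suc m) f W \<longleftrightarrow>
     (\<forall>x\<in>W. f differentiable (at x)) \<and> (\<forall>v. Ck_on m (\<lambda>x. frechet_derivative f (at x) v) W)"

definition pos_def :: "real ^ 'n ^ 'n \<Rightarrow> bool" where
  "pos_def A \<longleftrightarrow> transpose A = A \<and> (\<forall>v. v \<noteq> 0 \<longrightarrow> 0 < v \<bullet> (A *v v))"

definition op_norm :: "real ^ 'n ^ 'n \<Rightarrow> real" where
  "op_norm A = onorm (\<lambda>v. A *v v)"

definition outer :: "real ^ 'n \<Rightarrow> real ^ 'n \<Rightarrow> real ^ 'n ^ 'n" where
  "outer u v = (\<chi> i j. u $ i * v $ j)"

definition sigma_gen :: "'a measure \<Rightarrow> ('a \<Rightarrow> 'b::topological_space) \<Rightarrow> 'a measure" where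
  "sigma_gen P X = vimage_algebra (space P) X borel"

(* kappa is a regular version of the conditional law of Y given X. It fixes, for every y,
   the value E[h(Y) | X = y] as the integral of h with respect to kappa y. *)
definition cond_law ::
  "'a measure \<Rightarrow> ('a \<Rightarrow> 'b::topological_space) \<Rightarrow> ('a \<Rightarrow> 'c::topological_space) \<Rightarrow> ('b \<Rightarrow> 'c measure) \<Rightarrow> bool"
where
  "cond_law P X Y \<kappa> \<longleftrightarrow>
     \<kappa> \<in> borel \<rightarrow>\<^sub>M prob_algebra borel \<and>
     (\<forall>B\<in>sets borel. AE \<omega> in P.
        real_cond_exp P (sigma_gen P X) (\<lambda>\<omega>. indicator B (Y \<omega>)) \<omega> = measure (\<kappa> (X \<omega>)) B)"

(* The average with index k involves the iterates x 2, ..., x (k + 1). *)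
definition weighted_avg :: "(nat \<Rightarrow> real) \<Rightarrow> (nat \<Rightarrow> 'a \<Rightarrow> real ^ 'n) \<Rightarrow> nat \<Rightarrow> 'a \<Rightarrow> real ^ 'n" where
  "weighted_avg N x k \<omega> = (1 / (\<Sum>i=1..k. N i)) *\<^sub>R (\<Sum>i=1..k. N i *\<^sub>R x (Suc i) \<omega>)"

end

theory Submission
  imports Defs
begin

text \<open>Write \<open>X\<^sub>k = x\<^sub>k - x*\<close> and \<open>R\<^sub>k = grad f (x\<^sub>k) - S X\<^sub>k\<close>. Solving the recursion for \<open>X\<^sub>k\<close> gives
  \<open>N\<^sub>k X\<^sub>k = - S\<^sup>-\<^sup>1 N\<^sub>k E\<^sub>k - S\<^sup>-\<^sup>1 N\<^sub>k R\<^sub>k - S\<^sup>-\<^sup>1 D\<^sup>-\<^sup>1 (N\<^sub>k / a\<^sub>k) (X\<^sub>k\<^sub>+\<^sub>1 - X\<^sub>k)\<close>, so the weighted sum of the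
  iterates is a weighted sum of martingale differences plus a residual. A Lyapunov argument for the quadratic form of
  \<open>D\<^sup>-\<^sup>1\<close> gives \<open>E |X\<^sub>k|\<^sup>2 = O(k powr - (\<alpha> + q))\<close>, and Abel summation then makes the increments negligible. A second
  Lyapunov function, quartic at the critical point and quadratic at infinity, bounds \<open>E |R\<^sub>k|\<^sup>2\<close> by \<open>k powr - r\<close> with
  \<open>r > q + 1\<close>, which makes the sum of the \<open>N\<^sub>k R\<^sub>k\<close> negligible as well. The martingale differences are orthogonal and
  \<open>N\<^sub>k E [E\<^sub>k E\<^sub>k\<^sup>T]\<close> tends to \<open>\<Sigma>\<^sup>2\<close> because \<open>x\<^sub>k\<close> tends to \<open>x*\<close> in probability; a weighted Cesaro mean concludes.\<close>

section \<open>Positive definite matrices and the gradient\<close>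

text \<open>Solving for the current iterate, instead of unrolling the recursion, keeps products of
  step matrices out of the argument: the noise enters with the weight \<open>N_k\<close> and one
  fixed matrix. The normalising sum of the \<open>N_i\<close> is of order k^(q+1), so every residual
  has to be o(k^((q+1)/2)) in L2. The Taylor remainders are summed by the triangle inequality, with
  no cancellation, and give k^(q + 1 - r/2); this is small enough exactly when r > q + 1. The
  remainder is quadratic in the error, so the best r to hope for is twice the exponent \<alpha> + q
  of the second moment, and 2(\<alpha> + q) > q + 1 is the lower bound on \<alpha>. The increments
  contribute k^((\<alpha> + q)/2), which is small because \<alpha> < 1. The number of available
  noise moments limits r a second time, which is where the lower bounds on \<open>M\<close>
  enter.\<close>

lemma inner_matrix_sym:
  fixes A :: "real ^ 'n ^ 'n"
  assumes "transpose A = A"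
  shows "u \<bullet> (A *v v) = (A *v u) \<bullet> v"
  by (metis assms dot_lmul_matrix vector_transpose_matrix)

lemma pos_def_invertible:
  fixes A :: "real ^ 'n ^ 'n"
  assumes "pos_def A"
  shows "invertible A"
proof -
  have "\<forall>v. A *v v = 0 \<longrightarrow> v = 0"
    using assms unfolding pos_def_def by (metis inner_zero_right less_irrefl)
  then show ?thesis
    using matrix_left_invertible_ker invertible_left_inverse by blast
qed

lemma matrix_inv_right_left:
  fixes A :: "real ^ 'n ^ 'n"
  assumes "invertible A"
  shows "A ** matrix_inv A = mat 1" "matrix_inv A ** A = mat 1"
  using someI_ex[of "\<lambda>A'. A ** A' = mat 1 \<and> A' ** A = mat 1"] assms
  unfolding invertible_def matrix_inv_def by blast+

lemma matrix_inv_vector: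
  fixes A :: "real ^ 'n ^ 'n"
  assumes "invertible A"
  shows "A *v (matrix_inv A *v v) = v" "matrix_inv A *v (A *v v) = v"
  using matrix_inv_right_left[OF assms]
  by (simp_all add: matrix_vector_mul_assoc)

lemma pos_def_transpose_inv:
  fixes A :: "real ^ 'n ^ 'n"
  assumes "pos_def A"
  shows "transpose (matrix_inv A) = matrix_inv A"
proof -
  have t: "transpose A = A" using assms by (simp add: pos_def_def)
  have i: "invertible A" by (rule pos_def_invertible[OF assms])
  have "transpose (matrix_inv A) ** A = mat 1"
    using matrix_inv_right_left(1)[OF i] t by (metis matrix_transpose_mul transpose_mat)
  then show ?thesis
    by (metis i matrix_inv_right_left(1) matrix_mul_assoc matrix_mul_lid matrix_mul_rid)
qed

lemma pos_def_inv:
  fixes A :: "real ^ 'n ^ 'n"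
  assumes "pos_def A"
  shows "pos_def (matrix_inv A)"
  unfolding pos_def_def
proof (intro conjI allI impI)
  show "transpose (matrix_inv A) = matrix_inv A" by (rule pos_def_transpose_inv[OF assms])
  fix v :: "real ^ 'n" assume v: "v \<noteq> 0"
  define w where "w = matrix_inv A *v v"
  have Aw: "A *v w = v"
    by (simp add: w_def matrix_inv_vector pos_def_invertible[OF assms])
  with v have "w \<noteq> 0" by auto
  then have "0 < w \<bullet> (A *v w)" using assms by (simp add: pos_def_def)
  then show "0 < v \<bullet> (matrix_inv A *v v)"
    by (simp add: Aw flip: w_def) (simp add: inner_commute)
qed

lemma norm_matrix_vector_le:
  fixes A :: "real ^ 'n ^ 'n"
  shows "norm (A *v v) \<le> op_norm A * norm v"
  unfolding op_norm_def by (rule onorm) (rule matrix_vector_mul_bounded_linear)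

lemma op_norm_nonneg: "0 \<le> op_norm A"
  unfolding op_norm_def by (rule onorm_pos_le) (rule matrix_vector_mul_bounded_linear)

lemma abs_quadratic_le:
  fixes A :: "real ^ 'n ^ 'n"
  shows "\<bar>v \<bullet> (A *v v)\<bar> \<le> op_norm A * (norm v)\<^sup>2"
proof -
  have "\<bar>v \<bullet> (A *v v)\<bar> \<le> norm v * norm (A *v v)" by (rule Cauchy_Schwarz_ineq2)
  also have "\<dots> \<le> norm v * (op_norm A * norm v)"
    by (intro mult_left_mono norm_matrix_vector_le) simp
  finally show ?thesis by (simp add: power2_eq_square mult_ac)
qed

text \<open>A bound on the inverse becomes coercivity without eigenvalues: the form of
  \<open>H\<close> is nonnegative at v - s H^-1 v for every s, and this is a quadratic inequality in
  s.\<close>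

lemma pos_def_coercive_inv:
  fixes H :: "real ^ 'n ^ 'n"
  assumes H: "pos_def H" and K: "op_norm (matrix_inv H) \<le> K" "0 < K"
  shows "(norm v)\<^sup>2 \<le> K * (v \<bullet> (H *v v))"
proof -
  define u where "u = matrix_inv H *v v"
  have Hu: "H *v u = v" by (simp add: u_def matrix_inv_vector pos_def_invertible[OF H])
  have sym: "transpose H = H" using H by (simp add: pos_def_def)
  \<comment> \<open>The coefficient 1/K minimises v.Hv - 2s|v|^2 + s^2 K |v|^2 over s.\<close>
  define z where "z = v - (1/K) *\<^sub>R u"
  have "0 \<le> z \<bullet> (H *v z)"
    using H unfolding pos_def_def by (metis inner_zero_left order.strict_implies_order order_refl)
  also have "z \<bullet> (H *v z) = v \<bullet> (H *v v) - (2/K) * (v \<bullet> v) + (1/K)^2 * (u \<bullet> v)"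
    using inner_matrix_sym[OF sym, of u v]
    by (simp add: z_def matrix_vector_mult_diff_distrib Hu inner_diff_left inner_diff_right
        power2_eq_square matrix_vector_mult_scaleR inner_commute algebra_simps)
  also have "u \<bullet> v \<le> K * (v \<bullet> v)"
  proof -
    have "u \<bullet> v \<le> op_norm (matrix_inv H) * (norm v)\<^sup>2"
      using abs_quadratic_le[of v "matrix_inv H"] by (simp add: u_def inner_commute)
    also have "\<dots> \<le> K * (norm v)\<^sup>2" using K by (intro mult_right_mono) auto
    finally show ?thesis by (simp add: power2_norm_eq_inner)
  qed
  then have "v \<bullet> (H *v v) - (2/K) * (v \<bullet> v) + (1/K)^2 * (u \<bullet> v)
     \<le> v \<bullet> (H *v v) - (2/K) * (v \<bullet> v) + (1/K)^2 * (K * (v \<bullet> v))"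
    by (intro add_left_mono mult_left_mono) auto
  also have "\<dots> = v \<bullet> (H *v v) - (v \<bullet> v) / K" using K by (simp add: field_simps power2_eq_square)
  finally show ?thesis using K by (simp add: field_simps power2_norm_eq_inner)
qed

lemma pos_def_coercive:
  fixes H :: "real ^ 'n ^ 'n"
  assumes "pos_def H"
  obtains d where "0 < d" "\<And>v. d * (norm v)\<^sup>2 \<le> v \<bullet> (H *v v)"
proof
  define K where "K = op_norm (matrix_inv H) + 1"
  have K: "0 < K" using op_norm_nonneg[of "matrix_inv H"] by (simp add: K_def)
  show "0 < 1 / K" using K by simp
  show "1 / K * (norm v)\<^sup>2 \<le> v \<bullet> (H *v v)" for v
    using pos_def_coercive_inv[OF assms _ K, of v] K by (simp add: K_def field_simps)
qed

section \<open>Monotonicity, Lipschitz bound and Taylor remainder of the gradient\<close>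

lemma derivative_gradient_line:
  fixes f :: "real ^ 'n \<Rightarrow> real"
  assumes "grad f differentiable (at (y + t *\<^sub>R v))"
  shows "((\<lambda>t. v \<bullet> grad f (y + t *\<^sub>R v)) has_real_derivative (v \<bullet> (hessian f (y + t *\<^sub>R v) *v v))) (at t)"
proof -
  have "((\<lambda>t. y + t *\<^sub>R v) has_derivative (\<lambda>s. s *\<^sub>R v)) (at t)"
    by (auto intro!: derivative_eq_intros)
  from has_derivative_compose[OF this has_derivative_grad_hessian[OF assms]]
  have "((\<lambda>t. v \<bullet> grad f (y + t *\<^sub>R v)) has_derivative (\<lambda>s. v \<bullet> (hessian f (y + t *\<^sub>R v) *v (s *\<^sub>R v)))) (at t)"
    by (rule has_derivative_inner_right)
  then show ?thesis
    by (simp add: has_field_derivative_def matrix_vector_mult_scaleR mult.commute[of _ "_ \<bullet> _"])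
qed

text \<open>Only the component of the gradient along \<open>x - y\<close> matters, so the scalar
  mean value theorem on the segment applies; the uniform bound on the inverse Hessians then acts at
  the unknown intermediate point.\<close>

lemma strong_monotone_gradient:
  fixes f :: "real ^ 'n \<Rightarrow> real"
  assumes diff: "\<And>y. grad f differentiable (at y)"
    and pd: "\<And>y. pos_def (hessian f y)" and K: "\<And>y. op_norm (matrix_inv (hessian f y)) \<le> K" "0 < K"
  shows "(norm (x - y))\<^sup>2 \<le> K * ((x - y) \<bullet> (grad f x - grad f y))"
proof -
  define v where "v = x - y"
  have "\<exists>z. 0 < z \<and> z < 1 \<and> v \<bullet> grad f (y + 1 *\<^sub>R v) - v \<bullet> grad f (y + 0 *\<^sub>R v) =
    (1 - 0) * (v \<bullet> (hessian f (y + z *\<^sub>R v) *v v))"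
    by (rule MVT2) (use derivative_gradient_line[OF diff] in auto)
  then obtain z where "v \<bullet> grad f x - v \<bullet> grad f y = v \<bullet> (hessian f (y + z *\<^sub>R v) *v v)"
    by (auto simp: v_def)
  then have "v \<bullet> (grad f x - grad f y) = v \<bullet> (hessian f (y + z *\<^sub>R v) *v v)"
    by (simp add: inner_diff_right)
  then show ?thesis
    using pos_def_coercive_inv[OF pd K, of v "y + z *\<^sub>R v"] by (simp add: v_def)
qed

lemma lipschitz_gradient:
  fixes f :: "real ^ 'n \<Rightarrow> real"
  assumes diff: "\<And>y. grad f differentiable (at y)"
    and L: "\<And>y. op_norm (hessian f y) \<le> L"
  shows "norm (grad f x - grad f y) \<le> L * norm (x - y)"
  by (rule differentiable_bound[of UNIV _ "\<lambda>y v. hessian f y *v v"])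
     (use has_derivative_grad_hessian[OF diff] L in \<open>auto simp: op_norm_def\<close>)

text \<open>Here \<open>norm A\<close> is the Frobenius norm of the nested vector type, the norm in
  which increments of the matrix-valued map \<open>hessian f\<close> are measured; the bound is
  Cauchy-Schwarz row by row.\<close>

lemma norm_matrix_vector_le_norm:
  fixes A :: "real ^ 'n ^ 'n"
  shows "norm (A *v v) \<le> norm A * norm v"
proof -
  have "(norm (A *v v))\<^sup>2 = (\<Sum>i\<in>UNIV. (A $ i \<bullet> v)\<^sup>2)"
    unfolding power2_norm_eq_inner
    by (subst inner_vec_def) (simp add: matrix_vector_mul_component power2_eq_square)
  also have "\<dots> \<le> (\<Sum>i\<in>UNIV. (A $ i \<bullet> A $ i) * (v \<bullet> v))"
    by (intro sum_mono Cauchy_Schwarz_ineq)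
  also have "\<dots> = (norm A * norm v)\<^sup>2"
    by (simp add: power_mult_distrib power2_norm_eq_inner inner_vec_def[of A] sum_distrib_right)
  finally show ?thesis by (rule power2_le_imp_le) simp
qed

text \<open>Links \<open>hessian\<close>, defined through the derivative of the gradient, with the
  iterated directional derivatives into which \<open>Ck_on\<close> unfolds.\<close>

lemma hessian_component:
  fixes f :: "real ^ 'n \<Rightarrow> real"
  assumes "grad f differentiable (at y)"
  shows "hessian f y $ i $ j = frechet_derivative (\<lambda>y. frechet_derivative f (at y) (axis i 1)) (at y) (axis j 1)"
proof -
  have D: "(grad f has_derivative (\<lambda>h. hessian f y *v h)) (at y)"
    by (rule has_derivative_grad_hessian[OF assms])
  have "((\<lambda>y. grad f y $ i) has_derivative (\<lambda>h. (hessian f y *v h) $ i)) (at y)"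
    using bounded_linear.has_derivative[OF bounded_linear_vec_nth D] .
  then have "((\<lambda>y. frechet_derivative f (at y) (axis i 1)) has_derivative (\<lambda>h. (hessian f y *v h) $ i)) (at y)"
    by (simp add: grad_def)
  from frechet_derivative_at[OF this]
  have "frechet_derivative (\<lambda>y. frechet_derivative f (at y) (axis i 1)) (at y) (axis j 1) = (hessian f y *v axis j 1) $ i"
    by metis
  then show ?thesis by (simp add: matrix_vector_mul_component inner_axis)
qed

lemma differentiable_lipschitz_at:
  fixes h :: "'a::real_normed_vector \<Rightarrow> 'b::real_normed_vector"
  assumes "h differentiable (at x)"
  obtains C d where "0 \<le> C" "0 < d" "\<And>y. norm (y - x) < d \<Longrightarrow> norm (h y - h x) \<le> C * norm (y - x)"
proof -
  obtain h' where h': "(h has_derivative h') (at x)" using assms by (auto simp: differentiable_def)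
  then have bl: "bounded_linear h'" by (rule has_derivative_bounded_linear)
  obtain d where d: "0 < d" "\<And>y. norm (y - x) < d \<Longrightarrow> norm (h y - h x - h' (y - x)) \<le> 1 * norm (y - x)"
    using h' unfolding has_derivative_within_alt by (auto dest!: spec[of _ "1::real"])
  have "norm (h y - h x) \<le> (onorm h' + 1) * norm (y - x)" if "norm (y - x) < d" for y
  proof -
    have "norm (h y - h x) \<le> norm (h y - h x - h' (y - x)) + norm (h' (y - x))"
      by (metis norm_triangle_sub add.commute)
    also have "\<dots> \<le> 1 * norm (y - x) + onorm h' * norm (y - x)"
      by (intro add_mono d(2) that onorm[OF bl])
    finally show ?thesis by (simp add: algebra_simps)
  qed
  moreover have "0 \<le> onorm h' + 1" using onorm_pos_le[OF bl] by simp
  ultimately show ?thesis using d(1) that by blast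
qed

lemma differentiable_matrix:
  fixes h :: "'a::real_normed_vector \<Rightarrow> real ^ 'n ^ 'm"
  assumes "\<And>i j. (\<lambda>y. h y $ i $ j) differentiable (at x)"
  shows "h differentiable (at x)"
proof -
  have *: "(\<lambda>y. h y \<bullet> axis i (axis j 1)) = (\<lambda>y. h y $ i $ j)" for i j
    by (simp add: inner_axis)
  show ?thesis
    by (rule differentiable_componentwise_within[THEN iffD2])
       (auto simp: Basis_vec_def * assms)
qed

lemma hessian_differentiable_C3:
  fixes f :: "real ^ 'n \<Rightarrow> real"
  assumes C3: "Ck_on 3 f W" and W: "open W" "xs \<in> W" and diff: "\<And>y. grad f differentiable (at y)"
  shows "hessian f differentiable (at xs)"
proof (rule differentiable_matrix)
  fix i j
  show "(\<lambda>y. hessian f y $ i $ j) differentiable (at xs)"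
    using C3 W unfolding hessian_component[OF diff] by (simp add: numeral_3_eq_3)
qed

text \<open>The mean value inequality is applied to grad f minus its linearisation on the closed
  ball about \<open>xs\<close> through \<open>y\<close>. The derivative there is a difference of
  Hessians, and differentiability of the Hessian at the centre bounds it by a multiple of the
  radius.\<close>

lemma taylor_gradient_quadratic:
  fixes f :: "real ^ 'n \<Rightarrow> real"
  assumes diff: "\<And>y. grad f differentiable (at y)" and H: "hessian f differentiable (at xs)"
  obtains C d where "0 \<le> C" "0 < d"
    "\<And>y. norm (y - xs) < d \<Longrightarrow> norm (grad f y - grad f xs - hessian f xs *v (y - xs)) \<le> C * (norm (y - xs))\<^sup>2"
proof -
  obtain C d where C: "0 \<le> C" "0 < d" "\<And>y. norm (y - xs) < d \<Longrightarrow> norm (hessian f y - hessian f xs) \<le> C * norm (y - xs)"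
    using differentiable_lipschitz_at[OF H] by blast
  have "norm (grad f y - grad f xs - hessian f xs *v (y - xs)) \<le> C * (norm (y - xs))\<^sup>2" if y: "norm (y - xs) < d" for y
  proof -
    have "norm ((grad f y - hessian f xs *v y) - (grad f xs - hessian f xs *v xs)) \<le> (C * norm (y - xs)) * norm (y - xs)"
    proof (rule differentiable_bound[of "cball xs (norm (y - xs))" _ "\<lambda>z v. hessian f z *v v - hessian f xs *v v"])
      fix z assume z: "z \<in> cball xs (norm (y - xs))"
      show "((\<lambda>y. grad f y - hessian f xs *v y) has_derivative (\<lambda>v. hessian f z *v v - hessian f xs *v v)) (at z within cball xs (norm (y - xs)))"
        by (intro has_derivative_diff has_derivative_at_withinI[OF has_derivative_grad_hessian[OF diff]]
            bounded_linear_imp_has_derivative matrix_vector_mul_bounded_linear)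
      have zy: "norm (z - xs) \<le> norm (y - xs)" using z by (simp add: dist_norm norm_minus_commute)
      show "onorm (\<lambda>v. hessian f z *v v - hessian f xs *v v) \<le> C * norm (y - xs)"
      proof (rule onorm_le)
        fix v
        have "norm (hessian f z *v v - hessian f xs *v v) \<le> norm (hessian f z - hessian f xs) * norm v"
          using norm_matrix_vector_le_norm[of "hessian f z - hessian f xs" v] by (simp add: matrix_vector_mult_diff_rdistrib)
        also have "norm (hessian f z - hessian f xs) \<le> C * norm (z - xs)" using zy y by (intro C(3)) simp
        also have "\<dots> \<le> C * norm (y - xs)" using zy C(1) by (rule mult_left_mono)
        finally show "norm (hessian f z *v v - hessian f xs *v v) \<le> C * norm (y - xs) * norm v"
          by (simp add: mult_right_mono)
      qed
    qed (auto simp: dist_norm norm_minus_commute)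
    moreover have "(grad f y - hessian f xs *v y) - (grad f xs - hessian f xs *v xs)
        = grad f y - grad f xs - hessian f xs *v (y - xs)"
      by (simp add: matrix_vector_mult_diff_distrib algebra_simps)
    ultimately show ?thesis by (simp add: power2_eq_square mult_ac)
  qed
  with C(1,2) show ?thesis using that by blast
qed

text \<open>With t the squared distance, t^2/(1 + t) is comparable to t^2 near \<open>xs\<close>,
  where the remainder is quadratic, and to t away from it, where the Lipschitz bound makes the
  remainder linear. One global inequality thus covers both ranges; the right-hand side is later
  named \<open>damped_square\<close>.\<close>

lemma taylor_gradient_remainder:
  fixes f :: "real ^ 'n \<Rightarrow> real"
  assumes diff: "\<And>y. grad f differentiable (at y)" and H: "hessian f differentiable (at xs)"
    and L: "\<And>y. op_norm (hessian f y) \<le> L"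
  obtains C where "0 < C"
    "\<And>y. (norm (grad f y - grad f xs - hessian f xs *v (y - xs)))\<^sup>2
          \<le> C * (((norm (y - xs))\<^sup>2)\<^sup>2 / (1 + (norm (y - xs))\<^sup>2))"
proof -
  obtain C d where C: "0 \<le> C" "0 < d"
    "\<And>y. norm (y - xs) < d \<Longrightarrow> norm (grad f y - grad f xs - hessian f xs *v (y - xs)) \<le> C * (norm (y - xs))\<^sup>2"
    using taylor_gradient_quadratic[OF diff H] by blast
  \<comment> \<open>The two entries bound C^2 (1 + t) for t up to d^2 and (2L)^2 (1 + 1/t) for t
    from d^2 on, the factors left after t^2/(1 + t) is split off. The added 1 makes \<open>B\<close>
    strictly positive.\<close>
  define B where "B = max (C\<^sup>2 * (1 + d\<^sup>2)) ((2 * L)\<^sup>2 * (1 + 1 / d\<^sup>2)) + 1"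
  have B: "C\<^sup>2 * (1 + d\<^sup>2) \<le> B" "(2 * L)\<^sup>2 * (1 + 1 / d\<^sup>2) \<le> B" by (auto simp: B_def)
  have "0 \<le> C\<^sup>2 * (1 + d\<^sup>2)" by simp
  then have B0: "0 < B" unfolding B_def by linarith
  have "(norm (grad f y - grad f xs - hessian f xs *v (y - xs)))\<^sup>2
          \<le> B * (((norm (y - xs))\<^sup>2)\<^sup>2 / (1 + (norm (y - xs))\<^sup>2))" for y
  proof -
    define t where "t = (norm (y - xs))\<^sup>2"
    have t0: "0 \<le> t" by (simp add: t_def)
    let ?R = "grad f y - grad f xs - hessian f xs *v (y - xs)"
    have "(norm ?R)\<^sup>2 \<le> B * (t\<^sup>2 / (1 + t))"
    proof (cases "norm (y - xs) < d")
      case True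
      have "(norm ?R)\<^sup>2 \<le> (C * t)\<^sup>2" using C(3)[OF True] by (simp add: t_def power_mono)
      also have "\<dots> = (C\<^sup>2 * (1 + t)) * (t\<^sup>2 / (1 + t))" using t0 by (simp add: field_simps power2_eq_square)
      also have "\<dots> \<le> B * (t\<^sup>2 / (1 + t))"
      proof (rule mult_right_mono)
        have "t \<le> d\<^sup>2" using True by (simp add: t_def power_mono)
        then have "C\<^sup>2 * (1 + t) \<le> C\<^sup>2 * (1 + d\<^sup>2)" by (intro mult_left_mono) auto
        with B show "C\<^sup>2 * (1 + t) \<le> B" by linarith
      qed (use t0 in auto)
      finally show ?thesis .
    next
      case False
      have td: "d\<^sup>2 \<le> t" using False C(2) by (simp add: t_def power_mono)
      have tp: "0 < t" using td C(2) by (meson less_le_trans zero_less_power)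
      have "norm ?R \<le> L * norm (y - xs) + op_norm (hessian f xs) * norm (y - xs)"
        using norm_triangle_ineq4[of "grad f y - grad f xs" "hessian f xs *v (y - xs)"]
          lipschitz_gradient[OF diff L, of y xs] norm_matrix_vector_le[of "hessian f xs" "y - xs"] by linarith
      also have "\<dots> \<le> L * norm (y - xs) + L * norm (y - xs)"
        using L by (intro add_left_mono mult_right_mono) auto
      finally have "norm ?R \<le> 2 * L * norm (y - xs)" by simp
      then have "(norm ?R)\<^sup>2 \<le> (2 * L * norm (y - xs))\<^sup>2" by (rule power_mono) simp
      also have "\<dots> = ((2*L)\<^sup>2 * (1 + 1/t)) * (t\<^sup>2 / (1 + t))"
        using tp by (simp add: t_def[symmetric] power_mult_distrib divide_simps) (simp add: algebra_simps power2_eq_square)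
      also have "\<dots> \<le> B * (t\<^sup>2 / (1 + t))"
      proof (rule mult_right_mono)
        have "1/t \<le> 1/d\<^sup>2" using td C(2) by (simp add: frac_le)
        then have "(2*L)\<^sup>2 * (1 + 1/t) \<le> (2*L)\<^sup>2 * (1 + 1/d\<^sup>2)" by (intro mult_left_mono) auto
        with B show "(2*L)\<^sup>2 * (1 + 1/t) \<le> B" by linarith
      qed (use t0 in auto)
      finally show ?thesis .
    qed
    then show ?thesis by (simp add: t_def)
  qed
  with B0 show ?thesis using that by blast
qed

section \<open>Real sequences and the damped square\<close>

text \<open>Both inequalities come from 1 + u <= exp u: once for ln (1 + 1/k) <= 1/k, once for 1 -
  r/k <= exp (-r/k).\<close>

lemma powr_minus_Suc_ge:
  assumes "k \<ge> 1" "0 \<le> r"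
  shows "real k powr (- r) * (1 - r / real k) \<le> real (Suc k) powr (- r)"
proof -
  have k: "0 < real k" using assms by simp
  have "1 + 1 / real k \<le> exp (1 / real k)" by (rule exp_ge_add_one_self)
  then have "ln (1 + 1 / real k) \<le> 1 / real k" using k by (simp add: ln_le_minus_one ln_add_one_self_le_self)
  then have "- r / real k \<le> - r * ln (1 + 1 / real k)"
    using mult_left_mono[OF _ assms(2)] by fastforce
  have "1 - r / real k \<le> exp (- r / real k)" using exp_ge_add_one_self[of "- r / real k"] by simp
  also have "\<dots> \<le> exp (- r * ln (1 + 1 / real k))" using \<open>- r / real k \<le> _\<close> by simp
  also have "\<dots> = (1 + 1 / real k) powr (- r)"
    using add_pos_pos[OF zero_less_one, of "1 / real k"] k unfolding powr_def by simp
  finally have "real k powr (- r) * (1 - r / real k) \<le> real k powr (- r) * (1 + 1 / real k) powr (- r)"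
    by (rule mult_left_mono) simp
  also have "\<dots> = (real k * (1 + 1 / real k)) powr (- r)" using k by (simp add: powr_mult)
  also have "real k * (1 + 1 / real k) = real (Suc k)" using k by (simp add: field_simps)
  finally show ?thesis .
qed

text \<open>Suppose u_k <= C k^-r. One step contracts by \<open>lam * a k\<close>, while the target
  shrinks only by 1 - r/k, and r/k is eventually at most half of \<open>lam * a k\<close> because
  \<alpha> < 1. That half pays for the shrinking of the target, the other half for the forcing term
  once C >= 2B/lam.\<close>

lemma recursion_powr_decay:
  fixes u a :: "nat \<Rightarrow> real"
  assumes lam: "0 < lam" and al: "0 < \<alpha>" "\<alpha> < 1" and c: "0 \<le> c" and r: "0 \<le> r" and B: "0 \<le> B"
    and a: "\<And>k. k \<ge> 1 \<Longrightarrow> a k = (real k + c) powr (- \<alpha>)"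
    and rec: "\<And>k. k \<ge> k0 \<Longrightarrow> k \<ge> 1 \<Longrightarrow> u (Suc k) \<le> (1 - lam * a k) * u k + B * (a k * real k powr (- r))"
  obtains C where "0 < C" "\<And>k. k \<ge> 1 \<Longrightarrow> u k \<le> C * real k powr (- r)"
proof -
  have top: "filterlim (\<lambda>k::nat. real k + c) at_top sequentially"
    using filterlim_tendsto_add_at_top[OF tendsto_const filterlim_real_sequentially] by (simp add: add.commute)
  have "(\<lambda>k::nat. lam * (real k + c) powr (- \<alpha>)) \<longlonglongrightarrow> lam * 0"
    by (intro tendsto_mult tendsto_const tendsto_neg_powr[OF _ top]) (use al in auto)
  then have "eventually (\<lambda>k::nat. lam * (real k + c) powr (- \<alpha>) < 1) sequentially"
    by (rule order_tendstoD) simp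
  then have "eventually (\<lambda>k::nat. lam * (real k + c) powr (- \<alpha>) \<le> 1) sequentially"
    by (rule eventually_mono) simp
  moreover have "eventually (\<lambda>k::nat. r / real k \<le> lam / 2 * (real k + c) powr (- \<alpha>)) sequentially"
  proof -
    have "(\<lambda>k::nat. (r * 2 powr \<alpha>) * real k powr (\<alpha> - 1)) \<longlonglongrightarrow> (r * 2 powr \<alpha>) * 0"
      by (intro tendsto_mult tendsto_const tendsto_neg_powr[OF _ filterlim_real_sequentially]) (use al in auto)
    then have "eventually (\<lambda>k::nat. (r * 2 powr \<alpha>) * real k powr (\<alpha> - 1) < lam / 2) sequentially"
      by (rule order_tendstoD) (use lam in simp)
    moreover have "eventually (\<lambda>k::nat. max 1 c \<le> real k) sequentially"
      using filterlim_real_sequentially unfolding filterlim_at_top by blast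
    ultimately show ?thesis
    proof eventually_elim
      case (elim k)
      \<comment> \<open>The factor 2^\<alpha> compensates for k + c <= 2k, valid once k >=
        c.\<close>
      have "r / real k = (r * 2 powr \<alpha> * real k powr (\<alpha> - 1)) * (2 * real k) powr (- \<alpha>)"
        using elim by (simp add: powr_mult powr_diff powr_minus field_simps)
      also have "\<dots> \<le> lam / 2 * (real k + c) powr (- \<alpha>)"
        using elim lam al c by (intro mult_mono powr_mono2') auto
      finally show ?case .
    qed
  qed
  ultimately have "eventually (\<lambda>k::nat. lam * (real k + c) powr (- \<alpha>) \<le> 1
      \<and> r / real k \<le> lam / 2 * (real k + c) powr (- \<alpha>)) sequentially"
    by (rule eventually_conj)
  then obtain k1 where k1: "\<And>k. k \<ge> k1 \<Longrightarrow> lam * (real k + c) powr (- \<alpha>) \<le> 1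
      \<and> r / real k \<le> lam / 2 * (real k + c) powr (- \<alpha>)"
    by (auto simp: eventually_sequentially)
  define m where "m = max 1 (max k0 k1)"
  \<comment> \<open>The first summand lets half of the contraction absorb \<open>B\<close>, the sum
    dominates u_k k^r on the initial stretch up to \<open>m\<close>, and the 1 gives strict
    positivity.\<close>
  define C where "C = 2 * B / lam + (\<Sum>k=1..m. \<bar>u k\<bar> * real k powr r) + 1"
  have C1: "2 * B / lam \<le> C" by (simp add: C_def sum_nonneg)
  have S0: "0 \<le> (\<Sum>k=1..m. \<bar>u k\<bar> * real k powr r)" "0 \<le> 2 * B / lam" using B lam by (simp_all add: sum_nonneg)
  have C0: "0 < C" using S0 unfolding C_def by linarith
  have small: "u k \<le> C * real k powr (- r)" if k: "1 \<le> k" "k \<le> m" for k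
  proof -
    have "\<bar>u k\<bar> * real k powr r \<le> (\<Sum>k=1..m. \<bar>u k\<bar> * real k powr r)"
      by (rule member_le_sum) (use k in auto)
    then have "\<bar>u k\<bar> * real k powr r \<le> C" using S0 unfolding C_def by linarith
    then have "\<bar>u k\<bar> * real k powr r * real k powr (-r) \<le> C * real k powr (-r)" by (rule mult_right_mono) simp
    then show ?thesis using k by (simp add: mult.assoc flip: powr_add)
  qed
  have large: "u (m + j) \<le> C * real (m + j) powr (- r)" for j
  proof (induction j)
    case 0
    show ?case using small[of m] by (simp add: m_def)
  next
    case (Suc j)
    define k where "k = m + j"
    have k: "k \<ge> 1" "k \<ge> k0" "k \<ge> k1" by (auto simp: k_def m_def)
    have ak: "lam * a k \<le> 1" "r / real k \<le> lam / 2 * a k" using k1[OF k(3)] a[OF k(1)] by auto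
    have a0: "0 \<le> a k" using a[OF k(1)] by simp
    have "u (Suc k) \<le> (1 - lam * a k) * u k + B * (a k * real k powr (- r))" using rec k by simp
    also have "\<dots> \<le> (1 - lam * a k) * (C * real k powr (- r)) + (lam * C / 2) * (a k * real k powr (- r))"
    proof (intro add_mono mult_left_mono mult_right_mono)
      show "u k \<le> C * real k powr (- r)" using Suc by (simp add: k_def)
      show "B \<le> lam * C / 2" using C1 lam by (simp add: field_simps)
    qed (use ak a0 in auto)
    also have "\<dots> = C * real k powr (-r) * (1 - lam / 2 * a k)" by (simp add: algebra_simps)
    also have "\<dots> \<le> C * real k powr (-r) * (1 - r / real k)"
      using ak C0 by (intro mult_left_mono) auto
    also have "\<dots> = C * (real k powr (-r) * (1 - r / real k))" by simp
    also have "\<dots> \<le> C * real (Suc k) powr (- r)"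
      using powr_minus_Suc_ge[OF k(1) r] C0 by (intro mult_left_mono) auto
    finally show ?case by (simp add: k_def)
  qed
  have "u k \<le> C * real k powr (- r)" if "k \<ge> 1" for k
    using small[OF that] large[of "k - m"] by (cases "k \<le> m") auto
  with C0 show ?thesis using that by blast
qed

lemma sqrt_powr: "sqrt (y powr s) = y powr (s / 2)"
proof -
  have "sqrt (y powr s) = y powr (s * (1 / 2))"
    by (simp only: powr_half_sqrt[symmetric] powr_powr powr_ge_zero)
  then show ?thesis by simp
qed

section \<open>Power sums and weighted Cesaro means\<close>

lemma powr_diff_le:
  assumes "1 \<le> s"
  shows "real (Suc k) powr s - real k powr s \<le> s * real (Suc k) powr (s - 1)"
proof (cases "k = 0")
  case False
  have "\<exists>z. real k < z \<and> z < real (Suc k) \<and> real (Suc k) powr s - real k powr s = (real (Suc k) - real k) * (s * z powr (s - 1))"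
    by (rule MVT2) (use False in \<open>auto intro!: DERIV_powr derivative_eq_intros has_real_derivative_powr\<close>)
  then obtain z where z: "real k < z" "z < real (Suc k)"
    and eq: "real (Suc k) powr s - real k powr s = s * z powr (s - 1)" by auto
  have "z powr (s - 1) \<le> real (Suc k) powr (s - 1)" using z assms by (intro powr_mono2) auto
  then show ?thesis unfolding eq using assms by (intro mult_left_mono) auto
qed (use assms in auto)

lemma powr_diff_ge:
  assumes "0 < s" "s \<le> 1"
  shows "s * real (Suc k) powr (s - 1) \<le> real (Suc k) powr s - real k powr s"
proof (cases "k = 0")
  case False
  have "\<exists>z. real k < z \<and> z < real (Suc k) \<and> real (Suc k) powr s - real k powr s = (real (Suc k) - real k) * (s * z powr (s - 1))"
    by (rule MVT2) (use False in \<open>auto intro!: DERIV_powr derivative_eq_intros has_real_derivative_powr\<close>)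
  then obtain z where z: "real k < z" "z < real (Suc k)"
    and eq: "real (Suc k) powr s - real k powr s = s * z powr (s - 1)" by auto
  have "real (Suc k) powr (s - 1) \<le> z powr (s - 1)" using z assms by (intro powr_mono2') auto
  then show ?thesis unfolding eq using assms by (intro mult_left_mono) auto
qed (use assms in auto)

lemma sum_powr_ge:
  assumes "0 \<le> q"
  shows "real k powr (q + 1) \<le> (q + 1) * (\<Sum>i=1..k. real i powr q)"
proof (induction k)
  case (Suc k)
  then show ?case using powr_diff_le[of "q + 1" k] assms by (simp add: algebra_simps)
qed (use assms in auto)

text \<open>For s <= 1 the terms decrease and telescoping k^s gives the constant 1/s; for s > 1 they
  increase and the last term bounds each of them, with constant 1. The constant 1 + 1/s serves both
  cases.\<close>

lemma sum_powr_le: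
  assumes "0 < s"
  shows "(\<Sum>i=1..k. real i powr (s - 1)) \<le> (1 + 1 / s) * real k powr s"
proof (cases "s \<le> 1")
  case True
  have "s * (\<Sum>i=1..k. real i powr (s - 1)) \<le> real k powr s"
  proof (induction k)
    case (Suc k)
    then show ?case using powr_diff_ge[OF assms True, of k] by (simp add: algebra_simps)
  qed simp
  then have "(\<Sum>i=1..k. real i powr (s - 1)) \<le> 1 / s * real k powr s" using assms by (simp add: field_simps)
  also have "\<dots> \<le> (1 + 1 / s) * real k powr s" by (rule mult_right_mono) auto
  finally show ?thesis .
next
  case False
  have "(\<Sum>i=1..k. real i powr (s - 1)) \<le> (\<Sum>i=1..k. real k powr (s - 1))"
    using False by (intro sum_mono powr_mono2) auto
  also have "\<dots> = 1 * real k powr s" by (cases "k = 0") (simp_all add: powr_diff)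
  also have "\<dots> \<le> (1 + 1 / s) * real k powr s" using assms by (intro mult_right_mono) auto
  finally show ?thesis .
qed

lemma weighted_cesaro:
  fixes w :: "nat \<Rightarrow> real" and y :: "nat \<Rightarrow> 'b::real_normed_vector"
  assumes w: "\<And>i. i \<ge> 1 \<Longrightarrow> 0 < w i"
    and W: "filterlim (\<lambda>k. \<Sum>i=1..k. w i) at_top sequentially" and y: "y \<longlonglongrightarrow> l"
  shows "(\<lambda>k. (1 / (\<Sum>i=1..k. w i)) *\<^sub>R (\<Sum>i=1..k. w i *\<^sub>R y i)) \<longlonglongrightarrow> l"
proof (rule LIMSEQ_I)
  fix e :: real assume e: "0 < e"
  define T where "T = (\<lambda>k. \<Sum>i=1..k. w i)"
  obtain m where m: "\<And>i. i \<ge> m \<Longrightarrow> norm (y i - l) < e / 2"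
    using LIMSEQ_D[OF y, of "e/2"] e by auto
  define B where "B = (\<Sum>i=1..m. w i * norm (y i - l))"
  have B0: "0 \<le> B" unfolding B_def using w by (intro sum_nonneg mult_nonneg_nonneg) (auto intro: less_imp_le)
  have "eventually (\<lambda>k. T k > 2 * B / e + 1) sequentially"
    using W unfolding T_def filterlim_at_top_dense by blast
  then obtain n where n: "\<And>k. k \<ge> n \<Longrightarrow> T k > 2 * B / e + 1" by (auto simp: eventually_sequentially)
  have "norm ((1 / T k) *\<^sub>R (\<Sum>i=1..k. w i *\<^sub>R y i) - l) < e" if k: "k \<ge> max m n" for k
  proof -
    have Tk: "T k > 2 * B / e + 1" using n k by simp
    then have T0: "0 < T k" using B0 e by (smt (verit) divide_nonneg_pos)
    have "(\<Sum>i=1..k. w i *\<^sub>R y i) = T k *\<^sub>R l + (\<Sum>i=1..k. w i *\<^sub>R (y i - l))"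
      by (simp add: T_def scaleR_diff_right sum_subtractf scaleR_sum_left)
    then have "(1 / T k) *\<^sub>R (\<Sum>i=1..k. w i *\<^sub>R y i) - l = (1 / T k) *\<^sub>R (\<Sum>i=1..k. w i *\<^sub>R (y i - l))"
      using T0 by (simp add: scaleR_add_right)
    then have "norm ((1 / T k) *\<^sub>R (\<Sum>i=1..k. w i *\<^sub>R y i) - l) = norm (\<Sum>i=1..k. w i *\<^sub>R (y i - l)) / T k"
      using T0 by simp
    also have "norm (\<Sum>i=1..k. w i *\<^sub>R (y i - l)) \<le> (\<Sum>i=1..k. w i * norm (y i - l))"
      by (rule sum_norm_le) (use w in \<open>auto simp: less_imp_le abs_of_pos\<close>)
    also have "\<dots> \<le> B + T k * (e / 2)"
    proof -
      have "{1..k} = {1..m} \<union> {m<..k}" using k by auto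
      then have "(\<Sum>i=1..k. w i * norm (y i - l)) = B + (\<Sum>i\<in>{m<..k}. w i * norm (y i - l))"
        unfolding B_def by (simp only:) (subst sum.union_disjoint, auto)
      also have "(\<Sum>i\<in>{m<..k}. w i * norm (y i - l)) \<le> (\<Sum>i\<in>{m<..k}. w i * (e / 2))"
        by (intro sum_mono mult_left_mono) (use m w in \<open>auto simp: less_imp_le\<close>)
      also have "\<dots> \<le> (\<Sum>i=1..k. w i * (e / 2))"
        by (intro sum_mono2) (use w e in \<open>auto simp: less_imp_le\<close>)
      also have "\<dots> = T k * (e / 2)" by (simp add: T_def sum_distrib_right)
      finally show ?thesis by simp
    qed
    also have "(B + T k * (e / 2)) / T k < e"
    proof -
      have "2 * B / e < T k" using Tk by linarith
      then have "B < T k * (e / 2)" using e by (simp add: field_simps)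
      then have "B + T k * (e / 2) < e * T k" by (simp add: algebra_simps)
      then show ?thesis using T0 by (simp add: divide_less_eq)
    qed
    finally show ?thesis using T0 by (simp add: divide_right_mono)
  qed
  then show "\<exists>no. \<forall>k\<ge>no. norm ((1 / (\<Sum>i=1..k. w i)) *\<^sub>R (\<Sum>i=1..k. w i *\<^sub>R y i) - l) < e"
    unfolding T_def by blast
qed

text \<open>Composed with a squared norm this behaves like \<open>|x|\<^sup>4\<close> near the critical point, where it controls the
  squared Taylor remainder of the gradient, but only like \<open>|x|\<^sup>2\<close> at infinity, so that its expectation is
  finite although the initial value has no moments beyond the second.\<close>

definition damped_square :: "real \<Rightarrow> real" where
  "damped_square t = t\<^sup>2 / (1 + t)"

lemma damped_square_measurable [measurable]: "damped_square \<in> borel_measurable borel"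
  unfolding damped_square_def by measurable

lemma damped_square_nonneg: "0 \<le> t \<Longrightarrow> 0 \<le> damped_square t"
  by (simp add: damped_square_def)

lemma damped_square_le: "0 \<le> t \<Longrightarrow> damped_square t \<le> t"
  by (simp add: damped_square_def field_simps power2_eq_square)

text \<open>An exact first-order expansion about w, whose linear coefficient is the derivative. It
  holds for increments of any size, and the remainder keeps 1 + w + \<xi> in its denominator, which
  is what tames large noise steps.\<close>

lemma damped_square_expand:
  assumes "0 \<le> w" "0 \<le> w + \<xi>"
  shows "damped_square (w + \<xi>) = damped_square w + w * (2 + w) / (1 + w)\<^sup>2 * \<xi> + \<xi>\<^sup>2 / ((1 + w)\<^sup>2 * (1 + w + \<xi>))"
proof -
  define s z where "s = 1 + w" and "z = 1 + w + \<xi>"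
  have s: "s \<noteq> 0" "z \<noteq> 0" using assms by (auto simp: s_def z_def)
  have w: "w = s - 1" "\<xi> = z - s" by (auto simp: s_def z_def)
  show ?thesis unfolding damped_square_def w using s
    by (simp add: divide_simps) (simp add: algebra_simps power2_eq_square)
qed

lemma damped_square_mono:
  assumes "0 \<le> t" "t \<le> u"
  shows "damped_square t \<le> damped_square u"
proof -
  have "0 \<le> t * (2 + t) / (1 + t)\<^sup>2 * (u - t) + (u - t)\<^sup>2 / ((1 + t)\<^sup>2 * (1 + t + (u - t)))"
    using assms by (intro add_nonneg_nonneg mult_nonneg_nonneg divide_nonneg_nonneg) auto
  then show ?thesis using damped_square_expand[of t "u - t"] assms by simp
qed

text \<open>Convexity together with the value 0 at 0. A contraction of the quadratic form thereby
  passes to the damped square with the same factor.\<close>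

lemma damped_square_contract:
  assumes "0 \<le> t" "0 \<le> c" "c \<le> 1"
  shows "damped_square (c * t) \<le> c * damped_square t"
proof -
  have "c * (1 + t) \<le> 1 + c * t" using assms by (simp add: algebra_simps)
  then have "(c * t\<^sup>2) * (c * (1 + t)) \<le> (c * t\<^sup>2) * (1 + c * t)" using assms by (intro mult_left_mono) auto
  moreover have "0 < 1 + c * t" "0 < 1 + t" using assms by (auto intro: add_pos_nonneg)
  ultimately show ?thesis
    by (simp add: damped_square_def field_simps power2_eq_square)
qed

lemma damped_square_scale:
  assumes "0 \<le> t" "1 \<le> c"
  shows "damped_square (c * t) \<le> c\<^sup>2 * damped_square t"
proof -
  have "1 + t \<le> 1 + c * t" using assms by (simp add: mult_right_mono[of 1 c t, simplified])
  then have "(c * t)\<^sup>2 / (1 + c * t) \<le> (c * t)\<^sup>2 / (1 + t)"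
    using assms by (intro divide_left_mono) (auto intro: mult_pos_pos add_pos_nonneg)
  then show ?thesis by (simp add: damped_square_def power_mult_distrib)
qed

text \<open>To be read with \<open>w\<close> the quadratic form at the drifted point y,
  \<open>Y\<close> = |y|, s = a_k |e|, A = a_k y.e and B = a_k^2 e.De. The term in \<open>A\<close>
  is kept exactly because its mean vanishes; everything else may cost only w s^2 and s^p. The
  obstacle is B^2, of order s^4, when only p <= 4 noise moments are at hand. If s <= 1 then s^4 <=
  s^p; if s > 1 is below a multiple of \<open>Y\<close>, one factor s^2 is bounded by a multiple of
  \<open>w\<close>; in the remaining case the denominator of the expansion supplies the missing
  s^2.\<close>

lemma damped_square_step:
  fixes w Y s A B b0 b d :: real
  assumes pos: "0 < d" "0 < b0" "0 \<le> Y" "0 \<le> s"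
    and w: "d * Y\<^sup>2 \<le> w" and A: "\<bar>A\<bar> \<le> Y * s" and B: "b0 * s\<^sup>2 \<le> B" "B \<le> b * s\<^sup>2"
    and nonneg: "0 \<le> w + (B - 2 * A)" and b: "0 \<le> b" and p: "2 \<le> p" "p \<le> 4"
  shows "damped_square (w + (B - 2 * A)) \<le> damped_square w - 2 * (w * (2 + w) / (1 + w)\<^sup>2) * A
     + (2 * b + 8 / d + 32 * b\<^sup>2 / (b0\<^sup>2 * d) + 2 * b\<^sup>2 + 4 * b\<^sup>2 / b0) * (w * s\<^sup>2 + s ^ p)"
proof -
  define \<xi> where "\<xi> = B - 2 * A"
  \<comment> \<open>The denominator of the remainder. The bound W >= 1 serves ordinary steps, W >= 1
    + w + \<xi> those dominated by noise.\<close>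
  define W where "W = (1 + w)\<^sup>2 * (1 + w + \<xi>)"
  define C where "C = 2 * b + 8 / d + 32 * b\<^sup>2 / (b0\<^sup>2 * d) + 2 * b\<^sup>2 + 4 * b\<^sup>2 / b0"
  have w0: "0 \<le> w" using w pos by (smt (verit) mult_nonneg_nonneg zero_le_power2)
  have W1: "1 \<le> W" "1 + w + \<xi> \<le> W"
  proof -
    have "1 \<le> (1 + w)\<^sup>2" using w0 by simp
    moreover have "1 \<le> 1 + w + \<xi>" using nonneg by (simp add: \<xi>_def)
    ultimately show "1 \<le> W" "1 + w + \<xi> \<le> W"
      unfolding W_def using mult_mono[of 1 "(1 + w)\<^sup>2" 1 "1 + w + \<xi>"] mult_right_mono[of 1 "(1 + w)\<^sup>2" "1 + w + \<xi>"] by auto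
  qed
  have B0: "0 \<le> B" using B pos by (smt (verit) mult_nonneg_nonneg zero_le_power2)
  have drift: "w * (2 + w) / (1 + w)\<^sup>2 * B \<le> 2 * b * (w * s\<^sup>2)"
  proof -
    have "w * (2 + w) \<le> 2 * w * (1 + w)\<^sup>2" using w0 by (simp add: power2_eq_square algebra_simps)
    then have "w * (2 + w) / (1 + w)\<^sup>2 \<le> 2 * w" using w0 by (simp add: divide_le_eq)
    then have "w * (2 + w) / (1 + w)\<^sup>2 * B \<le> 2 * w * (b * s\<^sup>2)" using B B0 w0 by (intro mult_mono) auto
    then show ?thesis by (simp add: mult_ac)
  qed
  have sq: "\<xi>\<^sup>2 \<le> 8 / d * (w * s\<^sup>2) + 2 * b\<^sup>2 * s ^ 4"
  proof -
    have "\<xi>\<^sup>2 \<le> 8 * A\<^sup>2 + 2 * B\<^sup>2"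
    proof -
      have "0 \<le> (B + 2 * A)\<^sup>2" by simp
      then show ?thesis by (simp add: \<xi>_def power2_eq_square algebra_simps)
    qed
    moreover have "A\<^sup>2 \<le> w * s\<^sup>2 / d"
    proof -
      have "A\<^sup>2 \<le> (Y * s)\<^sup>2" using A by (metis abs_ge_zero power2_abs power_mono)
      also have "\<dots> \<le> (w / d) * s\<^sup>2"
        unfolding power_mult_distrib using w pos by (intro mult_right_mono) (auto simp: field_simps)
      finally show ?thesis by simp
    qed
    moreover have "B\<^sup>2 \<le> b\<^sup>2 * s ^ 4"
    proof -
      have "B\<^sup>2 \<le> (b * s\<^sup>2)\<^sup>2" using B B0 by (intro power_mono) auto
      then show ?thesis by (simp add: power_mult_distrib flip: power_mult)
    qed
    ultimately show ?thesis by simp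
  qed
  have quartic: "s ^ 4 / W \<le> s ^ p + 16 / (b0\<^sup>2 * d) * (w * s\<^sup>2) + 2 / b0 * s ^ p"
  proof -
    have nn: "0 \<le> s ^ p" "0 \<le> 16 / (b0\<^sup>2 * d) * (w * s\<^sup>2)" "0 \<le> 2 / b0 * s ^ p" using pos w0 by auto
    text \<open>A large noise step that is not dominated by \<open>w\<close> makes the denominator of order \<open>s\<^sup>2\<close>.\<close>
    consider "s \<le> 1" | "1 < s" "b0 * s / 4 < Y" | "1 < s" "Y \<le> b0 * s / 4" by linarith
    then show ?thesis
    proof cases
      case 1
      have "s ^ 4 / W \<le> s ^ 4 / 1" using W1 pos by (intro divide_left_mono) auto
      also have "\<dots> \<le> s ^ p" using 1 pos p by (simp add: power_decreasing)
      finally show ?thesis using nn by linarith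
    next
      case 2
      have "(b0 * s / 4)\<^sup>2 \<le> Y\<^sup>2" using 2 pos by (intro power_mono) auto
      also have "\<dots> \<le> w / d" using w pos by (simp add: field_simps)
      finally have "s\<^sup>2 \<le> 16 / (b0\<^sup>2 * d) * w" using pos by (simp add: field_simps power2_eq_square)
      then have "s\<^sup>2 * s\<^sup>2 \<le> 16 / (b0\<^sup>2 * d) * w * s\<^sup>2" by (rule mult_right_mono) simp
      then have "s ^ 4 \<le> 16 / (b0\<^sup>2 * d) * (w * s\<^sup>2)" by (simp add: power4_eq_xxxx power2_eq_square mult_ac)
      moreover have "s ^ 4 / W \<le> s ^ 4 / 1" using W1 pos by (intro divide_left_mono) auto
      ultimately show ?thesis using nn by simp
    next
      case 3
      have "A \<le> b0 * s / 4 * s" using A 3 pos by (smt (verit) mult_right_mono)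
      then have "b0 * s\<^sup>2 / 2 \<le> \<xi>" using B(1) by (simp add: \<xi>_def power2_eq_square field_simps)
      then have Wl: "b0 * s\<^sup>2 / 2 \<le> W" using W1 w0 by linarith
      have pp: "0 < b0 * s\<^sup>2 / 2" using pos 3 by simp
      have "s ^ 4 / W \<le> s ^ 4 / (b0 * s\<^sup>2 / 2)" using Wl pp pos by (intro divide_left_mono mult_pos_pos) auto
      also have "\<dots> = 2 / b0 * s\<^sup>2" using pos 3 by (simp add: field_simps power2_eq_square power4_eq_xxxx)
      also have "\<dots> \<le> 2 / b0 * s ^ p" using pos 3 p by (intro mult_left_mono power_increasing) auto
      finally show ?thesis using nn by linarith
    qed
  qed
  have "\<xi>\<^sup>2 / W \<le> (8 / d * (w * s\<^sup>2) + 2 * b\<^sup>2 * s ^ 4) / W" using sq W1 by (intro divide_right_mono) auto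
  also have "\<dots> = 8 / d * (w * s\<^sup>2) / W + 2 * b\<^sup>2 * (s ^ 4 / W)" by (simp add: add_divide_distrib)
  also have "\<dots> \<le> 8 / d * (w * s\<^sup>2) + 2 * b\<^sup>2 * (s ^ p + 16 / (b0\<^sup>2 * d) * (w * s\<^sup>2) + 2 / b0 * s ^ p)"
  proof (intro add_mono mult_left_mono quartic)
    have "8 / d * (w * s\<^sup>2) / W \<le> 8 / d * (w * s\<^sup>2) / 1" using W1 pos w0 by (intro divide_left_mono) auto
    then show "8 / d * (w * s\<^sup>2) / W \<le> 8 / d * (w * s\<^sup>2)" by simp
  qed auto
  finally have rem: "\<xi>\<^sup>2 / W \<le> \<dots>" .
  have "damped_square (w + \<xi>) = damped_square w + w * (2 + w) / (1 + w)\<^sup>2 * \<xi> + \<xi>\<^sup>2 / W"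
    unfolding W_def by (rule damped_square_expand) (use w0 nonneg \<xi>_def in auto)
  also have "w * (2 + w) / (1 + w)\<^sup>2 * \<xi> = w * (2 + w) / (1 + w)\<^sup>2 * B - 2 * (w * (2 + w) / (1 + w)\<^sup>2) * A"
    by (simp add: \<xi>_def right_diff_distrib)
  finally have "damped_square (w + \<xi>) \<le> damped_square w - 2 * (w * (2 + w) / (1 + w)\<^sup>2) * A
     + (2 * b * (w * s\<^sup>2) + (8 / d * (w * s\<^sup>2) + 2 * b\<^sup>2 * (s ^ p + 16 / (b0\<^sup>2 * d) * (w * s\<^sup>2) + 2 / b0 * s ^ p)))"
    using rem drift by linarith
  also have "2 * b * (w * s\<^sup>2) + (8 / d * (w * s\<^sup>2) + 2 * b\<^sup>2 * (s ^ p + 16 / (b0\<^sup>2 * d) * (w * s\<^sup>2) + 2 / b0 * s ^ p))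
     = (2 * b + 8 / d + 32 * b\<^sup>2 / (b0\<^sup>2 * d)) * (w * s\<^sup>2) + (2 * b\<^sup>2 + 4 * b\<^sup>2 / b0) * s ^ p"
    by (simp add: algebra_simps)
  also have "\<dots> \<le> C * (w * s\<^sup>2) + C * s ^ p"
  proof (intro add_mono mult_right_mono)
    have "0 \<le> 2 * b" "0 \<le> 8 / d" "0 \<le> 32 * b\<^sup>2 / (b0\<^sup>2 * d)" "0 \<le> 2 * b\<^sup>2" "0 \<le> 4 * b\<^sup>2 / b0"
      using pos b by auto
    then show "2 * b + 8 / d + 32 * b\<^sup>2 / (b0\<^sup>2 * d) \<le> C" "2 * b\<^sup>2 + 4 * b\<^sup>2 / b0 \<le> C"
      unfolding C_def by linarith+
  qed (use pos w0 in auto)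
  finally show ?thesis unfolding \<xi>_def C_def by (simp add: distrib_left)
qed

text \<open>Asymptotic equivalence speaks about large k only. Boundedness of the convergent
  sequences N_k / k^q and k^q / N_k extends the comparison to all k >= 1.\<close>

lemma asymp_equiv_powr_bounds:
  fixes N :: "nat \<Rightarrow> real"
  assumes pos: "\<And>k. k \<ge> 1 \<Longrightarrow> 0 < N k"
    and asymp: "N \<sim>[sequentially] (\<lambda>k. N1 * real k powr q)" and N1: "0 < N1"
  obtains n0 n1 where "0 < n0" "\<And>k. k \<ge> 1 \<Longrightarrow> n0 * real k powr q \<le> N k"
    "\<And>k. k \<ge> 1 \<Longrightarrow> N k \<le> n1 * real k powr q"
proof -
  define h where "h = (\<lambda>k. N k / real k powr q)"
  have "\<forall>\<^sub>F k in sequentially. N k \<noteq> 0 \<or> N1 * real k powr q \<noteq> 0"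
    using eventually_ge_at_top[of 1] by eventually_elim (use pos in force)
  from asymp_equivD_strong[OF asymp this]
  have "(\<lambda>k. N1 * (N k / (N1 * real k powr q))) \<longlonglongrightarrow> N1 * 1" by (intro tendsto_mult tendsto_const)
  then have h: "h \<longlonglongrightarrow> N1" using N1 by (simp add: h_def)
  have "Bseq h" using h by (intro convergent_imp_Bseq convergentI)
  then obtain n1 where n1: "\<And>k. norm (h k) \<le> n1" by (auto simp: Bseq_def)
  have "(\<lambda>k. inverse (h k)) \<longlonglongrightarrow> inverse N1" using h N1 by (intro tendsto_inverse) auto
  then have "Bseq (\<lambda>k. inverse (h k))" by (intro convergent_imp_Bseq convergentI)
  then obtain m where m: "0 < m" "\<And>k. norm (inverse (h k)) \<le> m" by (auto simp: Bseq_def)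
  show ?thesis
  proof (rule that[of "1 / m" n1])
    show "0 < 1 / m" using m by simp
    fix k :: nat assume k: "k \<ge> 1"
    have kq: "0 < real k powr q" and hk: "0 < h k" using k pos[OF k] by (auto simp: h_def)
    show "N k \<le> n1 * real k powr q" using n1[of k] hk kq by (simp add: h_def divide_le_eq)
    have "1 / m \<le> h k" using m(2)[of k] hk m(1) by (simp add: field_simps)
    then show "1 / m * real k powr q \<le> N k" using kq by (simp add: h_def pos_le_divide_eq)
  qed
qed

section \<open>Square-integrable random vectors and conditional laws\<close>

lemma measurable_matrix_vector_mult [measurable]: "(*v) A \<in> borel_measurable borel" for A :: "real ^ 'n ^ 'n"
  by (intro borel_measurable_continuous_onI linear_continuous_on matrix_vector_mul_bounded_linear)

lemma measurable_vec_nth: "h \<in> borel_measurable M \<Longrightarrow> (\<lambda>\<omega>. h \<omega> $ i) \<in> borel_measurable M"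
  for h :: "'c \<Rightarrow> real ^ 'n"
  by (rule borel_measurable_continuous_on[where f = "\<lambda>v. v $ i"])
     (auto intro: linear_continuous_on bounded_linear_vec_nth)

text \<open>A bound on the L2 norm and not on its square, so that sums obey Minkowski's inequality
  with bound \<open>s + t\<close>. Measurability and integrability travel with the bound, since an
  integral alone would be 0 by default for a function that is not integrable.\<close>

definition L2_le :: "'a measure \<Rightarrow> ('a \<Rightarrow> 'b::euclidean_space) \<Rightarrow> real \<Rightarrow> bool" where
  "L2_le P X s \<longleftrightarrow> X \<in> borel_measurable P \<and> 0 \<le> s \<and>
     integrable P (\<lambda>\<omega>. (norm (X \<omega>))\<^sup>2) \<and> (\<integral>\<omega>. (norm (X \<omega>))\<^sup>2 \<partial>P) \<le> s\<^sup>2"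

lemma L2_leD:
  assumes "L2_le P X s"
  shows "X \<in> borel_measurable P" "0 \<le> s" "integrable P (\<lambda>\<omega>. (norm (X \<omega>))\<^sup>2)"
    "(\<integral>\<omega>. (norm (X \<omega>))\<^sup>2 \<partial>P) \<le> s\<^sup>2"
  using assms by (auto simp: L2_le_def)

lemma L2_leI_integrable:
  assumes "X \<in> borel_measurable P" "integrable P (\<lambda>\<omega>. (norm (X \<omega>))\<^sup>2)"
    "(\<integral>\<omega>. (norm (X \<omega>))\<^sup>2 \<partial>P) \<le> B"
  shows "L2_le P X (sqrt B)"
proof -
  have "0 \<le> (\<integral>\<omega>. (norm (X \<omega>))\<^sup>2 \<partial>P)" by simp
  then have "0 \<le> B" using assms(3) by linarith
  with assms show ?thesis unfolding L2_le_def by simp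
qed

lemma L2_le_mono:
  assumes "L2_le P X s" "s \<le> t"
  shows "L2_le P X t"
proof -
  note X = L2_leD[OF assms(1)]
  have "s\<^sup>2 \<le> t\<^sup>2" using X(2) assms(2) by (intro power_mono)
  then have "(\<integral>\<omega>. (norm (X \<omega>))\<^sup>2 \<partial>P) \<le> t\<^sup>2" by (rule order_trans[OF X(4)])
  then show ?thesis unfolding L2_le_def using X assms(2) by (intro conjI) auto
qed

lemma L2_le_bound:
  assumes X: "L2_le P X s" and Y: "Y \<in> borel_measurable P" and K: "0 \<le> K"
    and le: "\<And>\<omega>. \<omega> \<in> space P \<Longrightarrow> norm (Y \<omega>) \<le> K * norm (X \<omega>)"
  shows "L2_le P Y (K * s)"
proof -
  note X = L2_leD[OF X]
  have le2: "(norm (Y \<omega>))\<^sup>2 \<le> K\<^sup>2 * (norm (X \<omega>))\<^sup>2" if "\<omega> \<in> space P" for \<omega>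
    using power_mono[OF le[OF that], of 2] by (simp add: power_mult_distrib)
  have int: "integrable P (\<lambda>\<omega>. (norm (Y \<omega>))\<^sup>2)"
    by (rule Bochner_Integration.integrable_bound[OF integrable_mult_right[OF X(3), of "K\<^sup>2"]])
       (use Y le2 in auto)
  have "(\<integral>\<omega>. (norm (Y \<omega>))\<^sup>2 \<partial>P) \<le> (\<integral>\<omega>. K\<^sup>2 * (norm (X \<omega>))\<^sup>2 \<partial>P)"
    by (intro integral_mono int integrable_mult_right X(3) le2)
  also have "\<dots> \<le> (K * s)\<^sup>2" using X(4) by (simp add: power_mult_distrib mult_left_mono)
  finally show ?thesis using Y int K X(2) by (simp add: L2_le_def)
qed

lemma L2_le_mult:
  fixes X :: "'a \<Rightarrow> 'b::euclidean_space" and Y :: "'a \<Rightarrow> 'c::euclidean_space"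
  assumes X: "L2_le P X s" and Y: "L2_le P Y t"
  shows "integrable P (\<lambda>\<omega>. norm (X \<omega>) * norm (Y \<omega>))" "(\<integral>\<omega>. norm (X \<omega>) * norm (Y \<omega>) \<partial>P) \<le> s * t"
proof -
  note X = L2_leD[OF X] and Y = L2_leD[OF Y]
  note [measurable] = X(1) Y(1)
  show int: "integrable P (\<lambda>\<omega>. norm (X \<omega>) * norm (Y \<omega>))"
  proof (rule Bochner_Integration.integrable_bound[OF Bochner_Integration.integrable_add[OF X(3) Y(3)]])
    show "AE \<omega> in P. norm (norm (X \<omega>) * norm (Y \<omega>)) \<le> norm ((norm (X \<omega>))\<^sup>2 + (norm (Y \<omega>))\<^sup>2)"
    proof (rule AE_I2)
      fix \<omega>
      have "2 * (norm (X \<omega>) * norm (Y \<omega>)) \<le> (norm (X \<omega>))\<^sup>2 + (norm (Y \<omega>))\<^sup>2"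
        using sum_squares_bound[of "norm (X \<omega>)" "norm (Y \<omega>)"] by simp
      moreover have "0 \<le> norm (X \<omega>) * norm (Y \<omega>)" by simp
      ultimately have "norm (X \<omega>) * norm (Y \<omega>) \<le> (norm (X \<omega>))\<^sup>2 + (norm (Y \<omega>))\<^sup>2" by linarith
      then show "norm (norm (X \<omega>) * norm (Y \<omega>)) \<le> norm ((norm (X \<omega>))\<^sup>2 + (norm (Y \<omega>))\<^sup>2)" by simp
    qed
  qed simp
  define J where "J = (\<integral>\<omega>. norm (X \<omega>) * norm (Y \<omega>) \<partial>P)"
  define a b where "a = (\<integral>\<omega>. (norm (X \<omega>))\<^sup>2 \<partial>P)" and "b = (\<integral>\<omega>. (norm (Y \<omega>))\<^sup>2 \<partial>P)"
  have nn: "0 \<le> J" "0 \<le> a" "0 \<le> b" by (simp_all add: J_def a_def b_def)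
  have "(\<integral>\<^sup>+\<omega>. ennreal (norm (X \<omega>)) * ennreal (norm (Y \<omega>)) \<partial>P)\<^sup>2
      \<le> (\<integral>\<^sup>+\<omega>. ennreal (norm (X \<omega>)) ^ 2 \<partial>P) * (\<integral>\<^sup>+\<omega>. ennreal (norm (Y \<omega>)) ^ 2 \<partial>P)"
    by (rule Cauchy_Schwarz_nn_integral) auto
  also have "(\<integral>\<^sup>+\<omega>. ennreal (norm (X \<omega>)) * ennreal (norm (Y \<omega>)) \<partial>P) = ennreal J"
    using nn_integral_eq_integral[OF int] by (simp add: J_def ennreal_mult)
  also have "(\<integral>\<^sup>+\<omega>. ennreal (norm (X \<omega>)) ^ 2 \<partial>P) = ennreal a"
    using nn_integral_eq_integral[OF X(3)] by (simp add: a_def ennreal_power)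
  also have "(\<integral>\<^sup>+\<omega>. ennreal (norm (Y \<omega>)) ^ 2 \<partial>P) = ennreal b"
    using nn_integral_eq_integral[OF Y(3)] by (simp add: b_def ennreal_power)
  finally have "J\<^sup>2 \<le> a * b" using nn by (simp add: ennreal_power flip: ennreal_mult)
  also have "\<dots> \<le> s\<^sup>2 * t\<^sup>2" using X(4) Y(4) nn by (intro mult_mono) (auto simp: a_def b_def)
  finally have "J\<^sup>2 \<le> (s * t)\<^sup>2" by (simp add: power_mult_distrib)
  then have "J \<le> s * t"
    by (rule power2_le_imp_le) (use X(2) Y(2) in simp)
  then show "(\<integral>\<omega>. norm (X \<omega>) * norm (Y \<omega>) \<partial>P) \<le> s * t" by (simp add: J_def)
qed

lemma L2_le_inner:
  assumes X: "L2_le P X s" and Y: "L2_le P Y t"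
  shows "integrable P (\<lambda>\<omega>. X \<omega> \<bullet> Y \<omega>)"
  by (rule Bochner_Integration.integrable_bound[OF L2_le_mult(1)[OF X Y]])
     (use L2_leD(1)[OF X] L2_leD(1)[OF Y] Cauchy_Schwarz_ineq2 in auto)

lemma L2_le_add:
  fixes X Y :: "'a \<Rightarrow> 'b::euclidean_space"
  assumes X: "L2_le P X s" and Y: "L2_le P Y t"
  shows "L2_le P (\<lambda>\<omega>. X \<omega> + Y \<omega>) (s + t)"
proof -
  note XY = L2_le_mult[OF X Y] L2_le_inner[OF X Y]
  note X = L2_leD[OF X] and Y = L2_leD[OF Y]
  have eq: "(norm (X \<omega> + Y \<omega>))\<^sup>2 = (norm (X \<omega>))\<^sup>2 + (2 * (X \<omega> \<bullet> Y \<omega>) + (norm (Y \<omega>))\<^sup>2)" for \<omega>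
    by (simp add: power2_norm_eq_inner inner_add inner_commute)
  have int: "integrable P (\<lambda>\<omega>. (norm (X \<omega> + Y \<omega>))\<^sup>2)"
    unfolding eq by (intro Bochner_Integration.integrable_add integrable_mult_right X Y XY)
  have "(\<integral>\<omega>. (norm (X \<omega> + Y \<omega>))\<^sup>2 \<partial>P) \<le>
      (\<integral>\<omega>. (norm (X \<omega>))\<^sup>2 + (2 * (norm (X \<omega>) * norm (Y \<omega>)) + (norm (Y \<omega>))\<^sup>2) \<partial>P)"
    by (intro integral_mono int Bochner_Integration.integrable_add integrable_mult_right X Y XY)
       (simp add: eq norm_cauchy_schwarz)
  also have "\<dots> = (\<integral>\<omega>. (norm (X \<omega>))\<^sup>2 \<partial>P) + (2 * (\<integral>\<omega>. norm (X \<omega>) * norm (Y \<omega>) \<partial>P) + (\<integral>\<omega>. (norm (Y \<omega>))\<^sup>2 \<partial>P))"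
    using X Y XY by simp
  also have "\<dots> \<le> s\<^sup>2 + (2 * (s * t) + t\<^sup>2)" using X Y XY by (intro add_mono mult_left_mono) auto
  also have "\<dots> = (s + t)\<^sup>2" by (simp add: power2_eq_square algebra_simps)
  finally show ?thesis using int X Y by (simp add: L2_le_def)
qed

lemma L2_le_scaleR:
  assumes "L2_le P X s"
  shows "L2_le P (\<lambda>\<omega>. c *\<^sub>R X \<omega>) (\<bar>c\<bar> * s)"
  by (rule L2_le_bound[OF assms]) (use L2_leD(1)[OF assms] in auto)

lemma L2_le_diff:
  assumes X: "L2_le P X s" and Y: "L2_le P Y t"
  shows "L2_le P (\<lambda>\<omega>. X \<omega> - Y \<omega>) (s + t)"
  using L2_le_add[OF X L2_le_scaleR[OF Y, of "-1"]] by simp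

lemma L2_le_zero: "L2_le P (\<lambda>_. 0) 0"
  by (simp add: L2_le_def)

lemma L2_le_sum:
  assumes "\<And>i. i \<in> I \<Longrightarrow> L2_le P (X i) (s i)"
  shows "L2_le P (\<lambda>\<omega>. \<Sum>i\<in>I. X i \<omega>) (\<Sum>i\<in>I. s i)"
  using assms
  by (induction I rule: infinite_finite_induct) (auto intro: L2_le_add L2_le_zero)

lemma L2_le_matrix:
  fixes X :: "'a \<Rightarrow> real ^ 'n" and A :: "real ^ 'n ^ 'n"
  assumes "L2_le P X s"
  shows "L2_le P (\<lambda>\<omega>. A *v X \<omega>) (onorm ((*v) A) * s)"
proof (rule L2_le_bound[OF assms])
  show "(\<lambda>\<omega>. A *v X \<omega>) \<in> borel_measurable P"
    by (rule measurable_compose[OF L2_leD(1)[OF assms] measurable_matrix_vector_mult])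
qed (auto intro: onorm matrix_vector_mul_bounded_linear onorm_pos_le)

text \<open>Summation by parts leaves boundary terms of size C sqrt(b_k) and terms with weights
  b_(k+1) - b_k. Since (b_(k+1) - b_k) / sqrt(b_(k+1)) <= 2 (sqrt(b_(k+1)) - sqrt(b_k)), the latter
  telescope to the same order.\<close>

lemma L2_le_abel_sum:
  fixes X :: "nat \<Rightarrow> 'a \<Rightarrow> 'b::euclidean_space" and b :: "nat \<Rightarrow> real"
  assumes pos: "\<And>i. i \<ge> 1 \<Longrightarrow> 0 < b i" and mono: "\<And>i. i \<ge> 1 \<Longrightarrow> b i \<le> b (Suc i)"
    and X: "\<And>i. i \<ge> 1 \<Longrightarrow> L2_le P (X i) (C / sqrt (b i))" and k: "k \<ge> 1"
  shows "L2_le P (\<lambda>\<omega>. \<Sum>i=1..k. b i *\<^sub>R (X (Suc i) \<omega> - X i \<omega>)) (3 * C * sqrt (b k))"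
proof -
  have C: "0 \<le> C"
    using L2_leD(2)[OF X[of 1]] pos[of 1] by (simp add: zero_le_divide_iff)
  have step: "b j / sqrt (b j) = sqrt (b j)" if "j \<ge> 1" for j
    using pos[OF that] by (simp add: real_div_sqrt)
  \<comment> \<open>The upper boundary term is subtracted for the induction: what remains changes in
    each step only by an increment of \<open>b\<close> times a single iterate. It is added back at
    the end at the cost of one more C sqrt(b_k).\<close>
  have "L2_le P (\<lambda>\<omega>. (\<Sum>i=1..k. b i *\<^sub>R (X (Suc i) \<omega> - X i \<omega>)) - b k *\<^sub>R X (Suc k) \<omega>) (2 * C * sqrt (b k))"
    using k
  proof (induction k rule: nat_induct_at_least)
    case base
    have "L2_le P (\<lambda>\<omega>. (- b 1) *\<^sub>R X 1 \<omega>) (\<bar>- b 1\<bar> * (C / sqrt (b 1)))"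
      by (rule L2_le_scaleR[OF X]) simp
    then have "L2_le P (\<lambda>\<omega>. (- b 1) *\<^sub>R X 1 \<omega>) (2 * C * sqrt (b 1))"
    proof (rule L2_le_mono)
      have "\<bar>- b 1\<bar> * (C / sqrt (b 1)) = C * (b 1 / sqrt (b 1))" using pos[of 1] by simp
      also have "\<dots> = C * sqrt (b 1)" by (simp add: step)
      finally show "\<bar>- b 1\<bar> * (C / sqrt (b 1)) \<le> 2 * C * sqrt (b 1)" using C pos[of 1] by simp
    qed
    then show ?case by (simp add: algebra_simps)
  next
    case (Suc k)
    let ?b = "b (Suc k)"
    have b: "0 < b k" "0 < ?b" "b k \<le> ?b" using pos mono Suc by auto
    have "L2_le P (\<lambda>\<omega>. ((\<Sum>i=1..k. b i *\<^sub>R (X (Suc i) \<omega> - X i \<omega>)) - b k *\<^sub>R X (Suc k) \<omega>)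
        + (- (?b - b k)) *\<^sub>R X (Suc k) \<omega>)
        (2 * C * sqrt (b k) + \<bar>- (?b - b k)\<bar> * (C / sqrt ?b))"
      by (intro L2_le_add Suc.IH L2_le_scaleR X) (use Suc in auto)
    then have "L2_le P (\<lambda>\<omega>. ((\<Sum>i=1..k. b i *\<^sub>R (X (Suc i) \<omega> - X i \<omega>)) - b k *\<^sub>R X (Suc k) \<omega>)
        + (- (?b - b k)) *\<^sub>R X (Suc k) \<omega>) (2 * C * sqrt ?b)"
    proof (rule L2_le_mono)
      have "?b - b k = (sqrt ?b - sqrt (b k)) * (sqrt ?b + sqrt (b k))"
        using b by (simp add: algebra_simps)
      also have "\<dots> \<le> (sqrt ?b - sqrt (b k)) * (2 * sqrt ?b)"
        using b by (intro mult_left_mono) auto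
      finally have "(?b - b k) / sqrt ?b \<le> 2 * (sqrt ?b - sqrt (b k))"
        using b by (simp add: divide_le_eq mult_ac right_diff_distrib)
      then have "C * ((?b - b k) / sqrt ?b) \<le> C * (2 * (sqrt ?b - sqrt (b k)))"
        using C by (rule mult_left_mono)
      then show "2 * C * sqrt (b k) + \<bar>- (?b - b k)\<bar> * (C / sqrt ?b) \<le> 2 * C * sqrt ?b"
        using b by (simp add: algebra_simps)
    qed
    then show ?case by (simp add: algebra_simps)
  qed
  then have "L2_le P (\<lambda>\<omega>. ((\<Sum>i=1..k. b i *\<^sub>R (X (Suc i) \<omega> - X i \<omega>)) - b k *\<^sub>R X (Suc k) \<omega>) + b k *\<^sub>R X (Suc k) \<omega>)
      (2 * C * sqrt (b k) + \<bar>b k\<bar> * (C / sqrt (b (Suc k))))"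
    by (intro L2_le_add L2_le_scaleR X) auto
  then have "L2_le P (\<lambda>\<omega>. ((\<Sum>i=1..k. b i *\<^sub>R (X (Suc i) \<omega> - X i \<omega>)) - b k *\<^sub>R X (Suc k) \<omega>) + b k *\<^sub>R X (Suc k) \<omega>)
      (3 * C * sqrt (b k))"
  proof (rule L2_le_mono)
    have b: "0 < b k" "b k \<le> b (Suc k)" using pos mono k by auto
    have "b k * (C / sqrt (b (Suc k))) \<le> b k * (C / sqrt (b k))"
      using b C by (intro mult_left_mono divide_left_mono mult_pos_pos) auto
    also have "\<dots> = C * (b k / sqrt (b k))" by simp
    also have "\<dots> = C * sqrt (b k)" by (simp add: step[OF k])
    finally show "2 * C * sqrt (b k) + \<bar>b k\<bar> * (C / sqrt (b (Suc k))) \<le> 3 * C * sqrt (b k)"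
      using b by (simp add: mult_ac)
  qed
  then show ?thesis by simp
qed

section \<open>Conditional laws and conditional moments\<close>

lemma measurable_sigma_gen: "X \<in> borel_measurable (sigma_gen P X)"
  unfolding sigma_gen_def by (rule measurable_vimage_algebra1) simp

lemma subalgebra_sigma_gen:
  assumes "X \<in> borel_measurable P"
  shows "subalgebra P (sigma_gen P X)"
  using sets_image_in_sets[OF refl assms] unfolding subalgebra_def sigma_gen_def by simp

lemma cond_law_kernel:
  assumes "cond_law P X Y \<kappa>"
  shows "\<kappa> \<in> borel \<rightarrow>\<^sub>M subprob_algebra borel" "sets (\<kappa> x) = sets borel" "space (\<kappa> x) = UNIV" "prob_space (\<kappa> x)"
proof -
  have k: "\<kappa> \<in> borel \<rightarrow>\<^sub>M prob_algebra borel" using assms by (simp add: cond_law_def)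
  show "\<kappa> \<in> borel \<rightarrow>\<^sub>M subprob_algebra borel" by (rule measurable_prob_algebraD[OF k])
  have "\<kappa> x \<in> space (prob_algebra borel)" using measurable_space[OF k, of x] by simp
  then show s: "sets (\<kappa> x) = sets borel" and "prob_space (\<kappa> x)" by (auto simp: space_prob_algebra)
  show "space (\<kappa> x) = UNIV" using sets_eq_imp_space_eq[OF s] by simp
qed

text \<open>The disintegration formula. The definition of \<open>cond_law\<close> covers indicators
  only; linearity and monotone convergence carry it to nonnegative Borel functions, with the weight
  \<open>w\<close> fixed throughout.\<close>

lemma cond_law_nn_integral:
  fixes X :: "'a \<Rightarrow> 'b::topological_space" and Y :: "'a \<Rightarrow> 'c::topological_space"
  assumes P: "prob_space P" and X: "X \<in> borel_measurable P" and Y: "Y \<in> borel_measurable P"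
    and law: "cond_law P X Y \<kappa>"
    and h: "h \<in> borel_measurable borel" and w: "w \<in> borel_measurable borel"
  shows "(\<integral>\<^sup>+\<omega>. w (X \<omega>) * h (Y \<omega>) \<partial>P) = (\<integral>\<^sup>+\<omega>. w (X \<omega>) * (\<integral>\<^sup>+e. h e \<partial>\<kappa> (X \<omega>)) \<partial>P)"
proof -
  interpret prob_space P by fact
  interpret S: finite_measure_subalgebra P "sigma_gen P X"
    by unfold_locales (rule subalgebra_sigma_gen[OF X])
  note [measurable] = X Y w
  note ker = cond_law_kernel[OF law]
  have meas: "(\<lambda>x. \<integral>\<^sup>+e. g e \<partial>\<kappa> x) \<in> borel_measurable borel" if "g \<in> borel_measurable borel" for g
    by (rule measurable_compose[OF ker(1) nn_integral_measurable_subprob_algebra[OF that]])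
  have meas2[measurable]: "(\<lambda>\<omega>. \<integral>\<^sup>+e. g e \<partial>\<kappa> (X \<omega>)) \<in> borel_measurable P" if "g \<in> borel_measurable borel" for g
    by (rule measurable_compose[OF X meas[OF that]])
  have kmeas: "g \<in> borel_measurable (\<kappa> x)" if "g \<in> borel_measurable borel" for g :: "'c \<Rightarrow> ennreal" and x
    using that ker(2) by (simp cong: measurable_cong_sets)
  have wX: "(\<lambda>\<omega>. w (X \<omega>)) \<in> borel_measurable (sigma_gen P X)"
    by (rule measurable_compose[OF measurable_sigma_gen w])
  from h show ?thesis
  proof (induction rule: borel_measurable_induct)
    case (cong f g)
    then have "f = g" by auto
    with cong show ?case by simp
  next
    case (set B)
    then have B[measurable]: "B \<in> sets borel" by simp
    let ?i = "\<lambda>\<omega>. indicator B (Y \<omega>) :: real"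
    \<comment> \<open>\<open>real_cond_exp\<close> is a difference of two extended nonnegative
      conditional expectations mapped to the reals, where an infinite value would become 0. For an
      indicator the first is at most 1 and the second vanishes almost everywhere, so the real
      equation can be lifted back.\<close>
    have "AE \<omega> in P. nn_cond_exp P (sigma_gen P X) (\<lambda>\<omega>. ennreal (?i \<omega>)) \<omega> \<le> nn_cond_exp P (sigma_gen P X) (\<lambda>\<omega>. 1) \<omega>"
      by (rule S.nn_cond_exp_mono) (auto simp: indicator_def)
    moreover have "AE \<omega> in P. 1 = nn_cond_exp P (sigma_gen P X) (\<lambda>\<omega>. 1) \<omega>"
      by (rule S.nn_cond_exp_F_meas) simp
    moreover have "AE \<omega> in P. 0 = nn_cond_exp P (sigma_gen P X) (\<lambda>\<omega>. 0) \<omega>"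
      by (rule S.nn_cond_exp_F_meas) simp
    moreover have "AE \<omega> in P. real_cond_exp P (sigma_gen P X) ?i \<omega> = measure (\<kappa> (X \<omega>)) B"
      using law B by (simp add: cond_law_def)
    ultimately have "AE \<omega> in P. nn_cond_exp P (sigma_gen P X) (\<lambda>\<omega>. ennreal (?i \<omega>)) \<omega> = emeasure (\<kappa> (X \<omega>)) B"
    proof eventually_elim
      case (elim \<omega>)
      have "(\<lambda>\<omega>. ennreal (- ?i \<omega>)) = (\<lambda>_. 0)" by (auto simp: indicator_def ennreal_neg)
      then have "enn2real (nn_cond_exp P (sigma_gen P X) (\<lambda>\<omega>. ennreal (?i \<omega>)) \<omega>) = measure (\<kappa> (X \<omega>)) B"
        using elim by (simp add: real_cond_exp_def)
      moreover have "nn_cond_exp P (sigma_gen P X) (\<lambda>\<omega>. ennreal (?i \<omega>)) \<omega> < top"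
        using elim by (metis ennreal_one_less_top le_less_trans)
      ultimately have "nn_cond_exp P (sigma_gen P X) (\<lambda>\<omega>. ennreal (?i \<omega>)) \<omega> = ennreal (measure (\<kappa> (X \<omega>)) B)"
        by (metis ennreal_enn2real)
      also have "\<dots> = emeasure (\<kappa> (X \<omega>)) B"
        using prob_space.finite_measure[OF ker(4), of "X \<omega>"] by (simp add: finite_measure.emeasure_eq_measure)
      finally show ?case .
    qed
    then have "(\<integral>\<^sup>+\<omega>. w (X \<omega>) * nn_cond_exp P (sigma_gen P X) (\<lambda>\<omega>. ennreal (?i \<omega>)) \<omega> \<partial>P)
        = (\<integral>\<^sup>+\<omega>. w (X \<omega>) * emeasure (\<kappa> (X \<omega>)) B \<partial>P)"
      by (intro nn_integral_cong_AE) (auto elim: eventually_mono)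
    moreover have "(\<integral>\<^sup>+\<omega>. w (X \<omega>) * nn_cond_exp P (sigma_gen P X) (\<lambda>\<omega>. ennreal (?i \<omega>)) \<omega> \<partial>P)
        = (\<integral>\<^sup>+\<omega>. w (X \<omega>) * ennreal (?i \<omega>) \<partial>P)"
      by (rule S.nn_cond_exp_intg[OF wX]) simp
    ultimately show ?case
      using ker(2) B by (simp add: ennreal_indicator)
  next
    case (mult u c)
    have "(\<integral>\<^sup>+\<omega>. w (X \<omega>) * (c * u (Y \<omega>)) \<partial>P) = c * (\<integral>\<^sup>+\<omega>. w (X \<omega>) * u (Y \<omega>) \<partial>P)"
      using mult(2) by (simp add: mult.left_commute[of _ c] nn_integral_cmult)
    also have "\<dots> = (\<integral>\<^sup>+\<omega>. w (X \<omega>) * (c * (\<integral>\<^sup>+e. u e \<partial>\<kappa> (X \<omega>))) \<partial>P)"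
      using mult(2) by (simp add: mult(4) mult.left_commute[of _ c] nn_integral_cmult)
    finally show ?case using kmeas[OF mult(2)] by (simp add: nn_integral_cmult)
  next
    case (add u v)
    then show ?case using kmeas[OF add(1)] kmeas[OF add(3)]
      by (simp add: distrib_left nn_integral_add)
  next
    case (seq U)
    have [measurable]: "U i \<in> borel_measurable borel" for i using seq by simp
    have inc: "incseq (\<lambda>i \<omega>. w (X \<omega>) * U i (Y \<omega>))" "incseq (\<lambda>i \<omega>. w (X \<omega>) * (\<integral>\<^sup>+e. U i e \<partial>\<kappa> (X \<omega>)))"
      using seq(3) by (auto simp: incseq_def le_fun_def intro!: mult_left_mono nn_integral_mono)
    have S: "(SUP i. U i) x = (SUP i. U i x)" for x by (simp add: image_image)
    have "(\<integral>\<^sup>+\<omega>. w (X \<omega>) * (SUP i. U i) (Y \<omega>) \<partial>P) = (\<integral>\<^sup>+\<omega>. (SUP i. w (X \<omega>) * U i (Y \<omega>)) \<partial>P)"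
      by (simp add: SUP_mult_left_ennreal image_image)
    also have "\<dots> = (SUP i. \<integral>\<^sup>+\<omega>. w (X \<omega>) * U i (Y \<omega>) \<partial>P)"
      by (rule nn_integral_monotone_convergence_SUP[OF inc(1)]) simp
    also have "\<dots> = (SUP i. \<integral>\<^sup>+\<omega>. w (X \<omega>) * (\<integral>\<^sup>+e. U i e \<partial>\<kappa> (X \<omega>)) \<partial>P)"
      using seq by simp
    also have "\<dots> = (\<integral>\<^sup>+\<omega>. (SUP i. w (X \<omega>) * (\<integral>\<^sup>+e. U i e \<partial>\<kappa> (X \<omega>))) \<partial>P)"
      by (rule nn_integral_monotone_convergence_SUP[OF inc(2), symmetric]) simp
    also have "\<dots> = (\<integral>\<^sup>+\<omega>. w (X \<omega>) * (\<integral>\<^sup>+e. (SUP i. U i) e \<partial>\<kappa> (X \<omega>)) \<partial>P)"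
      using seq(3) kmeas[of "U _"]
      by (simp add: SUP_mult_left_ennreal nn_integral_monotone_convergence_SUP image_image)
    finally show ?case .
  qed
qed

text \<open>The signed case, needed for the entries of the covariance: positive and negative parts
  are treated separately, and the bound uniform in the conditioning value makes both
  integrable.\<close>

lemma cond_law_integral:
  fixes X :: "'a \<Rightarrow> 'b::topological_space" and Y :: "'a \<Rightarrow> 'c::topological_space" and h :: "'c \<Rightarrow> real"
  assumes P: "prob_space P" and X: "X \<in> borel_measurable P" and Y: "Y \<in> borel_measurable P"
    and law: "cond_law P X Y \<kappa>"
    and h: "h \<in> borel_measurable borel"
    and bound: "\<And>x. (\<integral>\<^sup>+e. ennreal \<bar>h e\<bar> \<partial>\<kappa> x) \<le> ennreal B"
  shows "integrable P (\<lambda>\<omega>. h (Y \<omega>))" "integrable P (\<lambda>\<omega>. \<integral>e. h e \<partial>\<kappa> (X \<omega>))"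
    "(\<integral>\<omega>. h (Y \<omega>) \<partial>P) = (\<integral>\<omega>. (\<integral>e. h e \<partial>\<kappa> (X \<omega>)) \<partial>P)"
proof -
  interpret prob_space P by fact
  note [measurable] = X Y h
  note ker = cond_law_kernel[OF law]
  have meas: "(\<lambda>x. \<integral>\<^sup>+e. g e \<partial>\<kappa> x) \<in> borel_measurable borel" if "g \<in> borel_measurable borel" for g
    by (rule measurable_compose[OF ker(1) nn_integral_measurable_subprob_algebra[OF that]])
  have kmeas: "h \<in> borel_measurable (\<kappa> x)" for x
    using h ker(2) by (simp cong: measurable_cong_sets)
  have hint: "integrable (\<kappa> x) h" for x
    using kmeas bound[of x] by (intro integrableI_bounded) (auto intro: le_less_trans)
  define p n where "p = (\<lambda>x. enn2real (\<integral>\<^sup>+e. ennreal (h e) \<partial>\<kappa> x))" and "n = (\<lambda>x. enn2real (\<integral>\<^sup>+e. ennreal (- h e) \<partial>\<kappa> x))"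
  have fin: "(\<integral>\<^sup>+e. ennreal (h e) \<partial>\<kappa> x) \<le> ennreal B" "(\<integral>\<^sup>+e. ennreal (- h e) \<partial>\<kappa> x) \<le> ennreal B" for x
    using bound[of x] by (auto intro!: order_trans[OF nn_integral_mono bound[of x]] ennreal_leI)
  have pe: "ennreal (p x) = (\<integral>\<^sup>+e. ennreal (h e) \<partial>\<kappa> x)" and ne: "ennreal (n x) = (\<integral>\<^sup>+e. ennreal (- h e) \<partial>\<kappa> x)" for x
    using fin[of x] by (auto simp: p_def n_def intro!: ennreal_enn2real intro: le_less_trans)
  have pn_meas: "p \<in> borel_measurable borel" "n \<in> borel_measurable borel"
    unfolding p_def n_def using meas by measurable
  have pn0: "0 \<le> p x" "0 \<le> n x" for x by (auto simp: p_def n_def)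
  \<comment> \<open>The sign of \<open>B\<close> is not fixed and \<open>ennreal\<close> sends
    negative numbers to 0, so the absolute value gives a bound that holds in either case.\<close>
  have pn_le: "p x \<le> \<bar>B\<bar>" "n x \<le> \<bar>B\<bar>" for x
  proof -
    have "ennreal (p x) \<le> ennreal \<bar>B\<bar>" "ennreal (n x) \<le> ennreal \<bar>B\<bar>"
      unfolding pe ne using fin[of x] by (auto intro: order_trans ennreal_leI)
    then show "p x \<le> \<bar>B\<bar>" "n x \<le> \<bar>B\<bar>" by auto
  qed
  have pX: "(\<lambda>\<omega>. p (X \<omega>)) \<in> borel_measurable P" "(\<lambda>\<omega>. n (X \<omega>)) \<in> borel_measurable P"
    by (rule measurable_compose[OF X pn_meas(1)], rule measurable_compose[OF X pn_meas(2)])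
  have pint: "integrable P (\<lambda>\<omega>. p (X \<omega>))" "integrable P (\<lambda>\<omega>. n (X \<omega>))"
    by (intro integrable_const_bound[of _ "\<bar>B\<bar>"]; use pX pn0 pn_le in simp)+
  have keq: "(\<integral>e. h e \<partial>\<kappa> x) = p x - n x" for x
    unfolding p_def n_def by (rule real_lebesgue_integral_def[OF hint])
  have hp: "(\<integral>\<^sup>+\<omega>. ennreal (h (Y \<omega>)) \<partial>P) = (\<integral>\<^sup>+\<omega>. ennreal (p (X \<omega>)) \<partial>P)"
    using cond_law_nn_integral[OF P X Y law, of "\<lambda>e. ennreal (h e)" "\<lambda>_. 1"] by (simp add: pe)
  have hn: "(\<integral>\<^sup>+\<omega>. ennreal (- h (Y \<omega>)) \<partial>P) = (\<integral>\<^sup>+\<omega>. ennreal (n (X \<omega>)) \<partial>P)"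
    using cond_law_nn_integral[OF P X Y law, of "\<lambda>e. ennreal (- h e)" "\<lambda>_. 1"] by (simp add: ne)
  have ip: "(\<integral>\<^sup>+\<omega>. ennreal (p (X \<omega>)) \<partial>P) = ennreal (\<integral>\<omega>. p (X \<omega>) \<partial>P)"
    "(\<integral>\<^sup>+\<omega>. ennreal (n (X \<omega>)) \<partial>P) = ennreal (\<integral>\<omega>. n (X \<omega>) \<partial>P)"
    by (intro nn_integral_eq_integral pint; simp add: pn0)+
  show hY: "integrable P (\<lambda>\<omega>. h (Y \<omega>))"
    unfolding real_integrable_def hp hn ip by simp
  show "integrable P (\<lambda>\<omega>. \<integral>e. h e \<partial>\<kappa> (X \<omega>))"
    unfolding keq by (intro Bochner_Integration.integrable_diff pint)
  have "(\<integral>\<omega>. h (Y \<omega>) \<partial>P) = (\<integral>\<omega>. p (X \<omega>) \<partial>P) - (\<integral>\<omega>. n (X \<omega>) \<partial>P)"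
    unfolding real_lebesgue_integral_def[OF hY] hp hn ip by (simp add: pn0)
  then show "(\<integral>\<omega>. h (Y \<omega>) \<partial>P) = (\<integral>\<omega>. (\<integral>e. h e \<partial>\<kappa> (X \<omega>)) \<partial>P)"
    unfolding keq using pint by simp
qed

text \<open>A conditional moment bound that is uniform in the conditioning value survives any weight
  depending on that value. The weight used later is the quadratic form at the drifted iterate, which
  decouples the product of squared error and squared noise.\<close>

lemma cond_law_moment:
  fixes X :: "'a \<Rightarrow> 'b::topological_space" and Y :: "'a \<Rightarrow> 'c::topological_space" and h :: "'c \<Rightarrow> real"
  assumes P: "prob_space P" and X: "X \<in> borel_measurable P" and Y: "Y \<in> borel_measurable P"
    and law: "cond_law P X Y \<kappa>"
    and h: "h \<in> borel_measurable borel" "\<And>e. 0 \<le> h e" and B: "0 \<le> B"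
    and bound: "\<And>x. (\<integral>\<^sup>+e. ennreal (h e) \<partial>\<kappa> x) \<le> ennreal B"
    and w: "w \<in> borel_measurable borel" "\<And>x. 0 \<le> w x" "integrable P (\<lambda>\<omega>. w (X \<omega>))"
  shows "integrable P (\<lambda>\<omega>. w (X \<omega>) * h (Y \<omega>))"
    "(\<integral>\<omega>. w (X \<omega>) * h (Y \<omega>) \<partial>P) \<le> B * (\<integral>\<omega>. w (X \<omega>) \<partial>P)"
proof -
  note [measurable] = X Y h(1) w(1)
  have "(\<integral>\<^sup>+\<omega>. ennreal (w (X \<omega>) * h (Y \<omega>)) \<partial>P) = (\<integral>\<^sup>+\<omega>. ennreal (w (X \<omega>)) * ennreal (h (Y \<omega>)) \<partial>P)"
    using h w by (simp add: ennreal_mult)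
  also have "\<dots> = (\<integral>\<^sup>+\<omega>. ennreal (w (X \<omega>)) * (\<integral>\<^sup>+e. ennreal (h e) \<partial>\<kappa> (X \<omega>)) \<partial>P)"
    by (rule cond_law_nn_integral[OF P X Y law, of "\<lambda>e. ennreal (h e)" "\<lambda>x. ennreal (w x)"]) simp_all
  also have "\<dots> \<le> (\<integral>\<^sup>+\<omega>. ennreal (w (X \<omega>)) * ennreal B \<partial>P)"
    by (intro nn_integral_mono mult_left_mono bound) simp
  also have "\<dots> = ennreal B * ennreal (\<integral>\<omega>. w (X \<omega>) \<partial>P)"
    using nn_integral_eq_integral[OF w(3)] w(2)
    by (subst nn_integral_multc) (auto simp: mult.commute)
  finally have le: "(\<integral>\<^sup>+\<omega>. ennreal (w (X \<omega>) * h (Y \<omega>)) \<partial>P) \<le> ennreal (B * (\<integral>\<omega>. w (X \<omega>) \<partial>P))"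
    using B w by (simp add: ennreal_mult)
  show int: "integrable P (\<lambda>\<omega>. w (X \<omega>) * h (Y \<omega>))"
    by (rule integrableI_bounded) (use le h w in \<open>auto intro: le_less_trans\<close>)
  show "(\<integral>\<omega>. w (X \<omega>) * h (Y \<omega>) \<partial>P) \<le> B * (\<integral>\<omega>. w (X \<omega>) \<partial>P)"
    using le nn_integral_eq_integral[OF int] h w B by simp
qed

lemma integral_mult_cond_exp_zero:
  assumes P: "prob_space P" and F: "subalgebra P F"
    and e: "e \<in> borel_measurable P" "AE \<omega> in P. real_cond_exp P F e \<omega> = 0"
    and g: "g \<in> borel_measurable F" and int: "integrable P (\<lambda>\<omega>. g \<omega> * e \<omega>)"
  shows "(\<integral>\<omega>. g \<omega> * e \<omega> \<partial>P) = 0"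
proof -
  interpret prob_space P by fact
  interpret S: finite_measure_subalgebra P F by unfold_locales (rule F)
  have "(\<integral>\<omega>. g \<omega> * e \<omega> \<partial>P) = (\<integral>\<omega>. g \<omega> * real_cond_exp P F e \<omega> \<partial>P)"
    by (rule S.real_cond_exp_intg(2)[OF int g e(1), symmetric])
  also have "\<dots> = (\<integral>\<omega>. 0 \<partial>P)"
    by (rule integral_cong_AE) (use e(2) measurable_from_subalg[OF F g] in \<open>auto elim: eventually_mono\<close>)
  finally show ?thesis by simp
qed

text \<open>Turns the finite supremum into explicit decay in k, through the lower power bound on
  \<open>N\<close> and the negative exponent -p/2.\<close>

lemma scaled_moment_bound:
  fixes N :: "nat \<Rightarrow> real" and \<kappa> :: "nat \<Rightarrow> 'b \<Rightarrow> 'c::real_normed_vector measure"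
  assumes N: "0 < n0" "\<And>k. k \<ge> 1 \<Longrightarrow> n0 * real k powr q \<le> N k"
    and sup: "(SUP k\<in>{1..}. SUP y. ennreal (N k powr (real p / 2)) * (\<integral>\<^sup>+ e. ennreal (norm e ^ p) \<partial>\<kappa> k y)) < \<infinity>"
  obtains B where "0 \<le> B" "\<And>k y. k \<ge> 1 \<Longrightarrow>
    (\<integral>\<^sup>+ e. ennreal (norm e ^ p) \<partial>\<kappa> k y) \<le> ennreal (B * real k powr (- (q * real p / 2)))"
proof -
  let ?S = "SUP k\<in>{1..}. SUP y. ennreal (N k powr (real p / 2)) * (\<integral>\<^sup>+ e. ennreal (norm e ^ p) \<partial>\<kappa> k y)"
  define C where "C = enn2real ?S"
  have C: "?S = ennreal C" using sup by (simp add: C_def)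
  have C0: "0 \<le> C" by (simp add: C_def)
  show ?thesis
  proof (rule that[of "C * n0 powr (- (real p / 2))"])
    show "0 \<le> C * n0 powr (- (real p / 2))" using C0 by simp
    fix k :: nat and y :: 'b assume k: "k \<ge> 1"
    let ?I = "\<integral>\<^sup>+ e. ennreal (norm e ^ p) \<partial>\<kappa> k y"
    have kq: "0 < real k powr q" using k by simp
    then have lo: "0 < n0 * real k powr q" using N(1) by simp
    then have Nk: "0 < N k" using N(2)[OF k] by linarith
    have "ennreal (N k powr (real p / 2)) * ?I \<le> (SUP y. ennreal (N k powr (real p / 2)) * (\<integral>\<^sup>+ e. ennreal (norm e ^ p) \<partial>\<kappa> k y))"
      by (rule SUP_upper) simp
    also have "\<dots> \<le> ?S"
      by (rule SUP_upper[where f = "\<lambda>k. SUP y. ennreal (N k powr (real p / 2)) * (\<integral>\<^sup>+ e. ennreal (norm e ^ p) \<partial>\<kappa> k y)"]) (use k in simp)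
    finally have le: "ennreal (N k powr (real p / 2)) * ?I \<le> ennreal C" unfolding C .
    have "N k powr (- (real p / 2)) * N k powr (real p / 2) = 1" using Nk by (simp flip: powr_add)
    then have "?I = ennreal (N k powr (- (real p / 2))) * (ennreal (N k powr (real p / 2)) * ?I)"
      by (simp flip: mult.assoc ennreal_mult)
    also have "\<dots> \<le> ennreal (N k powr (- (real p / 2))) * ennreal C" by (intro mult_left_mono le) simp
    also have "\<dots> = ennreal (C * N k powr (- (real p / 2)))" using C0 by (simp add: mult.commute flip: ennreal_mult)
    also have "\<dots> \<le> ennreal (C * n0 powr (- (real p / 2)) * real k powr (- (q * real p / 2)))"
    proof (rule ennreal_leI)
      have "N k powr (- (real p / 2)) \<le> (n0 * real k powr q) powr (- (real p / 2))"
        using N(2)[OF k] lo by (intro powr_mono2') auto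
      also have "\<dots> = n0 powr (- (real p / 2)) * real k powr (- (q * real p / 2))"
        using N(1) by (simp add: powr_mult powr_powr)
      finally show "C * N k powr (- (real p / 2)) \<le> C * n0 powr (- (real p / 2)) * real k powr (- (q * real p / 2))"
        using C0 by (simp add: mult.assoc mult_left_mono)
    qed
    finally show "?I \<le> ennreal (C * n0 powr (- (real p / 2)) * real k powr (- (q * real p / 2)))" .
  qed
qed

section \<open>Moments of the iterates\<close>

text \<open>The gradient enters only as a continuous, coercive vector field \<open>G\<close> of
  linear growth about \<open>xs\<close>, which is all that the Lyapunov estimates use; its
  linearisation appears later as a hypothesis of single lemmas. The variance bound is already
  expressed in powers of k.\<close>

locale stochastic_descent = prob_space P
  for P :: "'a measure" +
  fixes F :: "nat \<Rightarrow> 'a measure" and x \<E> :: "nat \<Rightarrow> 'a \<Rightarrow> real ^ 'n"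
    and \<kappa> :: "nat \<Rightarrow> real ^ 'n \<Rightarrow> (real ^ 'n) measure"
    and G :: "real ^ 'n \<Rightarrow> real ^ 'n" and D :: "real ^ 'n ^ 'n" and xs :: "real ^ 'n"
    and a :: "nat \<Rightarrow> real" and c \<alpha> q K L B :: real
  assumes subalg: "\<And>k. subalgebra P (F k)"
    and F_mono: "\<And>i j. i \<le> j \<Longrightarrow> sets (F i) \<subseteq> sets (F j)"
    and x1_meas: "x 1 \<in> borel_measurable (F 0)"
    and x1_sq: "integrable P (\<lambda>\<omega>. (norm (x 1 \<omega>))\<^sup>2)"
    and noise_meas: "\<And>k. k \<ge> 1 \<Longrightarrow> \<E> k \<in> borel_measurable (F k)"
    and noise_mean: "\<And>k i. k \<ge> 1 \<Longrightarrow>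
          AE \<omega> in P. real_cond_exp P (F (k - 1)) (\<lambda>\<omega>. \<E> k \<omega> $ i) \<omega> = 0"
    and noise_law: "\<And>k. k \<ge> 1 \<Longrightarrow> cond_law P (x k) (\<E> k) (\<kappa> k)"
    and iter: "\<And>k \<omega>. k \<ge> 1 \<Longrightarrow> \<omega> \<in> space P \<Longrightarrow>
          x (Suc k) \<omega> = x k \<omega> - a k *\<^sub>R (D *v (G (x k \<omega>) + \<E> k \<omega>))"
    and G_cont: "continuous_on UNIV G"
    and G_coercive: "\<And>y. (norm (y - xs))\<^sup>2 \<le> K * ((y - xs) \<bullet> G y)"
    and G_growth: "\<And>y. norm (G y) \<le> L * norm (y - xs)"
    and K: "0 < K" and L: "0 \<le> L"
    and D: "pos_def D"
    and a_eq: "\<And>k. k \<ge> 1 \<Longrightarrow> a k = (real k + c) powr (- \<alpha>)"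
    and c: "0 \<le> c" and alpha: "0 < \<alpha>" "\<alpha> < 1" and q: "0 \<le> q" and B: "0 \<le> B"
    and variance: "\<And>k y. k \<ge> 1 \<Longrightarrow>
          (\<integral>\<^sup>+e. ennreal ((norm e)\<^sup>2) \<partial>\<kappa> k y) \<le> ennreal (B * real k powr (- q))"
begin

text \<open>In the norm given by the inverse of \<open>D\<close>, the step direction \<open>D e\<close> is paired with \<open>y\<close> simply as \<open>y \<bullet> e\<close>.\<close>

definition Q :: "real ^ 'n \<Rightarrow> real" where
  "Q y = y \<bullet> (matrix_inv D *v y)"

lemma a_pos: "k \<ge> 1 \<Longrightarrow> 0 < a k"
  using c by (simp add: a_eq)

lemma a_le: "k \<ge> 1 \<Longrightarrow> a k \<le> real k powr (- \<alpha>)"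
  using c alpha by (simp add: a_eq powr_mono2')

lemma a_decseq: "k \<ge> 1 \<Longrightarrow> a (Suc k) \<le> a k"
  using c alpha by (simp add: a_eq powr_mono2')

lemma a_tendsto: "a \<longlonglongrightarrow> 0"
proof -
  have top: "filterlim (\<lambda>k::nat. real k + c) at_top sequentially"
    using filterlim_tendsto_add_at_top[OF tendsto_const filterlim_real_sequentially] by (simp add: add.commute)
  have "(\<lambda>k::nat. (real k + c) powr (- \<alpha>)) \<longlonglongrightarrow> 0"
    by (rule tendsto_neg_powr[OF _ top]) (use alpha in auto)
  moreover have "eventually (\<lambda>k. a k = (real k + c) powr (- \<alpha>)) sequentially"
    using eventually_ge_at_top[of 1] by eventually_elim (simp add: a_eq)
  ultimately show ?thesis by (simp add: tendsto_cong)
qed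

lemma Q_lower:
  obtains d where "0 < d" "\<And>y. d * (norm y)\<^sup>2 \<le> Q y"
  using pos_def_coercive[OF pos_def_inv[OF D]] unfolding Q_def by blast

lemma Q_upper:
  obtains d where "0 < d" "\<And>y. Q y \<le> d * (norm y)\<^sup>2"
proof
  show "0 < op_norm (matrix_inv D) + 1" using op_norm_nonneg[of "matrix_inv D"] by simp
  show "Q y \<le> (op_norm (matrix_inv D) + 1) * (norm y)\<^sup>2" for y
    using abs_quadratic_le[of y "matrix_inv D"] zero_le_power2[of "norm y"]
    unfolding Q_def distrib_right by linarith
qed

lemma Q_nonneg: "0 \<le> Q y"
proof -
  obtain d where "0 < d" "d * (norm y)\<^sup>2 \<le> Q y" using Q_lower by blast
  moreover from this have "0 \<le> d * (norm y)\<^sup>2" by simp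
  ultimately show ?thesis by linarith
qed

lemma Q_step: "Q (y - s *\<^sub>R (D *v e)) = Q y + (s\<^sup>2 * (e \<bullet> (D *v e)) - 2 * (s * (y \<bullet> e)))"
proof -
  note inv = matrix_inv_vector[OF pos_def_invertible[OF D]]
  have "(D *v e) \<bullet> (matrix_inv D *v y) = e \<bullet> y"
    using inner_matrix_sym[of D e "matrix_inv D *v y"] D by (simp add: pos_def_def inv)
  then show ?thesis
    by (simp add: Q_def matrix_vector_mult_diff_distrib matrix_vector_mult_scaleR inv inner_diff_left inner_diff_right
        inner_commute power2_eq_square algebra_simps)
qed

lemma continuous_Q: "continuous_on UNIV Q"
  unfolding Q_def by (intro continuous_intros linear_continuous_on matrix_vector_mul_bounded_linear)

lemma Q_measurable [measurable]: "Q \<in> borel_measurable borel"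
  by (rule borel_measurable_continuous_onI[OF continuous_Q])

lemma G_measurable [measurable]: "G \<in> borel_measurable borel"
  by (rule borel_measurable_continuous_onI[OF G_cont])

text \<open>The shift matters: \<open>x k\<close> is known at time k - 1, one step before the noise
  \<open>\<E> k\<close>, so functions of \<open>x k\<close> are admissible factors in the martingale
  property.\<close>

lemma x_adapted: "x (Suc k) \<in> borel_measurable (F k)"
proof (induction k)
  case 0
  show ?case using x1_meas by simp
next
  case (Suc k)
  have sp: "space (F j) = space P" for j using subalg by (simp add: subalgebra_def)
  have "subalgebra (F (Suc k)) (F k)"
    using F_mono[of k "Suc k"] by (simp add: subalgebra_def sp)
  then have [measurable]: "x (Suc k) \<in> borel_measurable (F (Suc k))"
    by (rule measurable_from_subalg) (rule Suc)
  have [measurable]: "\<E> (Suc k) \<in> borel_measurable (F (Suc k))" by (rule noise_meas) simp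
  have "(\<lambda>\<omega>. x (Suc k) \<omega> - a (Suc k) *\<^sub>R (D *v (G (x (Suc k) \<omega>) + \<E> (Suc k) \<omega>))) \<in> borel_measurable (F (Suc k))"
    by measurable
  then show ?case
    by (rule measurable_cong[THEN iffD1, rotated]) (use iter in \<open>simp add: sp\<close>)
qed

lemma x_adapted': "k \<ge> 1 \<Longrightarrow> x k \<in> borel_measurable (F (k - 1))"
  using x_adapted[of "k - 1"] by simp

lemma x_measurable [measurable]: "k \<ge> 1 \<Longrightarrow> x k \<in> borel_measurable P"
  by (rule measurable_from_subalg[OF subalg x_adapted'])

lemma noise_measurable [measurable]: "k \<ge> 1 \<Longrightarrow> \<E> k \<in> borel_measurable P"
  by (rule measurable_from_subalg[OF subalg noise_meas])

lemma noise_moment: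
  assumes k: "k \<ge> 1" and C: "0 \<le> C" "\<And>y. (\<integral>\<^sup>+e. ennreal (norm e ^ p) \<partial>\<kappa> k y) \<le> ennreal C"
    and w: "w \<in> borel_measurable borel" "\<And>y. 0 \<le> w y" "integrable P (\<lambda>\<omega>. w (x k \<omega>))"
  shows "integrable P (\<lambda>\<omega>. w (x k \<omega>) * norm (\<E> k \<omega>) ^ p)"
    "(\<integral>\<omega>. w (x k \<omega>) * norm (\<E> k \<omega>) ^ p \<partial>P) \<le> C * (\<integral>\<omega>. w (x k \<omega>) \<partial>P)"
proof -
  have n: "(\<lambda>e :: real ^ 'n. norm e ^ p) \<in> borel_measurable borel" by measurable
  have nn: "0 \<le> norm e ^ p" for e :: "real ^ 'n" by simp
  note m = cond_law_moment[OF prob_space_axioms x_measurable[OF k] noise_measurable[OF k] noise_law[OF k] n nn C w]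
  show "integrable P (\<lambda>\<omega>. w (x k \<omega>) * norm (\<E> k \<omega>) ^ p)" by (rule m(1))
  show "(\<integral>\<omega>. w (x k \<omega>) * norm (\<E> k \<omega>) ^ p \<partial>P) \<le> C * (\<integral>\<omega>. w (x k \<omega>) \<partial>P)" by (rule m(2))
qed

lemma noise_moment_unweighted:
  assumes k: "k \<ge> 1" and C: "0 \<le> C" "\<And>y. (\<integral>\<^sup>+e. ennreal (norm e ^ p) \<partial>\<kappa> k y) \<le> ennreal C"
  shows "integrable P (\<lambda>\<omega>. norm (\<E> k \<omega>) ^ p)" "(\<integral>\<omega>. norm (\<E> k \<omega>) ^ p \<partial>P) \<le> C"
proof -
  have w: "(\<lambda>y :: real ^ 'n. 1 :: real) \<in> borel_measurable borel" "\<And>y :: real ^ 'n. 0 \<le> (1 :: real)"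
    "integrable P (\<lambda>\<omega>. 1 :: real)" by auto
  note m = noise_moment[OF k C w]
  show "integrable P (\<lambda>\<omega>. norm (\<E> k \<omega>) ^ p)" using m(1) by simp
  show "(\<integral>\<omega>. norm (\<E> k \<omega>) ^ p \<partial>P) \<le> C" using m(2) by (simp add: prob_space)
qed

lemma noise_L2:
  assumes k: "k \<ge> 1"
  shows "L2_le P (\<E> k) (sqrt (B * real k powr (- q)))"
proof (rule L2_leI_integrable)
  have B': "0 \<le> B * real k powr (- q)" using B by simp
  show "integrable P (\<lambda>\<omega>. (norm (\<E> k \<omega>))\<^sup>2)" by (rule noise_moment_unweighted(1)[OF k B' variance[OF k]])
  show "(\<integral>\<omega>. (norm (\<E> k \<omega>))\<^sup>2 \<partial>P) \<le> B * real k powr (- q)"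
    by (rule noise_moment_unweighted(2)[OF k B' variance[OF k]])
qed (use k in measurable)

text \<open>Finiteness without a rate, by induction along the recursion. The quantitative recursions
  compare integrals and need integrability of both sides beforehand.\<close>

lemma iterates_L2: "k \<ge> 1 \<Longrightarrow> \<exists>s. L2_le P (\<lambda>\<omega>. x k \<omega> - xs) s"
proof (induction k rule: nat_induct_at_least)
  case base
  have "L2_le P (x 1) (sqrt (\<integral>\<omega>. (norm (x 1 \<omega>))\<^sup>2 \<partial>P))"
    by (rule L2_leI_integrable[OF x_measurable x1_sq]) auto
  moreover have "L2_le P (\<lambda>_. xs) (norm xs)" by (simp add: L2_le_def prob_space)
  ultimately show ?case using L2_le_diff by blast
next
  case (Suc k)
  then obtain s where s: "L2_le P (\<lambda>\<omega>. x k \<omega> - xs) s" by blast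
  have k: "k \<ge> 1" by fact
  have G: "L2_le P (\<lambda>\<omega>. G (x k \<omega>)) (L * s)"
    by (rule L2_le_bound[OF s _ L]) (use k G_growth in \<open>auto intro: measurable_compose[OF x_measurable G_measurable]\<close>)
  have "L2_le P (\<lambda>\<omega>. (x k \<omega> - xs) - a k *\<^sub>R (D *v (G (x k \<omega>) + \<E> k \<omega>)))
     (s + \<bar>a k\<bar> * (onorm ((*v) D) * (L * s + sqrt (B * real k powr (- q)))))"
    by (intro L2_le_diff s L2_le_scaleR L2_le_matrix L2_le_add G noise_L2 k)
  then have "L2_le P (\<lambda>\<omega>. x (Suc k) \<omega> - xs)
     (s + \<bar>a k\<bar> * (onorm ((*v) D) * (L * s + sqrt (B * real k powr (- q)))))"
  proof (rule L2_le_bound[where K = 1, simplified])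
    fix \<omega> assume "\<omega> \<in> space P"
    then show "norm (x (Suc k) \<omega> - xs) \<le> norm (x k \<omega> - xs - a k *\<^sub>R (D *v (G (x k \<omega>) + \<E> k \<omega>)))"
      by (simp only: iter[OF k]) (simp add: algebra_simps)
  qed (use x_measurable[of "Suc k"] in auto)
  then show ?case by blast
qed

lemma integrable_Q:
  assumes k: "k \<ge> 1"
  shows "integrable P (\<lambda>\<omega>. Q (x k \<omega> - xs))"
proof -
  obtain d2 where d: "0 < d2" "\<And>y. Q y \<le> d2 * (norm y)\<^sup>2" using Q_upper by blast
  obtain s where s: "L2_le P (\<lambda>\<omega>. x k \<omega> - xs) s" using iterates_L2[OF k] by blast
  show ?thesis
  proof (rule Bochner_Integration.integrable_bound[OF integrable_mult_right[OF L2_leD(3)[OF s], of d2]])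
    show "(\<lambda>\<omega>. Q (x k \<omega> - xs)) \<in> borel_measurable P" using k by measurable
    show "AE \<omega> in P. norm (Q (x k \<omega> - xs)) \<le> norm (d2 * (norm (x k \<omega> - xs))\<^sup>2)"
      using d Q_nonneg by (auto intro!: AE_I2 simp: abs_mult)
  qed
qed

text \<open>The indices \<open>i\<close> and \<open>j\<close> are independent because the matrix
  covariance needs every mixed product, whereas the Lyapunov estimates need only the inner
  product.\<close>

lemma noise_orthogonal_component:
  fixes h :: "'a \<Rightarrow> real ^ 'n"
  assumes k: "k \<ge> 1" and h: "h \<in> borel_measurable (F (k - 1))" and hL2: "L2_le P h s"
  shows "integrable P (\<lambda>\<omega>. h \<omega> $ i * \<E> k \<omega> $ j)" "(\<integral>\<omega>. h \<omega> $ i * \<E> k \<omega> $ j \<partial>P) = 0"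
proof -
  have hP: "h \<in> borel_measurable P" by (rule L2_leD(1)[OF hL2])
  show int: "integrable P (\<lambda>\<omega>. h \<omega> $ i * \<E> k \<omega> $ j)"
  proof (rule Bochner_Integration.integrable_bound[OF L2_le_mult(1)[OF hL2 noise_L2[OF k]]])
    show "(\<lambda>\<omega>. h \<omega> $ i * \<E> k \<omega> $ j) \<in> borel_measurable P"
      using measurable_vec_nth[OF hP] measurable_vec_nth[OF noise_measurable[OF k]] by (intro borel_measurable_times)
    show "AE \<omega> in P. norm (h \<omega> $ i * \<E> k \<omega> $ j) \<le> norm (norm (h \<omega>) * norm (\<E> k \<omega>))"
      by (auto intro!: AE_I2 mult_mono component_le_norm_cart simp: abs_mult)
  qed
  show "(\<integral>\<omega>. h \<omega> $ i * \<E> k \<omega> $ j \<partial>P) = 0"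
  proof (rule integral_mult_cond_exp_zero[OF prob_space_axioms subalg[of "k - 1"] _ noise_mean[OF k] _ int])
    show "(\<lambda>\<omega>. \<E> k \<omega> $ j) \<in> borel_measurable P" by (intro measurable_vec_nth noise_measurable k)
    show "(\<lambda>\<omega>. h \<omega> $ i) \<in> borel_measurable (F (k - 1))" by (rule measurable_vec_nth[OF h])
  qed
qed

lemma noise_orthogonal:
  assumes k: "k \<ge> 1" and h: "h \<in> borel_measurable (F (k - 1))" and hL2: "L2_le P h s"
  shows "integrable P (\<lambda>\<omega>. h \<omega> \<bullet> \<E> k \<omega>)" "(\<integral>\<omega>. h \<omega> \<bullet> \<E> k \<omega> \<partial>P) = 0"
proof -
  note c = noise_orthogonal_component[OF assms]
  show "integrable P (\<lambda>\<omega>. h \<omega> \<bullet> \<E> k \<omega>)"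
    unfolding inner_vec_def inner_real_def by (intro Bochner_Integration.integrable_sum c)
  have "(\<integral>\<omega>. h \<omega> \<bullet> \<E> k \<omega> \<partial>P) = (\<Sum>i\<in>UNIV. \<integral>\<omega>. h \<omega> $ i * \<E> k \<omega> $ i \<partial>P)"
    unfolding inner_vec_def inner_real_def by (intro Bochner_Integration.integral_sum c)
  then show "(\<integral>\<omega>. h \<omega> \<bullet> \<E> k \<omega> \<partial>P) = 0" by (simp add: c)
qed

section \<open>Contraction of the noise-free step and decay of the moments\<close>

definition drift :: "nat \<Rightarrow> real ^ 'n \<Rightarrow> real ^ 'n" where
  "drift k y = y - xs - a k *\<^sub>R (D *v G y)"

lemma drift_measurable [measurable]: "drift k \<in> borel_measurable borel"
  unfolding drift_def by measurable

lemma iter_drift: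
  assumes "k \<ge> 1" "\<omega> \<in> space P"
  shows "x (Suc k) \<omega> - xs = drift k (x k \<omega>) - a k *\<^sub>R (D *v \<E> k \<omega>)"
  using iter[OF assms] by (simp add: drift_def matrix_vector_right_distrib algebra_simps)

text \<open>The first-order descent is 2 a_k v.G with v = y - xs. For small a_k the second-order
  term is at most a_k |v|^2 / K, which coercivity bounds by half of that descent; the other half is
  still at least \<open>lam * a k\<close> times the quadratic form. The early steps may be too long
  for this, hence the threshold \<open>k0\<close>.\<close>

lemma drift_contract:
  obtains lam k0 where "0 < lam" "\<And>k. k \<ge> k0 \<Longrightarrow> k \<ge> 1 \<Longrightarrow> lam * a k \<le> 1"
    "\<And>k y. k \<ge> k0 \<Longrightarrow> k \<ge> 1 \<Longrightarrow> Q (drift k y) \<le> (1 - lam * a k) * Q (y - xs)"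
proof -
  obtain d2 where d: "0 < d2" "\<And>y. Q y \<le> d2 * (norm y)\<^sup>2" using Q_upper by blast
  \<comment> \<open>Coercivity gives |v|^2 / K and the upper bound of the quadratic form gives Q v
    <= d2 |v|^2; the quotient is the contraction rate.\<close>
  define lam where "lam = 1 / (K * d2)"
  have lam: "0 < lam" using K d by (simp add: lam_def)
  \<comment> \<open>One threshold for two demands: a_k H <= 1 makes the second-order term absorbable
    and also keeps \<open>1 - lam * a k\<close> nonnegative.\<close>
  define H where "H = op_norm D * L\<^sup>2 * K + lam + 1"
  have H0: "0 \<le> op_norm D * L\<^sup>2 * K" using K op_norm_nonneg[of D] by simp
  have "eventually (\<lambda>k. a k < 1 / H) sequentially"
    by (rule order_tendstoD[OF a_tendsto]) (use H0 lam in \<open>simp add: H_def\<close>)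
  then obtain k0 where k0: "\<And>k. k \<ge> k0 \<Longrightarrow> a k < 1 / H" by (auto simp: eventually_sequentially)
  have aH: "a k * (op_norm D * L\<^sup>2 * K) \<le> 1" "lam * a k \<le> 1" if "k \<ge> k0" "k \<ge> 1" for k
  proof -
    have "a k * H \<le> 1" using k0[OF that(1)] H0 lam by (simp add: H_def field_simps)
    moreover have "a k * (op_norm D * L\<^sup>2 * K) \<le> a k * H" "a k * lam \<le> a k * H"
      using a_pos[OF that(2)] H0 lam by (intro mult_left_mono; simp add: H_def)+
    ultimately show "a k * (op_norm D * L\<^sup>2 * K) \<le> 1" "lam * a k \<le> 1" by (auto simp: mult.commute)
  qed
  have "Q (drift k y) \<le> (1 - lam * a k) * Q (y - xs)" if k: "k \<ge> k0" "k \<ge> 1" for k y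
  proof -
    let ?v = "y - xs" and ?a = "a k"
    have a0: "0 < ?a" by (rule a_pos[OF k(2)])
    have "Q (drift k y) = Q ?v + (?a\<^sup>2 * (G y \<bullet> (D *v G y)) - 2 * (?a * (?v \<bullet> G y)))"
      unfolding drift_def by (rule Q_step)
    also have "?a\<^sup>2 * (G y \<bullet> (D *v G y)) \<le> ?a * ((norm ?v)\<^sup>2 / K)"
    proof -
      have "G y \<bullet> (D *v G y) \<le> op_norm D * (norm (G y))\<^sup>2" using abs_quadratic_le[of "G y" D] by simp
      also have "\<dots> \<le> op_norm D * (L * norm ?v)\<^sup>2"
        using G_growth op_norm_nonneg by (intro mult_left_mono power_mono) auto
      finally have "?a * (G y \<bullet> (D *v G y)) \<le> ?a * (op_norm D * (L * norm ?v)\<^sup>2)"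
        using a0 by (intro mult_left_mono) auto
      also have "\<dots> = (?a * (op_norm D * L\<^sup>2 * K)) * ((norm ?v)\<^sup>2 / K)"
        using K by (simp add: power_mult_distrib)
      also have "\<dots> \<le> 1 * ((norm ?v)\<^sup>2 / K)"
        using aH(1)[OF k] K by (intro mult_right_mono) auto
      finally have "?a * (?a * (G y \<bullet> (D *v G y))) \<le> ?a * ((norm ?v)\<^sup>2 / K)"
        using a0 by (intro mult_left_mono) auto
      then show ?thesis by (simp add: power2_eq_square mult.assoc)
    qed
    also have "?a * ((norm ?v)\<^sup>2 / K) \<le> ?a * (?v \<bullet> G y)"
      using G_coercive[of y] K a0 by (intro mult_left_mono) (auto simp: field_simps)
    finally have "Q (drift k y) \<le> Q ?v - ?a * (?v \<bullet> G y)" by simp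
    also have "?a * (lam * Q ?v) \<le> ?a * (?v \<bullet> G y)"
    proof (rule mult_left_mono)
      have "lam * Q ?v \<le> lam * (d2 * (norm ?v)\<^sup>2)" using d lam by (intro mult_left_mono) auto
      also have "\<dots> = (norm ?v)\<^sup>2 / K" using d by (simp add: lam_def)
      also have "\<dots> \<le> ?v \<bullet> G y" using G_coercive[of y] K by (simp add: field_simps)
      finally show "lam * Q ?v \<le> ?v \<bullet> G y" .
    qed (use a0 in simp)
    then have "Q ?v - ?a * (?v \<bullet> G y) \<le> Q ?v - ?a * (lam * Q ?v)" by simp
    finally show ?thesis by (simp add: algebra_simps)
  qed
  with lam aH(2) show ?thesis using that by blast
qed

lemma drift_L2:
  assumes k: "k \<ge> 1"
  obtains s where "L2_le P (\<lambda>\<omega>. drift k (x k \<omega>)) s"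
proof -
  obtain s where s: "L2_le P (\<lambda>\<omega>. x k \<omega> - xs) s" using iterates_L2[OF k] by blast
  have G: "L2_le P (\<lambda>\<omega>. G (x k \<omega>)) (L * s)"
    by (rule L2_le_bound[OF s _ L]) (use k G_growth in \<open>auto intro: measurable_compose[OF x_measurable G_measurable]\<close>)
  have "L2_le P (\<lambda>\<omega>. (x k \<omega> - xs) - a k *\<^sub>R (D *v G (x k \<omega>))) (s + \<bar>a k\<bar> * (onorm ((*v) D) * (L * s)))"
    by (intro L2_le_diff s L2_le_scaleR L2_le_matrix G)
  then show ?thesis using that by (simp add: drift_def)
qed

lemma drift_adapted: "k \<ge> 1 \<Longrightarrow> (\<lambda>\<omega>. drift k (x k \<omega>)) \<in> borel_measurable (F (k - 1))"
  by (rule measurable_compose[OF x_adapted' drift_measurable])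

lemma integrable_Q_drift:
  assumes k: "k \<ge> 1"
  shows "integrable P (\<lambda>\<omega>. Q (drift k (x k \<omega>)))"
proof -
  obtain d2 where d: "0 < d2" "\<And>y. Q y \<le> d2 * (norm y)\<^sup>2" using Q_upper by blast
  obtain s where s: "L2_le P (\<lambda>\<omega>. drift k (x k \<omega>)) s" using drift_L2[OF k] by blast
  show ?thesis
  proof (rule Bochner_Integration.integrable_bound[OF integrable_mult_right[OF L2_leD(3)[OF s], of d2]])
    show "(\<lambda>\<omega>. Q (drift k (x k \<omega>))) \<in> borel_measurable P" using k by measurable
    show "AE \<omega> in P. norm (Q (drift k (x k \<omega>))) \<le> norm (d2 * (norm (drift k (x k \<omega>)))\<^sup>2)"
      using d Q_nonneg by (auto intro!: AE_I2 simp: abs_mult)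
  qed
qed

text \<open>The cross term has mean zero, so noise enters only through a_k^2 k^-q. One factor a_k is
  kept to match the contraction and the other is spent as k^-\<alpha>, which leaves a forcing a_k
  k^-(\<alpha> + q) and hence this rate.\<close>

lemma second_moment_decay:
  obtains C where "0 < C" "\<And>k. k \<ge> 1 \<Longrightarrow> (\<integral>\<omega>. Q (x k \<omega> - xs) \<partial>P) \<le> C * real k powr (- (\<alpha> + q))"
proof -
  obtain lam k0 where lam: "0 < lam" "\<And>k. k \<ge> k0 \<Longrightarrow> k \<ge> 1 \<Longrightarrow> lam * a k \<le> 1"
    "\<And>k y. k \<ge> k0 \<Longrightarrow> k \<ge> 1 \<Longrightarrow> Q (drift k y) \<le> (1 - lam * a k) * Q (y - xs)"
    using drift_contract by blast
  define u where "u = (\<lambda>k. \<integral>\<omega>. Q (x k \<omega> - xs) \<partial>P)"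
  have rec: "u (Suc k) \<le> (1 - lam * a k) * u k + (op_norm D * B) * (a k * real k powr (- (\<alpha> + q)))"
    if k: "k \<ge> k0" "k \<ge> 1" for k
  proof -
    obtain s where s: "L2_le P (\<lambda>\<omega>. drift k (x k \<omega>)) s" using drift_L2[OF k(2)] by blast
    note orth = noise_orthogonal[OF k(2) drift_adapted[OF k(2)] s]
    note nL2 = L2_leD[OF noise_L2[OF k(2)]]
    have "u (Suc k) \<le> (\<integral>\<omega>. Q (drift k (x k \<omega>)) + ((a k)\<^sup>2 * (op_norm D * (norm (\<E> k \<omega>))\<^sup>2)
        - 2 * (a k * (drift k (x k \<omega>) \<bullet> \<E> k \<omega>))) \<partial>P)"
      unfolding u_def
    proof (rule integral_mono)
      show "integrable P (\<lambda>\<omega>. Q (x (Suc k) \<omega> - xs))" by (rule integrable_Q) simp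
      show "integrable P (\<lambda>\<omega>. Q (drift k (x k \<omega>)) + ((a k)\<^sup>2 * (op_norm D * (norm (\<E> k \<omega>))\<^sup>2)
        - 2 * (a k * (drift k (x k \<omega>) \<bullet> \<E> k \<omega>))))"
        by (intro Bochner_Integration.integrable_add Bochner_Integration.integrable_diff integrable_mult_right
            integrable_Q_drift k nL2 orth)
      fix \<omega> assume \<omega>: "\<omega> \<in> space P"
      have "(a k)\<^sup>2 * (\<E> k \<omega> \<bullet> (D *v \<E> k \<omega>)) \<le> (a k)\<^sup>2 * (op_norm D * (norm (\<E> k \<omega>))\<^sup>2)"
        using abs_quadratic_le[of "\<E> k \<omega>" D] by (intro mult_left_mono) auto
      then show "Q (x (Suc k) \<omega> - xs) \<le> Q (drift k (x k \<omega>)) + ((a k)\<^sup>2 * (op_norm D * (norm (\<E> k \<omega>))\<^sup>2)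
        - 2 * (a k * (drift k (x k \<omega>) \<bullet> \<E> k \<omega>)))"
        unfolding iter_drift[OF k(2) \<omega>] Q_step by linarith
    qed
    also have "\<dots> = (\<integral>\<omega>. Q (drift k (x k \<omega>)) \<partial>P) + (a k)\<^sup>2 * (op_norm D * (\<integral>\<omega>. (norm (\<E> k \<omega>))\<^sup>2 \<partial>P))"
      using integrable_Q_drift[OF k(2)] nL2(3) orth by simp
    also have "\<dots> \<le> (1 - lam * a k) * u k + (op_norm D * B) * (a k * real k powr (- (\<alpha> + q)))"
    proof (rule add_mono)
      have "(\<integral>\<omega>. Q (drift k (x k \<omega>)) \<partial>P) \<le> (\<integral>\<omega>. (1 - lam * a k) * Q (x k \<omega> - xs) \<partial>P)"
        by (intro integral_mono integrable_Q_drift integrable_mult_right integrable_Q lam k)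
      then show "(\<integral>\<omega>. Q (drift k (x k \<omega>)) \<partial>P) \<le> (1 - lam * a k) * u k" by (simp add: u_def)
      have "(\<integral>\<omega>. (norm (\<E> k \<omega>))\<^sup>2 \<partial>P) \<le> B * real k powr (- q)" using nL2(4) B by simp
      then have "(a k)\<^sup>2 * (op_norm D * (\<integral>\<omega>. (norm (\<E> k \<omega>))\<^sup>2 \<partial>P))
          \<le> (a k * real k powr (- \<alpha>)) * (op_norm D * (B * real k powr (- q)))"
        using a_le[OF k(2)] a_pos[OF k(2)] op_norm_nonneg[of D]
        unfolding power2_eq_square by (intro mult_mono mult_nonneg_nonneg) auto
      then show "(a k)\<^sup>2 * (op_norm D * (\<integral>\<omega>. (norm (\<E> k \<omega>))\<^sup>2 \<partial>P))
          \<le> (op_norm D * B) * (a k * real k powr (- (\<alpha> + q)))"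
        by (simp add: powr_add powr_diff powr_minus field_simps)
    qed
    finally show ?thesis .
  qed
  obtain C where "0 < C" "\<And>k. k \<ge> 1 \<Longrightarrow> u k \<le> C * real k powr (- (\<alpha> + q))"
    by (rule recursion_powr_decay[OF lam(1) alpha c _ _ a_eq rec]) (use alpha q B op_norm_nonneg[of D] in auto)
  then show ?thesis using that by (simp add: u_def)
qed

lemma iterates_L2_decay:
  obtains C where "0 < C" "\<And>k. k \<ge> 1 \<Longrightarrow> L2_le P (\<lambda>\<omega>. x k \<omega> - xs) (C * real k powr (- ((\<alpha> + q) / 2)))"
proof -
  obtain C where C: "0 < C" "\<And>k. k \<ge> 1 \<Longrightarrow> (\<integral>\<omega>. Q (x k \<omega> - xs) \<partial>P) \<le> C * real k powr (- (\<alpha> + q))"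
    using second_moment_decay by blast
  obtain d1 where d: "0 < d1" "\<And>y. d1 * (norm y)\<^sup>2 \<le> Q y" using Q_lower by blast
  have "L2_le P (\<lambda>\<omega>. x k \<omega> - xs) (sqrt (C / d1) * real k powr (- ((\<alpha> + q) / 2)))" if k: "k \<ge> 1" for k
  proof -
    obtain s where s: "L2_le P (\<lambda>\<omega>. x k \<omega> - xs) s" using iterates_L2[OF k] by blast
    have "(\<integral>\<omega>. d1 * (norm (x k \<omega> - xs))\<^sup>2 \<partial>P) \<le> (\<integral>\<omega>. Q (x k \<omega> - xs) \<partial>P)"
      by (intro integral_mono integrable_mult_right L2_leD(3)[OF s] integrable_Q k d)
    also have "\<dots> \<le> C * real k powr (- (\<alpha> + q))" by (rule C(2)[OF k])
    finally have "(\<integral>\<omega>. (norm (x k \<omega> - xs))\<^sup>2 \<partial>P) \<le> C / d1 * real k powr (- (\<alpha> + q))"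
      using d by (simp add: field_simps)
    from L2_leI_integrable[OF L2_leD(1,3)[OF s] this]
    have "L2_le P (\<lambda>\<omega>. x k \<omega> - xs) (sqrt (C / d1 * real k powr (- (\<alpha> + q))))" .
    also have "sqrt (C / d1 * real k powr (- (\<alpha> + q))) = sqrt (C / d1) * real k powr (- ((\<alpha> + q) / 2))"
      by (simp only: real_sqrt_mult sqrt_powr minus_divide_left)
    finally show ?thesis .
  qed
  with C d show ?thesis using that[of "sqrt (C / d1)"] by simp
qed

text \<open>The two upper bounds on \<open>r\<close> mirror the two error terms of the one-step
  estimate. The mixed term, by independence of the noise bound from the iterate and the
  second-moment rate, costs a_k k^-(2(\<alpha> + q)); the pure noise term costs a_k^p k^-(qp/2),
  which is at most a_k k^-(\<alpha>(p - 1) + qp/2).\<close>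

lemma damped_moment_decay:
  assumes p: "2 \<le> p" "p \<le> 4" and Bp: "0 \<le> Bp"
    and moment: "\<And>k y. k \<ge> 1 \<Longrightarrow>
          (\<integral>\<^sup>+e. ennreal (norm e ^ p) \<partial>\<kappa> k y) \<le> ennreal (Bp * real k powr (- (q * real p / 2)))"
    and r: "r \<le> 2 * (\<alpha> + q)" "r \<le> \<alpha> * (real p - 1) + q * real p / 2" "0 \<le> r"
  obtains C where "0 < C" "\<And>k. k \<ge> 1 \<Longrightarrow> (\<integral>\<omega>. damped_square (Q (x k \<omega> - xs)) \<partial>P) \<le> C * real k powr (- r)"
proof -
  obtain lam k0 where lam: "0 < lam" "\<And>k. k \<ge> k0 \<Longrightarrow> k \<ge> 1 \<Longrightarrow> lam * a k \<le> 1"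
    "\<And>k y. k \<ge> k0 \<Longrightarrow> k \<ge> 1 \<Longrightarrow> Q (drift k y) \<le> (1 - lam * a k) * Q (y - xs)"
    using drift_contract by blast
  obtain C2 where C2: "0 < C2" "\<And>k. k \<ge> 1 \<Longrightarrow> (\<integral>\<omega>. Q (x k \<omega> - xs) \<partial>P) \<le> C2 * real k powr (- (\<alpha> + q))"
    using second_moment_decay by blast
  obtain d1 where d: "0 < d1" "\<And>y. d1 * (norm y)\<^sup>2 \<le> Q y" using Q_lower by blast
  obtain b0 where b0: "0 < b0" "\<And>v. b0 * (norm v)\<^sup>2 \<le> v \<bullet> (D *v v)" using pos_def_coercive[OF D] by blast
  define b where "b = op_norm D"
  define Cs where "Cs = 2 * b + 8 / d1 + 32 * b\<^sup>2 / (b0\<^sup>2 * d1) + 2 * b\<^sup>2 + 4 * b\<^sup>2 / b0"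
  have b: "0 \<le> b" by (simp add: b_def op_norm_nonneg)
  have Cs: "0 \<le> Cs" unfolding Cs_def using b b0 d by (intro add_nonneg_nonneg) auto
  \<comment> \<open>The derivative of the damped square at \<open>Q y\<close>. Its values lie
    between 0 and 1, so g(y) y is square integrable whenever y is, and the linear term integrates to
    zero.\<close>
  define g where "g = (\<lambda>y. Q y * (2 + Q y) / (1 + Q y)\<^sup>2)"
  have g: "0 \<le> g y" "g y \<le> 1" for y
    using Q_nonneg[of y] by (auto simp: g_def divide_le_eq power2_eq_square algebra_simps intro!: divide_nonneg_nonneg)
      (smt (verit) mult_nonneg_nonneg)
  have [measurable]: "g \<in> borel_measurable borel" unfolding g_def by measurable
  define u where "u = (\<lambda>k. \<integral>\<omega>. damped_square (Q (x k \<omega> - xs)) \<partial>P)"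
  \<comment> \<open>Damping never exceeds the identity, so integrability of the quadratic form
    suffices where a genuine fourth moment might be infinite.\<close>
  have ds_int: "integrable P (\<lambda>\<omega>. damped_square (w \<omega>))" if "integrable P w" "\<And>\<omega>. 0 \<le> w \<omega>" for w
    by (rule Bochner_Integration.integrable_bound[OF that(1)])
      (use that damped_square_nonneg damped_square_le in \<open>auto intro!: AE_I2\<close>)
  have rec: "u (Suc k) \<le> (1 - lam * a k) * u k + (Cs * (B * C2 + Bp)) * (a k * real k powr (- r))"
    if k: "k \<ge> k0" "k \<ge> 1" for k
  proof -
    let ?y = "\<lambda>\<omega>. drift k (x k \<omega>)" and ?e = "\<lambda>\<omega>. \<E> k \<omega>"
    have a0: "0 < a k" by (rule a_pos[OF k(2)])
    obtain s where s: "L2_le P ?y s" using drift_L2[OF k(2)] by blast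
    have gy: "L2_le P (\<lambda>\<omega>. g (?y \<omega>) *\<^sub>R ?y \<omega>) (1 * s)"
    proof (rule L2_le_bound[OF s])
      show "(\<lambda>\<omega>. g (?y \<omega>) *\<^sub>R ?y \<omega>) \<in> borel_measurable P" using k by measurable
      show "norm (g (?y \<omega>) *\<^sub>R ?y \<omega>) \<le> 1 * norm (?y \<omega>)" for \<omega>
        using g[of "?y \<omega>"] by (simp add: mult_left_le_one_le)
    qed simp
    have "(\<lambda>\<omega>. g (?y \<omega>) *\<^sub>R ?y \<omega>) \<in> borel_measurable (F (k - 1))"
      using drift_adapted[OF k(2)] by measurable
    note orth = noise_orthogonal[OF k(2) this gy]
    note Qd = integrable_Q_drift[OF k(2)]
    have B': "0 \<le> B * real k powr (- q)" using B by simp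
    have Qy: "(\<lambda>y. Q (drift k y)) \<in> borel_measurable borel" by measurable
    note m2 = noise_moment[OF k(2) B' variance[OF k(2)] Qy Q_nonneg Qd]
    have Bp': "0 \<le> Bp * real k powr (- (q * real p / 2))" using Bp by simp
    note mp = noise_moment_unweighted[OF k(2) Bp' moment[OF k(2)]]
    have "u (Suc k) \<le> (\<integral>\<omega>. damped_square (Q (?y \<omega>)) - 2 * a k * ((g (?y \<omega>) *\<^sub>R ?y \<omega>) \<bullet> ?e \<omega>)
        + Cs * ((a k)\<^sup>2 * (Q (?y \<omega>) * (norm (?e \<omega>))\<^sup>2) + a k ^ p * norm (?e \<omega>) ^ p) \<partial>P)"
      unfolding u_def
    proof (rule integral_mono)
      show "integrable P (\<lambda>\<omega>. damped_square (Q (x (Suc k) \<omega> - xs)))"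
        by (intro ds_int integrable_Q Q_nonneg) simp
      show "integrable P (\<lambda>\<omega>. damped_square (Q (?y \<omega>)) - 2 * a k * ((g (?y \<omega>) *\<^sub>R ?y \<omega>) \<bullet> ?e \<omega>)
        + Cs * ((a k)\<^sup>2 * (Q (?y \<omega>) * (norm (?e \<omega>))\<^sup>2) + a k ^ p * norm (?e \<omega>) ^ p))"
        by (intro Bochner_Integration.integrable_add Bochner_Integration.integrable_diff integrable_mult_right
            ds_int Qd Q_nonneg orth m2 mp)
      fix \<omega> assume \<omega>: "\<omega> \<in> space P"
      define y e t where "y = ?y \<omega>" and "e = ?e \<omega>" and "t = a k * norm e"
      have st: "Q (x (Suc k) \<omega> - xs) = Q y + ((a k)\<^sup>2 * (e \<bullet> (D *v e)) - 2 * (a k * (y \<bullet> e)))"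
        unfolding iter_drift[OF k(2) \<omega>] Q_step y_def e_def ..
      have "damped_square (Q y + ((a k)\<^sup>2 * (e \<bullet> (D *v e)) - 2 * (a k * (y \<bullet> e))))
         \<le> damped_square (Q y) - 2 * (Q y * (2 + Q y) / (1 + Q y)\<^sup>2) * (a k * (y \<bullet> e)) + Cs * (Q y * t\<^sup>2 + t ^ p)"
        unfolding Cs_def
      proof (rule damped_square_step[where Y = "norm y"])
        show "d1 * (norm y)\<^sup>2 \<le> Q y" by (rule d)
        show "\<bar>a k * (y \<bullet> e)\<bar> \<le> norm y * t"
          using Cauchy_Schwarz_ineq2[of y e] a0 by (simp add: t_def abs_mult)
        show "b0 * t\<^sup>2 \<le> (a k)\<^sup>2 * (e \<bullet> (D *v e))"
          using mult_left_mono[OF b0(2)[of e], of "(a k)\<^sup>2"] by (simp add: t_def power_mult_distrib mult_ac)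
        have "e \<bullet> (D *v e) \<le> b * (norm e)\<^sup>2" using abs_quadratic_le[of e D] by (simp add: b_def)
        then show "(a k)\<^sup>2 * (e \<bullet> (D *v e)) \<le> b * t\<^sup>2"
          using mult_left_mono[of _ _ "(a k)\<^sup>2"] by (fastforce simp: t_def power_mult_distrib mult_ac)
        show "0 \<le> Q y + ((a k)\<^sup>2 * (e \<bullet> (D *v e)) - 2 * (a k * (y \<bullet> e)))"
          unfolding st[symmetric] by (rule Q_nonneg)
      qed (use d b0 b p a0 in \<open>auto simp: t_def\<close>)
      then show "damped_square (Q (x (Suc k) \<omega> - xs)) \<le> damped_square (Q (?y \<omega>)) - 2 * a k * ((g (?y \<omega>) *\<^sub>R ?y \<omega>) \<bullet> ?e \<omega>)
        + Cs * ((a k)\<^sup>2 * (Q (?y \<omega>) * (norm (?e \<omega>))\<^sup>2) + a k ^ p * norm (?e \<omega>) ^ p)"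
      proof -
        have "2 * a k * ((g y *\<^sub>R y) \<bullet> e) = 2 * (Q y * (2 + Q y) / (1 + Q y)\<^sup>2) * (a k * (y \<bullet> e))"
          by (simp add: g_def)
        moreover have "(a k)\<^sup>2 * (Q y * (norm e)\<^sup>2) + a k ^ p * norm e ^ p = Q y * t\<^sup>2 + t ^ p"
          by (simp add: t_def power_mult_distrib)
        ultimately show ?thesis
          using \<open>damped_square (Q y + _) \<le> _\<close> unfolding st y_def[symmetric] e_def[symmetric] by presburger
      qed
    qed
    also have "\<dots> = (\<integral>\<omega>. damped_square (Q (?y \<omega>)) \<partial>P)
        + Cs * ((a k)\<^sup>2 * (\<integral>\<omega>. Q (?y \<omega>) * (norm (?e \<omega>))\<^sup>2 \<partial>P) + a k ^ p * (\<integral>\<omega>. norm (?e \<omega>) ^ p \<partial>P))"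
      using ds_int[OF Qd Q_nonneg] orth m2(1) mp(1) by simp
    also have "\<dots> \<le> (1 - lam * a k) * u k + Cs * ((B * C2 + Bp) * (a k * real k powr (- r)))"
    proof (intro add_mono mult_left_mono Cs)
      have l1: "0 \<le> 1 - lam * a k" "1 - lam * a k \<le> 1" using lam k a0 by auto
      have "(\<integral>\<omega>. damped_square (Q (?y \<omega>)) \<partial>P) \<le> (\<integral>\<omega>. (1 - lam * a k) * damped_square (Q (x k \<omega> - xs)) \<partial>P)"
      proof (intro integral_mono ds_int Qd Q_nonneg integrable_mult_right integrable_Q k)
        fix \<omega>
        have "damped_square (Q (?y \<omega>)) \<le> damped_square ((1 - lam * a k) * Q (x k \<omega> - xs))"
          by (intro damped_square_mono Q_nonneg lam k)
        also have "\<dots> \<le> (1 - lam * a k) * damped_square (Q (x k \<omega> - xs))"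
          by (intro damped_square_contract Q_nonneg l1)
        finally show "damped_square (Q (?y \<omega>)) \<le> (1 - lam * a k) * damped_square (Q (x k \<omega> - xs))" .
      qed
      then show "(\<integral>\<omega>. damped_square (Q (?y \<omega>)) \<partial>P) \<le> (1 - lam * a k) * u k" by (simp add: u_def)
      have kp: "1 \<le> real k" using k by simp
      have "(\<integral>\<omega>. Q (?y \<omega>) \<partial>P) \<le> (\<integral>\<omega>. Q (x k \<omega> - xs) \<partial>P)"
      proof (intro integral_mono Qd integrable_Q k)
        fix \<omega>
        have "(1 - lam * a k) * Q (x k \<omega> - xs) \<le> 1 * Q (x k \<omega> - xs)" using l1 Q_nonneg by (intro mult_right_mono) auto
        with lam(3)[OF k, of "x k \<omega>"] show "Q (?y \<omega>) \<le> Q (x k \<omega> - xs)" by simp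
      qed
      then have "(\<integral>\<omega>. Q (?y \<omega>) \<partial>P) \<le> C2 * real k powr (- (\<alpha> + q))" using C2(2)[OF k(2)] by simp
      then have "B * real k powr (- q) * (\<integral>\<omega>. Q (?y \<omega>) \<partial>P) \<le> B * real k powr (- q) * (C2 * real k powr (- (\<alpha> + q)))"
        using B by (intro mult_left_mono) auto
      then have "(\<integral>\<omega>. Q (?y \<omega>) * (norm (?e \<omega>))\<^sup>2 \<partial>P) \<le> B * real k powr (- q) * (C2 * real k powr (- (\<alpha> + q)))"
        using m2(2) by linarith
      then have "(a k)\<^sup>2 * (\<integral>\<omega>. Q (?y \<omega>) * (norm (?e \<omega>))\<^sup>2 \<partial>P)
          \<le> (a k * real k powr (- \<alpha>)) * (B * real k powr (- q) * (C2 * real k powr (- (\<alpha> + q))))"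
        using a_le[OF k(2)] a0 Q_nonneg unfolding power2_eq_square
        by (intro mult_mono mult_nonneg_nonneg) auto
      also have "\<dots> = B * C2 * a k * real k powr (- (2 * (\<alpha> + q)))"
        by (simp add: algebra_simps flip: powr_add)
      also have "\<dots> \<le> B * C2 * a k * real k powr (- r)"
        using r B C2 a0 kp by (intro mult_left_mono powr_mono) auto
      finally have i1: "(a k)\<^sup>2 * (\<integral>\<omega>. Q (?y \<omega>) * (norm (?e \<omega>))\<^sup>2 \<partial>P) \<le> B * C2 * a k * real k powr (- r)" .
      \<comment> \<open>Again one factor is reserved for the contraction; the other p - 1 become
        powers of k.\<close>
      have "a k ^ p = a k * a k ^ (p - 1)" using p by (cases p) auto
      also have "a k ^ (p - 1) \<le> (real k powr (- \<alpha>)) ^ (p - 1)" using a_le[OF k(2)] a0 by (intro power_mono) auto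
      also have "(real k powr (- \<alpha>)) ^ (p - 1) = real k powr (- (\<alpha> * (real p - 1)))"
        using p kp by (simp add: powr_power of_nat_diff algebra_simps)
      finally have "a k ^ p \<le> a k * real k powr (- (\<alpha> * (real p - 1)))" using a0 by simp
      then have "a k ^ p * (\<integral>\<omega>. norm (?e \<omega>) ^ p \<partial>P)
          \<le> (a k * real k powr (- (\<alpha> * (real p - 1)))) * (Bp * real k powr (- (q * real p / 2)))"
        using mp(2) a0 by (intro mult_mono mult_nonneg_nonneg) auto
      also have "\<dots> = Bp * a k * real k powr (- (\<alpha> * (real p - 1) + q * real p / 2))"
        by (simp add: algebra_simps flip: powr_add)
      also have "\<dots> \<le> Bp * a k * real k powr (- r)"
        using r Bp a0 kp by (intro mult_left_mono powr_mono) auto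
      finally show "(a k)\<^sup>2 * (\<integral>\<omega>. Q (?y \<omega>) * (norm (?e \<omega>))\<^sup>2 \<partial>P) + a k ^ p * (\<integral>\<omega>. norm (?e \<omega>) ^ p \<partial>P)
         \<le> (B * C2 + Bp) * (a k * real k powr (- r))"
        using i1 by (simp add: algebra_simps)
    qed
    finally show ?thesis by (simp add: mult.assoc)
  qed
  obtain C where "0 < C" "\<And>k. k \<ge> 1 \<Longrightarrow> u k \<le> C * real k powr (- r)"
    by (rule recursion_powr_decay[OF lam(1) alpha c r(3) _ a_eq rec]) (use B Bp C2 Cs in auto)
  then show ?thesis using that by (simp add: u_def)
qed

end

section \<open>Covariance of the noise\<close>

lemma norm_outer: "norm (outer u v) = norm u * norm v"
proof -
  have "(norm (outer u v))\<^sup>2 = (norm u * norm v)\<^sup>2"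
    unfolding power_mult_distrib power2_norm_eq_inner
    by (simp add: inner_vec_def outer_def sum_product power2_eq_square mult_ac sum_distrib_left sum_distrib_right)
       (rule sum.swap)
  then show ?thesis by (simp add: power2_eq_iff_nonneg)
qed

lemma bounded_bilinear_outer: "bounded_bilinear outer"
proof
  show "\<exists>K. \<forall>u v. norm (outer u v) \<le> norm u * norm v * K"
    by (rule exI[of _ 1]) (simp add: norm_outer)
qed (simp_all add: outer_def vec_eq_iff algebra_simps)

lemma outer_matrix_vector: "outer (A *v u) (A *v v) = A ** outer u v ** transpose A"
  by (simp add: vec_eq_iff outer_def matrix_vector_mult_def matrix_matrix_mult_def transpose_def
      sum_product sum_distrib_left sum_distrib_right mult_ac)

lemma bounded_linear_sandwich:
  fixes A C :: "real ^ 'n ^ 'n"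
  shows "bounded_linear (\<lambda>M. A ** M ** C)"
  unfolding linear_conv_bounded_linear[symmetric]
proof (rule linearI)
  show "A ** (M + M') ** C = A ** M ** C + A ** M' ** C" for M M' :: "real ^ 'n ^ 'n"
    by (simp add: vec_eq_iff matrix_matrix_mult_def sum_distrib_right distrib_left distrib_right sum.distrib)
  show "A ** (r *\<^sub>R M) ** C = r *\<^sub>R (A ** M ** C)" for r and M :: "real ^ 'n ^ 'n"
    by (simp add: vec_eq_iff matrix_matrix_mult_def sum_distrib_left sum_distrib_right mult_ac)
qed

lemma L2_le_outer:
  fixes X Y :: "'a \<Rightarrow> real ^ 'n"
  assumes X: "L2_le P X s" and Y: "L2_le P Y t"
  shows "integrable P (\<lambda>\<omega>. outer (X \<omega>) (Y \<omega>))" "norm (\<integral>\<omega>. outer (X \<omega>) (Y \<omega>) \<partial>P) \<le> s * t"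
proof -
  note [measurable] = L2_leD(1)[OF X] L2_leD(1)[OF Y]
  have meas: "(\<lambda>\<omega>. outer (X \<omega>) (Y \<omega>)) \<in> borel_measurable P"
    by (rule borel_measurable_continuous_Pair)
       (auto intro!: bounded_bilinear.continuous_on[OF bounded_bilinear_outer] continuous_intros)
  show "integrable P (\<lambda>\<omega>. outer (X \<omega>) (Y \<omega>))"
    by (rule Bochner_Integration.integrable_bound[OF L2_le_mult(1)[OF X Y] meas]) (simp add: norm_outer)
  have "norm (\<integral>\<omega>. outer (X \<omega>) (Y \<omega>) \<partial>P) \<le> (\<integral>\<omega>. norm (X \<omega>) * norm (Y \<omega>) \<partial>P)"
    using integral_norm_bound[of P "\<lambda>\<omega>. outer (X \<omega>) (Y \<omega>)"] by (simp add: norm_outer)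
  also note L2_le_mult(2)[OF X Y]
  finally show "norm (\<integral>\<omega>. outer (X \<omega>) (Y \<omega>) \<partial>P) \<le> s * t" .
qed

lemma L2_le_outer_add:
  fixes X Y :: "'a \<Rightarrow> real ^ 'n"
  assumes X: "L2_le P X s" and Y: "L2_le P Y t"
  shows "(\<integral>\<omega>. outer (X \<omega> + Y \<omega>) (X \<omega> + Y \<omega>) \<partial>P) = (\<integral>\<omega>. outer (X \<omega>) (X \<omega>) \<partial>P)
     + ((\<integral>\<omega>. outer (X \<omega>) (Y \<omega>) \<partial>P) + (\<integral>\<omega>. outer (Y \<omega>) (X \<omega>) \<partial>P)) + (\<integral>\<omega>. outer (Y \<omega>) (Y \<omega>) \<partial>P)"
proof -
  interpret O: bounded_bilinear outer by (rule bounded_bilinear_outer)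
  note i = L2_le_outer(1)[OF X X] L2_le_outer(1)[OF X Y] L2_le_outer(1)[OF Y X] L2_le_outer(1)[OF Y Y]
  show ?thesis using i by (simp add: O.add_left O.add_right algebra_simps)
qed

lemma integral_component:
  fixes X :: "'a \<Rightarrow> real ^ 'n ^ 'm"
  assumes "integrable P X"
  shows "(\<integral>\<omega>. X \<omega> \<partial>P) $ i $ j = (\<integral>\<omega>. X \<omega> $ i $ j \<partial>P)"
proof -
  have "bounded_linear (\<lambda>M :: real ^ 'n ^ 'm. M $ i $ j)"
    by (rule bounded_linear_compose[OF bounded_linear_vec_nth bounded_linear_vec_nth])
  from integral_bounded_linear[OF this assms] show ?thesis by simp
qed

context stochastic_descent begin

text \<open>Orthogonality makes variances add, whereas the triangle inequality would add standard
  deviations. The adaptedness in the first conclusion is what makes the next noise term orthogonal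
  to the partial sum.\<close>

lemma noise_sum_L2:
  fixes N :: "nat \<Rightarrow> real"
  shows "(\<lambda>\<omega>. \<Sum>i=1..k. N i *\<^sub>R \<E> i \<omega>) \<in> borel_measurable (F k)"
    "L2_le P (\<lambda>\<omega>. \<Sum>i=1..k. N i *\<^sub>R \<E> i \<omega>) (sqrt (\<Sum>i=1..k. (N i)\<^sup>2 * (B * real i powr (- q))))"
proof -
  have sp: "space (F j) = space P" for j using subalg by (simp add: subalgebra_def)
  have sub: "subalgebra (F j) (F i)" if "i \<le> j" for i j
    using F_mono[OF that] by (simp add: subalgebra_def sp)
  show meas: "(\<lambda>\<omega>. \<Sum>i=1..k. N i *\<^sub>R \<E> i \<omega>) \<in> borel_measurable (F k)" for k
    by (intro borel_measurable_sum borel_measurable_scaleR borel_measurable_const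
        measurable_from_subalg[OF sub noise_meas]) auto
  show "L2_le P (\<lambda>\<omega>. \<Sum>i=1..k. N i *\<^sub>R \<E> i \<omega>) (sqrt (\<Sum>i=1..k. (N i)\<^sup>2 * (B * real i powr (- q))))"
  proof (induction k)
    case 0
    show ?case using L2_le_zero by simp
  next
    case (Suc k)
    let ?Z = "\<lambda>\<omega>. \<Sum>i=1..k. N i *\<^sub>R \<E> i \<omega>" and ?e = "\<E> (Suc k)" and ?n = "N (Suc k)"
    have k: "Suc k \<ge> 1" by simp
    have "?Z \<in> borel_measurable (F (Suc k - 1))" using meas[of k] by simp
    note orth = noise_orthogonal[OF k this Suc.IH]
    note e = L2_leD[OF noise_L2[OF k]] and Z = L2_leD[OF Suc.IH]
    have s0: "0 \<le> (\<Sum>i=1..k. (N i)\<^sup>2 * (B * real i powr (- q)))" using B by (intro sum_nonneg) auto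
    have eq: "(norm (?Z \<omega> + ?n *\<^sub>R ?e \<omega>))\<^sup>2 = (norm (?Z \<omega>))\<^sup>2 + (2 * ?n * (?Z \<omega> \<bullet> ?e \<omega>) + ?n\<^sup>2 * (norm (?e \<omega>))\<^sup>2)" for \<omega>
      unfolding power2_norm_eq_inner by (simp add: inner_add inner_commute power2_eq_square)
    have "L2_le P (\<lambda>\<omega>. ?Z \<omega> + ?n *\<^sub>R ?e \<omega>) (sqrt ((\<Sum>i=1..k. (N i)\<^sup>2 * (B * real i powr (- q))) + ?n\<^sup>2 * (B * real (Suc k) powr (- q))))"
    proof (rule L2_leI_integrable)
      show "(\<lambda>\<omega>. ?Z \<omega> + ?n *\<^sub>R ?e \<omega>) \<in> borel_measurable P" using Z(1) e(1) by measurable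
      show "integrable P (\<lambda>\<omega>. (norm (?Z \<omega> + ?n *\<^sub>R ?e \<omega>))\<^sup>2)"
        unfolding eq by (intro Bochner_Integration.integrable_add integrable_mult_right e Z orth)
      have "(\<integral>\<omega>. (norm (?Z \<omega> + ?n *\<^sub>R ?e \<omega>))\<^sup>2 \<partial>P) = (\<integral>\<omega>. (norm (?Z \<omega>))\<^sup>2 \<partial>P) + ?n\<^sup>2 * (\<integral>\<omega>. (norm (?e \<omega>))\<^sup>2 \<partial>P)"
        unfolding eq using e(3) Z(3) orth by simp
      also have "\<dots> \<le> (\<Sum>i=1..k. (N i)\<^sup>2 * (B * real i powr (- q))) + ?n\<^sup>2 * (B * real (Suc k) powr (- q))"
        using Z(4) e(4) s0 B by (intro add_mono mult_left_mono) auto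
      finally show "(\<integral>\<omega>. (norm (?Z \<omega> + ?n *\<^sub>R ?e \<omega>))\<^sup>2 \<partial>P) \<le> \<dots>" .
    qed
    then show ?case by simp
  qed
qed

text \<open>The matrix form of the same orthogonality: the two mixed outer products are not equal,
  and each vanishes entry by entry.\<close>

lemma noise_sum_covariance:
  fixes N :: "nat \<Rightarrow> real"
  shows "(\<integral>\<omega>. outer (\<Sum>i=1..k. N i *\<^sub>R \<E> i \<omega>) (\<Sum>i=1..k. N i *\<^sub>R \<E> i \<omega>) \<partial>P)
     = (\<Sum>i=1..k. (N i)\<^sup>2 *\<^sub>R (\<integral>\<omega>. outer (\<E> i \<omega>) (\<E> i \<omega>) \<partial>P))"
proof (induction k)
  case 0
  interpret O: bounded_bilinear outer by (rule bounded_bilinear_outer)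
  show ?case by (simp add: O.zero_left)
next
  case (Suc k)
  interpret O: bounded_bilinear outer by (rule bounded_bilinear_outer)
  let ?Z = "\<lambda>\<omega>. \<Sum>i=1..k. N i *\<^sub>R \<E> i \<omega>" and ?e = "\<E> (Suc k)" and ?n = "N (Suc k)"
  have k: "Suc k \<ge> 1" by simp
  note ZL = noise_sum_L2(2)[where N = N and k = k]
  have "?Z \<in> borel_measurable (F (Suc k - 1))" using noise_sum_L2(1)[where N = N and k = k] by simp
  note c = noise_orthogonal_component[OF k this ZL]
  note int = L2_le_outer(1)[OF ZL noise_L2[OF k]] L2_le_outer(1)[OF noise_L2[OF k] ZL]
  have z1: "(\<integral>\<omega>. outer (?Z \<omega>) (?e \<omega>) \<partial>P) = 0"
    unfolding vec_eq_iff integral_component[OF int(1)]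
    using c(2) by (simp only: outer_def vec_lambda_beta zero_index simp_thms)
  have z2: "(\<integral>\<omega>. outer (?e \<omega>) (?Z \<omega>) \<partial>P) = 0"
    unfolding vec_eq_iff integral_component[OF int(2)]
    using c(2) by (simp only: outer_def vec_lambda_beta zero_index simp_thms mult.commute[of "\<E> (Suc k) _ $ _"])
  have "(\<integral>\<omega>. outer (?Z \<omega> + ?n *\<^sub>R ?e \<omega>) (?Z \<omega> + ?n *\<^sub>R ?e \<omega>) \<partial>P)
     = (\<integral>\<omega>. outer (?Z \<omega>) (?Z \<omega>) \<partial>P) + ?n\<^sup>2 *\<^sub>R (\<integral>\<omega>. outer (?e \<omega>) (?e \<omega>) \<partial>P)"
    unfolding L2_le_outer_add[OF ZL L2_le_scaleR[OF noise_L2[OF k], of ?n]]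
    using z1 z2 by (simp add: O.scaleR_left O.scaleR_right power2_eq_square)
  then show ?case using Suc by simp
qed

text \<open>Disintegration is available for real functions, so the covariance is treated entrywise.
  The norm bound, uniform in \<open>y\<close>, controls the conditional covariance far from
  \<open>xs\<close>, where no convergence is assumed.\<close>

lemma noise_product_law:
  assumes k: "k \<ge> 1"
  shows "(\<integral>\<omega>. outer (\<E> k \<omega>) (\<E> k \<omega>) \<partial>P) $ i $ j = (\<integral>\<omega>. (\<integral>e. outer e e \<partial>\<kappa> k (x k \<omega>)) $ i $ j \<partial>P)"
    "integrable P (\<lambda>\<omega>. (\<integral>e. outer e e \<partial>\<kappa> k (x k \<omega>)) $ i $ j)"
    "norm (\<integral>e. outer e e \<partial>\<kappa> k y) \<le> B * real k powr (- q)"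
proof -
  define h :: "real ^ 'n \<Rightarrow> real" where "h = (\<lambda>e. e $ i * e $ j)"
  note ker = cond_law_kernel[OF noise_law[OF k]]
  have hm: "h \<in> borel_measurable borel"
    unfolding h_def by (intro borel_measurable_times measurable_vec_nth) auto
  have hb: "\<bar>h e\<bar> \<le> (norm e)\<^sup>2" for e
    unfolding h_def abs_mult power2_eq_square by (intro mult_mono component_le_norm_cart) auto
  have "(\<integral>\<^sup>+e. ennreal \<bar>h e\<bar> \<partial>\<kappa> k y) \<le> ennreal (B * real k powr (- q))" for y
    using hb by (intro order_trans[OF nn_integral_mono variance[OF k]] ennreal_leI)
  note law = cond_law_integral[OF prob_space_axioms x_measurable[OF k] noise_measurable[OF k] noise_law[OF k] hm this]
  have kL2: "L2_le (\<kappa> k y) (\<lambda>e. e) (sqrt (B * real k powr (- q)))" for y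
  proof (rule L2_leI_integrable)
    show m: "(\<lambda>e. e) \<in> borel_measurable (\<kappa> k y)" using ker(2) by (simp cong: measurable_cong_sets)
    then have m2: "(\<lambda>e. (norm e)\<^sup>2) \<in> borel_measurable (\<kappa> k y)" by measurable
    show int: "integrable (\<kappa> k y) (\<lambda>e. (norm e)\<^sup>2)"
      by (rule integrableI_bounded[OF m2]) (use variance[OF k, of y] in \<open>auto intro: le_less_trans\<close>)
    show "(\<integral>e. (norm e)\<^sup>2 \<partial>\<kappa> k y) \<le> B * real k powr (- q)"
      using variance[OF k, of y] nn_integral_eq_integral[OF int] B by simp
  qed
  have comp: "(\<integral>e. outer e e \<partial>\<kappa> k y) $ i $ j = (\<integral>e. h e \<partial>\<kappa> k y)" for y
    unfolding integral_component[OF L2_le_outer(1)[OF kL2 kL2]] by (simp add: outer_def h_def)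
  show "integrable P (\<lambda>\<omega>. (\<integral>e. outer e e \<partial>\<kappa> k (x k \<omega>)) $ i $ j)" unfolding comp by (rule law(2))
  have "(\<integral>\<omega>. outer (\<E> k \<omega>) (\<E> k \<omega>) \<partial>P) $ i $ j = (\<integral>\<omega>. h (\<E> k \<omega>) \<partial>P)"
    unfolding integral_component[OF L2_le_outer(1)[OF noise_L2[OF k] noise_L2[OF k]]] by (simp add: outer_def h_def)
  then show "(\<integral>\<omega>. outer (\<E> k \<omega>) (\<E> k \<omega>) \<partial>P) $ i $ j = (\<integral>\<omega>. (\<integral>e. outer e e \<partial>\<kappa> k (x k \<omega>)) $ i $ j \<partial>P)"
    unfolding comp law(3) .
  show "norm (\<integral>e. outer e e \<partial>\<kappa> k y) \<le> B * real k powr (- q)"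
    using L2_le_outer(2)[OF kL2 kL2, of y] B by simp
qed

text \<open>Near \<open>xs\<close> uniform convergence and continuity apply; elsewhere the scaled
  conditional covariance is merely bounded, and the second-moment decay of the iterates makes that
  region negligible.\<close>

lemma noise_covariance_limit:
  fixes N :: "nat \<Rightarrow> real" and U :: "real ^ 'n \<Rightarrow> real ^ 'n ^ 'n"
  assumes N: "\<And>k. k \<ge> 1 \<Longrightarrow> 0 < N k" "\<And>k. k \<ge> 1 \<Longrightarrow> N k \<le> n1 * real k powr q"
    and V: "open V" "xs \<in> V"
    and U_lim: "uniform_limit V (\<lambda>k y. N k *\<^sub>R (\<integral>e. outer e e \<partial>\<kappa> k y)) U sequentially"
    and U_cont: "continuous_on V U"
  shows "(\<lambda>k. N k *\<^sub>R (\<integral>\<omega>. outer (\<E> k \<omega>) (\<E> k \<omega>) \<partial>P)) \<longlonglongrightarrow> U xs"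
proof (intro vec_tendstoI)
  fix i j
  define u where "u = (\<lambda>k y. (N k *\<^sub>R (\<integral>e. outer e e \<partial>\<kappa> k y)) $ i $ j)"
  obtain C where C: "0 < C" "\<And>k. k \<ge> 1 \<Longrightarrow> L2_le P (\<lambda>\<omega>. x k \<omega> - xs) (C * real k powr (- ((\<alpha> + q) / 2)))"
    using iterates_L2_decay by blast
  have comp: "\<bar>M $ i $ j\<bar> \<le> norm M" for M :: "real ^ 'n ^ 'n"
    by (rule order_trans[OF component_le_norm_cart Finite_Cartesian_Product.norm_nth_le])
  \<comment> \<open>The growth k^q of \<open>N\<close> cancels the decay k^-q of the conditional
    covariance, so the scaled covariance differs from its limit by at most this constant
    everywhere.\<close>
  define A where "A = \<bar>n1\<bar> * B + norm (U xs)"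
  have A0: "0 \<le> A" using B by (simp add: A_def)
  have bound: "\<bar>u k y - U xs $ i $ j\<bar> \<le> A" if k: "k \<ge> 1" for k y
  proof -
    have "\<bar>u k y\<bar> \<le> norm (N k *\<^sub>R (\<integral>e. outer e e \<partial>\<kappa> k y))" unfolding u_def by (rule comp)
    also have "\<dots> = N k * norm (\<integral>e. outer e e \<partial>\<kappa> k y)" using N(1)[OF k] by simp
    also have "\<dots> \<le> (\<bar>n1\<bar> * real k powr q) * (B * real k powr (- q))"
    proof (rule mult_mono)
      have "n1 * real k powr q \<le> \<bar>n1\<bar> * real k powr q" by (rule mult_right_mono) auto
      then show "N k \<le> \<bar>n1\<bar> * real k powr q" using N(2)[OF k] by linarith
    qed (use noise_product_law(3)[OF k] in auto)
    also have "\<dots> = \<bar>n1\<bar> * B" using k by (simp add: powr_minus)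
    finally show ?thesis using comp[of "U xs"] by (simp add: A_def)
  qed
  have "(\<lambda>k. (\<integral>\<omega>. u k (x k \<omega>) \<partial>P)) \<longlonglongrightarrow> U xs $ i $ j"
  proof (rule LIMSEQ_I)
    fix e :: real assume e: "0 < e"
    obtain d where d: "0 < d" "\<And>y. dist y xs < d \<Longrightarrow> y \<in> V \<and> dist (U y) (U xs) < e / 4"
    proof -
      obtain d1 where d1: "0 < d1" "\<And>y. dist y xs < d1 \<Longrightarrow> y \<in> V" using V by (auto simp: open_dist)
      obtain d2 where d2: "0 < d2" "\<And>y. y \<in> V \<Longrightarrow> dist y xs < d2 \<Longrightarrow> dist (U y) (U xs) < e / 4"
        using U_cont V(2) e unfolding continuous_on_iff by (metis divide_pos_pos zero_less_numeral)
      show ?thesis using that[of "min d1 d2"] d1 d2 by auto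
    qed
    have "\<forall>\<^sub>F k in sequentially. \<forall>y\<in>V. dist (N k *\<^sub>R (\<integral>e. outer e e \<partial>\<kappa> k y)) (U y) < e / 4"
      using uniform_limitD[OF U_lim, of "e/4"] e by simp
    moreover have "(\<lambda>k. A / d\<^sup>2 * (C\<^sup>2 * real k powr (- (\<alpha> + q)))) \<longlonglongrightarrow> A / d\<^sup>2 * (C\<^sup>2 * 0)"
      by (intro tendsto_mult tendsto_const tendsto_neg_powr[OF _ filterlim_real_sequentially]) (use alpha q in auto)
    then have "\<forall>\<^sub>F k in sequentially. A / d\<^sup>2 * (C\<^sup>2 * real k powr (- (\<alpha> + q))) < e / 4"
      by (rule order_tendstoD) (use e in simp)
    ultimately have "\<forall>\<^sub>F k in sequentially. norm ((\<integral>\<omega>. u k (x k \<omega>) \<partial>P) - U xs $ i $ j) < e"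
      using eventually_ge_at_top[of 1]
    proof eventually_elim
      case (elim k)
      note s = L2_leD[OF C(2)[OF elim(3)]]
      have ui: "integrable P (\<lambda>\<omega>. u k (x k \<omega>))"
        unfolding u_def using noise_product_law(2)[OF elim(3)] by simp
      \<comment> \<open>Chebyshev's inequality in pointwise form: outside the ball of radius
        \<open>d\<close> the factor |y - xs|^2 / d^2 is at least 1 and carries the crude bound
        \<open>A\<close>; inside, each of two errors costs e/4.\<close>
      have pt: "\<bar>u k y - U xs $ i $ j\<bar> \<le> e / 2 + A / d\<^sup>2 * (norm (y - xs))\<^sup>2" for y
      proof (cases "dist y xs < d")
        case True
        have "\<bar>(N k *\<^sub>R (\<integral>e. outer e e \<partial>\<kappa> k y) - U y) $ i $ j\<bar> < e / 4"
          using comp[of "N k *\<^sub>R (\<integral>e. outer e e \<partial>\<kappa> k y) - U y"] elim(1) d(2)[OF True] by (auto simp: dist_norm intro: le_less_trans)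
        moreover have "\<bar>(U y - U xs) $ i $ j\<bar> < e / 4"
          using comp[of "U y - U xs"] d(2)[OF True] by (auto simp: dist_norm intro: le_less_trans)
        ultimately have "\<bar>u k y - U xs $ i $ j\<bar> \<le> e / 2"
          unfolding u_def vector_minus_component by linarith
        moreover have "0 \<le> A / d\<^sup>2 * (norm (y - xs))\<^sup>2" using A0 by simp
        ultimately show ?thesis by linarith
      next
        case False
        then have "d\<^sup>2 \<le> (norm (y - xs))\<^sup>2" using d(1) by (intro power_mono) (auto simp: dist_norm)
        then have "A * 1 \<le> A * ((norm (y - xs))\<^sup>2 / d\<^sup>2)" using A0 d(1) by (intro mult_left_mono) auto
        then show ?thesis using bound[OF elim(3), of y] e by simp
      qed
      have "(\<integral>\<omega>. u k (x k \<omega>) \<partial>P) - U xs $ i $ j = (\<integral>\<omega>. u k (x k \<omega>) - U xs $ i $ j \<partial>P)"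
        using ui by (simp add: prob_space)
      also have "norm \<dots> \<le> (\<integral>\<omega>. norm (u k (x k \<omega>) - U xs $ i $ j) \<partial>P)" by (rule integral_norm_bound)
      also have "\<dots> \<le> (\<integral>\<omega>. e / 2 + A / d\<^sup>2 * (norm (x k \<omega> - xs))\<^sup>2 \<partial>P)"
        using pt ui s(3) by (intro integral_mono) auto
      also have "\<dots> = e / 2 + A / d\<^sup>2 * (\<integral>\<omega>. (norm (x k \<omega> - xs))\<^sup>2 \<partial>P)"
        using s(3) by (simp add: prob_space)
      also have "\<dots> \<le> e / 2 + A / d\<^sup>2 * (C * real k powr (- ((\<alpha> + q) / 2)))\<^sup>2"
        using s(4) A0 by (intro add_left_mono mult_left_mono) auto
      also have "(C * real k powr (- ((\<alpha> + q) / 2)))\<^sup>2 = C\<^sup>2 * real k powr (- (\<alpha> + q))"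
      proof -
        have "(real k powr (- ((\<alpha> + q) / 2)))\<^sup>2 = real k powr (- ((\<alpha> + q) / 2) + - ((\<alpha> + q) / 2))"
          by (simp only: power2_eq_square powr_add)
        then show ?thesis by (simp add: power_mult_distrib)
      qed
      finally show ?case using elim(2) e by linarith
    qed
    then show "\<exists>no. \<forall>k\<ge>no. norm ((\<integral>\<omega>. u k (x k \<omega>) \<partial>P) - U xs $ i $ j) < e"
      by (simp add: eventually_sequentially)
  qed
  moreover have "\<forall>\<^sub>F k in sequentially. (\<integral>\<omega>. u k (x k \<omega>) \<partial>P) = (N k *\<^sub>R (\<integral>\<omega>. outer (\<E> k \<omega>) (\<E> k \<omega>) \<partial>P)) $ i $ j"
    using eventually_ge_at_top[of 1]
    by eventually_elim (simp add: u_def noise_product_law(1))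
  ultimately show "(\<lambda>k. (N k *\<^sub>R (\<integral>\<omega>. outer (\<E> k \<omega>) (\<E> k \<omega>) \<partial>P)) $ i $ j) \<longlonglongrightarrow> U xs $ i $ j"
    by (rule Lim_transform_eventually)
qed

end

section \<open>Covariance of the weighted average\<close>

lemma matrix_vector_mult_sum: "A *v (\<Sum>i\<in>I. c i *\<^sub>R v i) = (\<Sum>i\<in>I. c i *\<^sub>R (A *v v i))"
  for A :: "real ^ 'n ^ 'n"
  by (simp add: linear_sum[OF matrix_vector_mul_linear] matrix_vector_mult_scaleR)

context stochastic_descent begin

lemma remainder_L2_decay:
  assumes R: "\<And>y. (norm (G y - S *v (y - xs)))\<^sup>2 \<le> CR * damped_square ((norm (y - xs))\<^sup>2)" and CR: "0 \<le> CR"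
    and p: "2 \<le> p" "p \<le> 4" and Bp: "0 \<le> Bp"
    and moment: "\<And>k y. k \<ge> 1 \<Longrightarrow>
          (\<integral>\<^sup>+e. ennreal (norm e ^ p) \<partial>\<kappa> k y) \<le> ennreal (Bp * real k powr (- (q * real p / 2)))"
    and r: "r \<le> 2 * (\<alpha> + q)" "r \<le> \<alpha> * (real p - 1) + q * real p / 2" "0 \<le> r"
  obtains C where "0 \<le> C"
    "\<And>k. k \<ge> 1 \<Longrightarrow> L2_le P (\<lambda>\<omega>. G (x k \<omega>) - S *v (x k \<omega> - xs)) (C * real k powr (- (r / 2)))"
proof -
  obtain C where C: "0 < C" "\<And>k. k \<ge> 1 \<Longrightarrow> (\<integral>\<omega>. damped_square (Q (x k \<omega> - xs)) \<partial>P) \<le> C * real k powr (- r)"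
    using damped_moment_decay[OF p Bp moment r] by blast
  obtain d where d: "0 < d" "\<And>y. d * (norm y)\<^sup>2 \<le> Q y" using Q_lower by blast
  \<comment> \<open>The price of passing from the Euclidean norm to the quadratic form; the maximum
    with 1 is there because scaling of the damped square is available for factors at least
    1.\<close>
  define m where "m = max 1 (1 / d)"
  have m: "1 \<le> m" "1 / d \<le> m" by (auto simp: m_def)
  have le: "(norm (G y - S *v (y - xs)))\<^sup>2 \<le> (CR * m\<^sup>2) * damped_square (Q (y - xs))" for y
  proof -
    have "(norm (y - xs))\<^sup>2 \<le> (1 / d) * Q (y - xs)" using d by (simp add: field_simps)
    also have "\<dots> \<le> m * Q (y - xs)" using m Q_nonneg by (intro mult_right_mono) auto
    finally have "damped_square ((norm (y - xs))\<^sup>2) \<le> damped_square (m * Q (y - xs))"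
      by (intro damped_square_mono) auto
    also have "\<dots> \<le> m\<^sup>2 * damped_square (Q (y - xs))" by (rule damped_square_scale[OF Q_nonneg m(1)])
    finally have "CR * damped_square ((norm (y - xs))\<^sup>2) \<le> CR * (m\<^sup>2 * damped_square (Q (y - xs)))"
      using CR by (rule mult_left_mono)
    with R[of y] show ?thesis by (simp add: mult.assoc)
  qed
  have "L2_le P (\<lambda>\<omega>. G (x k \<omega>) - S *v (x k \<omega> - xs)) (sqrt (CR * m\<^sup>2 * C) * real k powr (- (r / 2)))" if k: "k \<ge> 1" for k
  proof -
    note [measurable] = x_measurable[OF k]
    have ds: "integrable P (\<lambda>\<omega>. damped_square (Q (x k \<omega> - xs)))"
      by (rule Bochner_Integration.integrable_bound[OF integrable_Q[OF k]])
        (use Q_nonneg damped_square_nonneg damped_square_le in \<open>auto intro!: AE_I2\<close>)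
    have m1: "(\<lambda>\<omega>. G (x k \<omega>) - S *v (x k \<omega> - xs)) \<in> borel_measurable P" by measurable
    have int: "integrable P (\<lambda>\<omega>. (norm (G (x k \<omega>) - S *v (x k \<omega> - xs)))\<^sup>2)"
    proof (rule Bochner_Integration.integrable_bound[OF integrable_mult_right[OF ds, of "CR * m\<^sup>2"]])
      show "AE \<omega> in P. norm ((norm (G (x k \<omega>) - S *v (x k \<omega> - xs)))\<^sup>2) \<le> norm (CR * m\<^sup>2 * damped_square (Q (x k \<omega> - xs)))"
        by (rule AE_I2) (use le in \<open>auto intro: order_trans[OF _ abs_ge_self]\<close>)
    qed measurable
    have "(\<integral>\<omega>. (norm (G (x k \<omega>) - S *v (x k \<omega> - xs)))\<^sup>2 \<partial>P) \<le> (\<integral>\<omega>. (CR * m\<^sup>2) * damped_square (Q (x k \<omega> - xs)) \<partial>P)"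
      by (intro integral_mono int integrable_mult_right ds le)
    also have "\<dots> \<le> (CR * m\<^sup>2) * (C * real k powr (- r))"
      using C(2)[OF k] CR by (simp add: mult_left_mono)
    finally have "(\<integral>\<omega>. (norm (G (x k \<omega>) - S *v (x k \<omega> - xs)))\<^sup>2 \<partial>P) \<le> CR * m\<^sup>2 * C * real k powr (- r)"
      by (simp add: mult.assoc)
    from L2_leI_integrable[OF m1 int this] show ?thesis
      by (simp only: real_sqrt_mult sqrt_powr minus_divide_left)
  qed
  moreover have "0 \<le> sqrt (CR * m\<^sup>2 * C)" using CR C by simp
  ultimately show ?thesis using that by blast
qed

text \<open>Besides the solved recursion there is an index shift: the average runs over
  \<open>x (Suc i)\<close>, while the recursion is solved for \<open>x i\<close>. The first sum of
  the residual accounts for that difference.\<close>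

lemma averaged_decomposition:
  fixes N :: "nat \<Rightarrow> real" and S :: "real ^ 'n ^ 'n"
  assumes S: "pos_def S" and \<omega>: "\<omega> \<in> space P"
  shows "(\<Sum>i=1..k. N i *\<^sub>R (x (Suc i) \<omega> - xs)) =
    - (matrix_inv S *v (\<Sum>i=1..k. N i *\<^sub>R \<E> i \<omega>)) +
    ((\<Sum>i=1..k. N i *\<^sub>R ((x (Suc i) \<omega> - xs) - (x i \<omega> - xs)))
     - matrix_inv S *v (\<Sum>i=1..k. N i *\<^sub>R (G (x i \<omega>) - S *v (x i \<omega> - xs)))
     - matrix_inv S *v (matrix_inv D *v (\<Sum>i=1..k. (N i / a i) *\<^sub>R ((x (Suc i) \<omega> - xs) - (x i \<omega> - xs)))))"
proof -
  note invD = matrix_inv_vector[OF pos_def_invertible[OF D]] and invS = matrix_inv_vector[OF pos_def_invertible[OF S]]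
  have summand: "N i *\<^sub>R (x (Suc i) \<omega> - xs) = - (N i *\<^sub>R (matrix_inv S *v \<E> i \<omega>)) +
    (N i *\<^sub>R ((x (Suc i) \<omega> - xs) - (x i \<omega> - xs))
     - N i *\<^sub>R (matrix_inv S *v (G (x i \<omega>) - S *v (x i \<omega> - xs)))
     - (N i / a i) *\<^sub>R (matrix_inv S *v (matrix_inv D *v ((x (Suc i) \<omega> - xs) - (x i \<omega> - xs)))))"
    if i: "i \<in> {1..k}" for i
  proof -
    have i1: "i \<ge> 1" using i by simp
    have a: "a i \<noteq> 0" using a_pos[OF i1] by simp
    have "(x (Suc i) \<omega> - xs) - (x i \<omega> - xs) = D *v ((- a i) *\<^sub>R (G (x i \<omega>) + \<E> i \<omega>))"
      using iter[OF i1 \<omega>] by (simp add: matrix_vector_mult_scaleR del: scaleR_minus_left) (simp add: scaleR_minus_left)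
    then have "matrix_inv D *v ((x (Suc i) \<omega> - xs) - (x i \<omega> - xs)) = (- a i) *\<^sub>R (G (x i \<omega>) + \<E> i \<omega>)"
      by (simp only: invD)
    then have "(N i / a i) *\<^sub>R (matrix_inv S *v (matrix_inv D *v ((x (Suc i) \<omega> - xs) - (x i \<omega> - xs))))
       = - (N i *\<^sub>R (matrix_inv S *v (G (x i \<omega>) + \<E> i \<omega>)))"
      using a by (simp only: matrix_vector_mult_scaleR scaleR_scaleR) simp
    then show ?thesis
      by (simp add: matrix_vector_right_distrib matrix_vector_mult_diff_distrib invS algebra_simps)
  qed
  show ?thesis
    unfolding matrix_vector_mult_sum sum_negf[symmetric] sum_subtractf[symmetric] sum.distrib[symmetric]
    by (rule sum.cong[OF refl summand])
qed

text \<open>Abel summation with the nondecreasing weights \<open>N i\<close> and \<open>N i / a i\<close> needs no control of their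
  increments, only that the iterates are of the order of the inverse square root of the weights.\<close>

lemma residual_L2:
  fixes N :: "nat \<Rightarrow> real" and S :: "real ^ 'n ^ 'n"
  assumes N: "\<And>k. k \<ge> 1 \<Longrightarrow> 0 < N k" "\<And>k. k \<ge> 1 \<Longrightarrow> N k \<le> N (Suc k)"
      "\<And>k. k \<ge> 1 \<Longrightarrow> N k \<le> n1 * real k powr q"
    and CR: "0 \<le> CR" "\<And>k. k \<ge> 1 \<Longrightarrow> L2_le P (\<lambda>\<omega>. G (x k \<omega>) - S *v (x k \<omega> - xs)) (CR * real k powr (- (r / 2)))"
    and r: "q + 1 < r"
  obtains C s where "0 \<le> C" "s < (q + 1) / 2"
    "\<And>k. k \<ge> 1 \<Longrightarrow> L2_le P (\<lambda>\<omega>. (\<Sum>i=1..k. N i *\<^sub>R ((x (Suc i) \<omega> - xs) - (x i \<omega> - xs)))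
     - matrix_inv S *v (\<Sum>i=1..k. N i *\<^sub>R (G (x i \<omega>) - S *v (x i \<omega> - xs)))
     - matrix_inv S *v (matrix_inv D *v (\<Sum>i=1..k. (N i / a i) *\<^sub>R ((x (Suc i) \<omega> - xs) - (x i \<omega> - xs)))))
     (C * real k powr s)"
proof -
  obtain C0 where C0: "0 < C0" "\<And>k. k \<ge> 1 \<Longrightarrow> L2_le P (\<lambda>\<omega>. x k \<omega> - xs) (C0 * real k powr (- ((\<alpha> + q) / 2)))"
    using iterates_L2_decay by blast
  \<comment> \<open>The first exponent comes from summing i^(q - r/2), the second from Abel
    summation with weights of order i^(\<alpha> + q). Both lie below (q + 1)/2, by r > q + 1 and by
    \<alpha> < 1; the second also makes \<open>s\<close> positive, as the power sum
    requires.\<close>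
  define s where "s = max (q - r / 2 + 1) ((q + \<alpha>) / 2)"
  have s: "q - r / 2 \<le> s - 1" "(q + \<alpha>) / 2 \<le> s" "s < (q + 1) / 2" "0 < s"
    using r alpha q by (auto simp: s_def max_def field_simps)
  have n1: "0 < n1" using N(1,3)[of 1] by simp
  \<comment> \<open>Dividing by a_i multiplies by (i + c)^\<alpha>, and i + c <= (1 + c) i. The same
    constant bounds both weight sequences, so one Abel estimate serves twice.\<close>
  define m where "m = n1 * (1 + c) powr \<alpha>"
  have m: "0 < m" using n1 c by (simp add: m_def)
  have abel: "L2_le P (\<lambda>\<omega>. \<Sum>i=1..k. b i *\<^sub>R ((x (Suc i) \<omega> - xs) - (x i \<omega> - xs))) (3 * (C0 * sqrt m) * (sqrt m * real k powr s))"
    if k: "k \<ge> 1" and b: "\<And>i. i \<ge> 1 \<Longrightarrow> 0 < b i" "\<And>i. i \<ge> 1 \<Longrightarrow> b i \<le> b (Suc i)" "\<And>i. i \<ge> 1 \<Longrightarrow> b i \<le> m * real i powr (\<alpha> + q)" for b k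
  proof -
    have sb: "sqrt (b i) \<le> sqrt m * real i powr ((\<alpha> + q) / 2)" if "i \<ge> 1" for i
      using real_sqrt_le_mono[OF b(3)[OF that]] by (simp only: real_sqrt_mult sqrt_powr)
    have "L2_le P (\<lambda>\<omega>. \<Sum>i=1..k. b i *\<^sub>R ((x (Suc i) \<omega> - xs) - (x i \<omega> - xs))) (3 * (C0 * sqrt m) * sqrt (b k))"
    proof (rule L2_le_abel_sum[where X = "\<lambda>i \<omega>. x i \<omega> - xs" and b = b and C = "C0 * sqrt m" and P = P, OF b(1,2) _ k])
      fix i :: nat assume i: "i \<ge> 1"
      show "L2_le P (\<lambda>\<omega>. x i \<omega> - xs) (C0 * sqrt m / sqrt (b i))"
      proof (rule L2_le_mono[OF C0(2)[OF i]])
        have "real i powr (- ((\<alpha> + q) / 2)) * sqrt (b i) \<le> real i powr (- ((\<alpha> + q) / 2)) * (sqrt m * real i powr ((\<alpha> + q) / 2))"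
          using sb[OF i] by (rule mult_left_mono) simp
        also have "\<dots> = sqrt m * (real i powr (- ((\<alpha> + q) / 2)) * real i powr ((\<alpha> + q) / 2))" by simp
        also have "\<dots> = sqrt m" using i by (simp flip: powr_add)
        finally show "C0 * real i powr (- ((\<alpha> + q) / 2)) \<le> C0 * sqrt m / sqrt (b i)"
          using b(1)[OF i] C0(1) by (simp add: le_divide_eq mult.assoc)
      qed
    qed
    then show ?thesis
    proof (rule L2_le_mono)
      have "real k powr ((\<alpha> + q) / 2) \<le> real k powr s" using s k by (intro powr_mono) (auto simp: add.commute)
      then have "sqrt m * real k powr ((\<alpha> + q) / 2) \<le> sqrt m * real k powr s" using m by (intro mult_left_mono) auto
      then have "sqrt (b k) \<le> sqrt m * real k powr s" using sb[OF k] by linarith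
      then show "3 * (C0 * sqrt m) * sqrt (b k) \<le> 3 * (C0 * sqrt m) * (sqrt m * real k powr s)"
        using C0(1) m by (intro mult_left_mono) auto
    qed
  qed
  have b1: "N i \<le> m * real i powr (\<alpha> + q)" if i: "i \<ge> 1" for i
  proof -
    have "1 powr \<alpha> \<le> (1 + c) powr \<alpha>" using c alpha by (intro powr_mono2) auto
    moreover have "real i powr q \<le> real i powr (\<alpha> + q)" using i alpha by (intro powr_mono) auto
    ultimately have "(n1 * 1) * real i powr q \<le> (n1 * (1 + c) powr \<alpha>) * real i powr (\<alpha> + q)"
      using n1 by (intro mult_mono mult_left_mono) auto
    then show ?thesis using N(3)[OF i] by (simp add: m_def)
  qed
  have b2: "N i / a i \<le> m * real i powr (\<alpha> + q)" if i: "i \<ge> 1" for i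
  proof -
    have "real i + c \<le> (1 + c) * real i" using i c by (simp add: algebra_simps mult_le_cancel_left1)
    then have "(real i + c) powr \<alpha> \<le> ((1 + c) * real i) powr \<alpha>" using alpha c by (intro powr_mono2) auto
    then have "N i * (real i + c) powr \<alpha> \<le> (n1 * real i powr q) * ((1 + c) powr \<alpha> * real i powr \<alpha>)"
      using N(3)[OF i] n1 c by (intro mult_mono) (auto simp: powr_mult)
    then show ?thesis by (simp add: a_eq[OF i] m_def powr_minus powr_add divide_inverse mult_ac)
  qed
  have b2_mono: "N i / a i \<le> N (Suc i) / a (Suc i)" if i: "i \<ge> 1" for i
    using N(1)[of "Suc i"] N(2)[OF i] a_pos[OF i] a_pos[of "Suc i"] a_decseq[OF i] by (intro frac_le) auto
  define oS oD where "oS = onorm ((*v) (matrix_inv S))" and "oD = onorm ((*v) (matrix_inv D))"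
  have o: "0 \<le> oS" "0 \<le> oD" unfolding oS_def oD_def by (auto intro: onorm_pos_le matrix_vector_mul_bounded_linear)
  define C1 where "C1 = 3 * (C0 * sqrt m) * sqrt m"
  define C2 where "C2 = n1 * CR * (1 + 1 / s)"
  have Rsum: "L2_le P (\<lambda>\<omega>. \<Sum>i=1..k. N i *\<^sub>R (G (x i \<omega>) - S *v (x i \<omega> - xs))) (C2 * real k powr s)" for k
  proof -
    have "L2_le P (\<lambda>\<omega>. \<Sum>i=1..k. N i *\<^sub>R (G (x i \<omega>) - S *v (x i \<omega> - xs))) (\<Sum>i=1..k. \<bar>N i\<bar> * (CR * real i powr (- (r / 2))))"
      by (intro L2_le_sum L2_le_scaleR CR) auto
    then show ?thesis
    proof (rule L2_le_mono)
      have "(\<Sum>i=1..k. \<bar>N i\<bar> * (CR * real i powr (- (r / 2)))) \<le> (\<Sum>i=1..k. n1 * CR * real i powr (s - 1))"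
      proof (rule sum_mono)
        fix i assume "i \<in> {1..k}"
        then have i: "i \<ge> 1" by simp
        have "\<bar>N i\<bar> * (CR * real i powr (- (r / 2))) \<le> (n1 * real i powr q) * (CR * real i powr (- (r / 2)))"
          using N(1,3)[OF i] CR(1) by (intro mult_right_mono) auto
        also have "\<dots> = n1 * CR * (real i powr q * real i powr (- (r / 2)))" by (simp only: mult_ac)
        also have "real i powr q * real i powr (- (r / 2)) = real i powr (q - r / 2)"
          by (subst powr_add[symmetric]) simp
        also have "n1 * CR * real i powr (q - r / 2) \<le> n1 * CR * real i powr (s - 1)" using s i n1 CR(1) by (intro mult_left_mono powr_mono) auto
        finally show "\<bar>N i\<bar> * (CR * real i powr (- (r / 2))) \<le> n1 * CR * real i powr (s - 1)" .
      qed
      also have "\<dots> = n1 * CR * (\<Sum>i=1..k. real i powr (s - 1))" by (simp add: sum_distrib_left)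
      also have "\<dots> \<le> n1 * CR * ((1 + 1 / s) * real k powr s)"
        using n1 CR(1) by (intro mult_left_mono sum_powr_le s) auto
      finally show "(\<Sum>i=1..k. \<bar>N i\<bar> * (CR * real i powr (- (r / 2)))) \<le> C2 * real k powr s" by (simp add: C2_def)
    qed
  qed
  have "L2_le P (\<lambda>\<omega>. (\<Sum>i=1..k. N i *\<^sub>R ((x (Suc i) \<omega> - xs) - (x i \<omega> - xs)))
     - matrix_inv S *v (\<Sum>i=1..k. N i *\<^sub>R (G (x i \<omega>) - S *v (x i \<omega> - xs)))
     - matrix_inv S *v (matrix_inv D *v (\<Sum>i=1..k. (N i / a i) *\<^sub>R ((x (Suc i) \<omega> - xs) - (x i \<omega> - xs)))))
     ((C1 + oS * C2 + oS * (oD * C1)) * real k powr s)" if k: "k \<ge> 1" for k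
  proof -
    have L1: "L2_le P (\<lambda>\<omega>. \<Sum>i=1..k. N i *\<^sub>R ((x (Suc i) \<omega> - xs) - (x i \<omega> - xs))) (3 * (C0 * sqrt m) * (sqrt m * real k powr s))"
      by (rule abel[OF k]) (rule N(1) N(2) b1, assumption)+
    have pos: "0 < N i / a i" if "i \<ge> 1" for i using N(1) a_pos that by simp
    have L2: "L2_le P (\<lambda>\<omega>. \<Sum>i=1..k. (N i / a i) *\<^sub>R ((x (Suc i) \<omega> - xs) - (x i \<omega> - xs))) (3 * (C0 * sqrt m) * (sqrt m * real k powr s))"
      by (rule abel[OF k]) (rule pos b2_mono b2, assumption)+
    note L = L2_le_diff[OF L2_le_diff[OF L1 L2_le_matrix[OF Rsum[of k], of "matrix_inv S"]] L2_le_matrix[OF L2_le_matrix[OF L2, of "matrix_inv D"], of "matrix_inv S"]]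
    have "3 * (C0 * sqrt m) * (sqrt m * real k powr s) + oS * (C2 * real k powr s) +
        oS * (oD * (3 * (C0 * sqrt m) * (sqrt m * real k powr s))) = (C1 + oS * C2 + oS * (oD * C1)) * real k powr s"
      unfolding C1_def by (simp only: distrib_right mult.assoc)
    with L show ?thesis by (simp only: oS_def oD_def)
  qed
  moreover have "0 \<le> C1 + oS * C2 + oS * (oD * C1)"
  proof -
    have "0 \<le> C1" using C0(1) m by (simp add: C1_def)
    moreover have "0 \<le> C2" using n1 CR(1) s(4) by (simp add: C2_def)
    ultimately show ?thesis using o by simp
  qed
  ultimately show ?thesis using that[of "C1 + oS * C2 + oS * (oD * C1)" s] s(3) by blast
qed

text \<open>With T the sum of the weights, the centred average is (H + res)/T, where
  \<open>H\<close> is the transformed noise sum. After multiplication by T the covariance is 1/T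
  times that of H + res. Since \<open>H\<close> is O(sqrt T) and \<open>res\<close> is o(sqrt T) in
  L2, Cauchy-Schwarz removes every term containing \<open>res\<close>.\<close>

lemma weighted_average_covariance:
  fixes N :: "nat \<Rightarrow> real" and S :: "real ^ 'n ^ 'n" and U :: "real ^ 'n \<Rightarrow> real ^ 'n ^ 'n"
  assumes N: "\<And>k. k \<ge> 1 \<Longrightarrow> 0 < N k" "\<And>k. k \<ge> 1 \<Longrightarrow> N k \<le> N (Suc k)"
      "\<And>k. k \<ge> 1 \<Longrightarrow> N k \<le> n1 * real k powr q"
    and n0: "0 < n0" "\<And>k. k \<ge> 1 \<Longrightarrow> n0 * real k powr q \<le> N k"
    and S: "pos_def S"
    and R: "0 \<le> CR" "\<And>y. (norm (G y - S *v (y - xs)))\<^sup>2 \<le> CR * damped_square ((norm (y - xs))\<^sup>2)"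
    and p: "2 \<le> p" "p \<le> 4" and Bp: "0 \<le> Bp"
    and moment: "\<And>k y. k \<ge> 1 \<Longrightarrow>
          (\<integral>\<^sup>+e. ennreal (norm e ^ p) \<partial>\<kappa> k y) \<le> ennreal (Bp * real k powr (- (q * real p / 2)))"
    and rate: "q + 1 < 2 * (\<alpha> + q)" "q + 1 < \<alpha> * (real p - 1) + q * real p / 2"
    and V: "open V" "xs \<in> V"
    and U_lim: "uniform_limit V (\<lambda>k y. N k *\<^sub>R (\<integral>e. outer e e \<partial>\<kappa> k y)) U sequentially"
    and U_cont: "continuous_on V U"
  shows "(\<lambda>k. (\<Sum>i=1..k. N i) *\<^sub>R
            (\<integral>\<omega>. outer (weighted_avg N x k \<omega> - xs) (weighted_avg N x k \<omega> - xs) \<partial>P))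
         \<longlonglongrightarrow> matrix_inv S ** U xs ** matrix_inv S"
proof -
  interpret O: bounded_bilinear outer by (rule bounded_bilinear_outer)
  \<comment> \<open>The largest exponent allowed by the damped-moment estimate; the two rate
    conditions together say that it exceeds q + 1.\<close>
  define r where "r = min (2 * (\<alpha> + q)) (\<alpha> * (real p - 1) + q * real p / 2)"
  have r: "q + 1 < r" "r \<le> 2 * (\<alpha> + q)" "r \<le> \<alpha> * (real p - 1) + q * real p / 2" "0 \<le> r"
    using rate q by (auto simp: r_def)
  obtain CR' where CR': "0 \<le> CR'"
    "\<And>k. k \<ge> 1 \<Longrightarrow> L2_le P (\<lambda>\<omega>. G (x k \<omega>) - S *v (x k \<omega> - xs)) (CR' * real k powr (- (r / 2)))"
    using remainder_L2_decay[OF R(2,1) p Bp moment r(2-4)] by blast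
  define T where "T = (\<lambda>k. \<Sum>i=1..k. N i)"
  have T_eq: "(\<Sum>i=1..k. N i) = T k" for k by (simp add: T_def)
  define res where "res = (\<lambda>k \<omega>. (\<Sum>i=1..k. N i *\<^sub>R ((x (Suc i) \<omega> - xs) - (x i \<omega> - xs)))
     - matrix_inv S *v (\<Sum>i=1..k. N i *\<^sub>R (G (x i \<omega>) - S *v (x i \<omega> - xs)))
     - matrix_inv S *v (matrix_inv D *v (\<Sum>i=1..k. (N i / a i) *\<^sub>R ((x (Suc i) \<omega> - xs) - (x i \<omega> - xs)))))"
  obtain Cr s where Cr: "0 \<le> Cr" "s < (q + 1) / 2" "\<And>k. k \<ge> 1 \<Longrightarrow> L2_le P (res k) (Cr * real k powr s)"
    using residual_L2[OF N CR' r(1)] unfolding res_def by blast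
  define Z where "Z = (\<lambda>k \<omega>. \<Sum>i=1..k. N i *\<^sub>R \<E> i \<omega>)"
  define H where "H = (\<lambda>k \<omega>. (- matrix_inv S) *v Z k \<omega>)"
  define oS where "oS = onorm ((*v) (- matrix_inv S))"
  have oS: "0 \<le> oS" unfolding oS_def by (intro onorm_pos_le matrix_vector_mul_bounded_linear)
  have n1: "0 < n1" using N(1,3)[of 1] by simp
  have T_ge: "n0 / (q + 1) * real k powr (q + 1) \<le> T k" for k
  proof -
    have "n0 * real k powr (q + 1) \<le> n0 * ((q + 1) * (\<Sum>i=1..k. real i powr q))"
      using n0(1) by (intro mult_left_mono sum_powr_ge q) auto
    also have "\<dots> = (q + 1) * (\<Sum>i=1..k. n0 * real i powr q)" by (simp add: sum_distrib_left mult_ac)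
    also have "\<dots> \<le> (q + 1) * T k"
      unfolding T_def using q n0(2) by (intro mult_left_mono sum_mono) auto
    finally show ?thesis using q by (simp add: field_simps)
  qed
  have T_pos: "0 < T k" if "k \<ge> 1" for k
    unfolding T_def using N(1) that by (intro sum_pos) auto
  have T_top: "filterlim T at_top sequentially"
  proof (rule filterlim_at_top_mono)
    show "filterlim (\<lambda>k::nat. n0 / (q + 1) * real k) at_top sequentially"
      by (intro filterlim_tendsto_pos_mult_at_top[OF tendsto_const] filterlim_real_sequentially) (use n0 q in auto)
    show "\<forall>\<^sub>F k in sequentially. n0 / (q + 1) * real k \<le> T k"
      using eventually_ge_at_top[of 1]
    proof eventually_elim
      case (elim k)
      have "real k powr 1 \<le> real k powr (q + 1)" using elim q by (intro powr_mono) auto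
      then have "n0 / (q + 1) * real k \<le> n0 / (q + 1) * real k powr (q + 1)"
        using n0(1) q by (intro mult_left_mono) auto
      then show ?case using T_ge[of k] by linarith
    qed
  qed
  \<comment> \<open>One factor N_i cancels the decay i^-q of the noise variance up to
    \<open>n1\<close>, which leaves the plain weights and hence T.\<close>
  have ZL: "L2_le P (Z k) (sqrt (n1 * B) * sqrt (T k))" for k
  proof (rule L2_le_mono)
    show "L2_le P (Z k) (sqrt (\<Sum>i=1..k. (N i)\<^sup>2 * (B * real i powr (- q))))"
      unfolding Z_def by (rule noise_sum_L2(2))
    have "(\<Sum>i=1..k. (N i)\<^sup>2 * (B * real i powr (- q))) \<le> (\<Sum>i=1..k. (n1 * B) * N i)"
    proof (rule sum_mono)
      fix i assume "i \<in> {1..k}"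
      then have i: "i \<ge> 1" by simp
      have "N i * real i powr (- q) \<le> n1 * real i powr q * real i powr (- q)"
        using N(3)[OF i] by (rule mult_right_mono) simp
      also have "\<dots> = n1" using i by (simp add: powr_minus)
      finally have "(N i * B) * (N i * real i powr (- q)) \<le> (N i * B) * n1"
        using N(1)[OF i] B by (intro mult_left_mono) auto
      then show "(N i)\<^sup>2 * (B * real i powr (- q)) \<le> (n1 * B) * N i" by (simp add: power2_eq_square mult_ac)
    qed
    also have "\<dots> = n1 * B * T k" by (simp add: T_def sum_distrib_left)
    finally show "sqrt (\<Sum>i=1..k. (N i)\<^sup>2 * (B * real i powr (- q))) \<le> sqrt (n1 * B) * sqrt (T k)"
      by (simp flip: real_sqrt_mult)
  qed
  define Ch where "Ch = oS * sqrt (n1 * B)"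
  have HL: "L2_le P (H k) (Ch * sqrt (T k))" for k
    using L2_le_matrix[OF ZL, of "- matrix_inv S"] by (simp add: H_def oS_def[symmetric] Ch_def mult.assoc)
  define Ce where "Ce = Cr / sqrt (n0 / (q + 1))"
  \<comment> \<open>The residual measured in units of sqrt T, using the lower bound of order k^(q+1)
    on T; the exponent is negative by the choice of \<open>s\<close>.\<close>
  define \<epsilon> where "\<epsilon> = (\<lambda>k. Ce * real k powr (s - (q + 1) / 2))"
  have resL: "L2_le P (res k) (\<epsilon> k * sqrt (T k))" if k: "k \<ge> 1" for k
  proof (rule L2_le_mono[OF Cr(3)[OF k]])
    define w where "w = sqrt (n0 / (q + 1))"
    have w: "0 < w" using n0(1) q by (simp add: w_def)
    have e0: "0 \<le> \<epsilon> k" using Cr(1) n0(1) q by (simp add: \<epsilon>_def Ce_def)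
    have "Cr * real k powr s = \<epsilon> k * (w * real k powr ((q + 1) / 2))"
      using w by (simp add: \<epsilon>_def Ce_def flip: w_def powr_add)
    also have "w * real k powr ((q + 1) / 2) \<le> sqrt (T k)"
      using real_sqrt_le_mono[OF T_ge[of k]] by (simp only: real_sqrt_mult sqrt_powr w_def)
    finally show "Cr * real k powr s \<le> \<epsilon> k * sqrt (T k)" using e0 by (simp add: mult_left_mono)
  qed
  have \<epsilon>0: "\<epsilon> \<longlonglongrightarrow> 0"
  proof -
    have "(\<lambda>k. Ce * real k powr (s - (q + 1) / 2)) \<longlonglongrightarrow> Ce * 0"
      by (intro tendsto_mult tendsto_const tendsto_neg_powr[OF _ filterlim_real_sequentially]) (use Cr(2) in simp)
    then show ?thesis by (simp add: \<epsilon>_def)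
  qed
  define err where "err = (\<lambda>k. (1 / T k) *\<^sub>R (((\<integral>\<omega>. outer (H k \<omega>) (res k \<omega>) \<partial>P) + (\<integral>\<omega>. outer (res k \<omega>) (H k \<omega>) \<partial>P))
     + (\<integral>\<omega>. outer (res k \<omega>) (res k \<omega>) \<partial>P)))"
  have err_le: "norm (err k) \<le> 2 * Ch * \<epsilon> k + (\<epsilon> k)\<^sup>2" if k: "k \<ge> 1" for k
  proof -
    have Tk: "sqrt (T k) * sqrt (T k) = T k" "0 < T k" using T_pos[OF k] by simp_all
    have "norm (((\<integral>\<omega>. outer (H k \<omega>) (res k \<omega>) \<partial>P) + (\<integral>\<omega>. outer (res k \<omega>) (H k \<omega>) \<partial>P)) + (\<integral>\<omega>. outer (res k \<omega>) (res k \<omega>) \<partial>P))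
      \<le> ((Ch * sqrt (T k)) * (\<epsilon> k * sqrt (T k)) + (\<epsilon> k * sqrt (T k)) * (Ch * sqrt (T k))) + (\<epsilon> k * sqrt (T k)) * (\<epsilon> k * sqrt (T k))"
      by (intro norm_triangle_le add_mono L2_le_outer(2) HL resL k)
    also have "\<dots> = (2 * Ch * \<epsilon> k + (\<epsilon> k)\<^sup>2) * (sqrt (T k) * sqrt (T k))" by (simp add: algebra_simps power2_eq_square)
    finally show ?thesis unfolding err_def Tk(1) using Tk(2) by (simp add: divide_le_eq)
  qed
  have err0: "err \<longlonglongrightarrow> 0"
  proof (rule Lim_null_comparison)
    show "\<forall>\<^sub>F k in sequentially. norm (err k) \<le> 2 * Ch * \<epsilon> k + (\<epsilon> k)\<^sup>2"
      using eventually_ge_at_top[of 1] by eventually_elim (rule err_le)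
    have "(\<lambda>k. 2 * Ch * \<epsilon> k + (\<epsilon> k)\<^sup>2) \<longlonglongrightarrow> 2 * Ch * 0 + 0\<^sup>2" by (intro tendsto_intros \<epsilon>0)
    then show "(\<lambda>k. 2 * Ch * \<epsilon> k + (\<epsilon> k)\<^sup>2) \<longlonglongrightarrow> 0" by simp
  qed
  \<comment> \<open>Splitting N_i^2 into N_i times N_i turns the covariance of the noise sum into a
    weighted mean of convergent matrices.\<close>
  have "(\<lambda>k. (1 / T k) *\<^sub>R (\<Sum>i=1..k. N i *\<^sub>R (N i *\<^sub>R (\<integral>\<omega>. outer (\<E> i \<omega>) (\<E> i \<omega>) \<partial>P)))) \<longlonglongrightarrow> U xs"
    unfolding T_def
    by (rule weighted_cesaro[OF N(1) T_top[unfolded T_def] noise_covariance_limit[OF N(1,3) V U_lim U_cont]])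
  then have "(\<lambda>k. (1 / T k) *\<^sub>R (\<integral>\<omega>. outer (Z k \<omega>) (Z k \<omega>) \<partial>P)) \<longlonglongrightarrow> U xs"
    unfolding Z_def noise_sum_covariance by (simp add: power2_eq_square)
  from bounded_linear.tendsto[OF bounded_linear_sandwich this, of "- matrix_inv S" "transpose (- matrix_inv S)"]
  have "(\<lambda>k. (1 / T k) *\<^sub>R (\<integral>\<omega>. outer (H k \<omega>) (H k \<omega>) \<partial>P)) \<longlonglongrightarrow> (- matrix_inv S) ** U xs ** transpose (- matrix_inv S)"
    unfolding H_def outer_matrix_vector
    by (simp add: integral_bounded_linear[OF bounded_linear_sandwich L2_le_outer(1)[OF ZL ZL]]
        linear_cmul[OF bounded_linear.linear[OF bounded_linear_sandwich]])
  also have "(- matrix_inv S) ** U xs ** transpose (- matrix_inv S) = matrix_inv S ** U xs ** matrix_inv S"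
  proof -
    have "transpose (- matrix_inv S) = - matrix_inv S"
      using pos_def_transpose_inv[OF S] by (simp add: transpose_def vec_eq_iff)
    then show ?thesis by (simp add: vec_eq_iff matrix_matrix_mult_def sum_negf)
  qed
  finally have main: "(\<lambda>k. (1 / T k) *\<^sub>R (\<integral>\<omega>. outer (H k \<omega>) (H k \<omega>) \<partial>P) + err k) \<longlonglongrightarrow> matrix_inv S ** U xs ** matrix_inv S + 0"
    by (intro tendsto_add err0)
  have "(\<Sum>i=1..k. N i) *\<^sub>R (\<integral>\<omega>. outer (weighted_avg N x k \<omega> - xs) (weighted_avg N x k \<omega> - xs) \<partial>P)
     = (1 / T k) *\<^sub>R (\<integral>\<omega>. outer (H k \<omega>) (H k \<omega>) \<partial>P) + err k" if k: "k \<ge> 1" for k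
  proof -
    have Tk: "T k \<noteq> 0" using T_pos[OF k] by simp
    have "weighted_avg N x k \<omega> - xs = (1 / T k) *\<^sub>R (H k \<omega> + res k \<omega>)" if \<omega>: "\<omega> \<in> space P" for \<omega>
    proof -
      have "H k \<omega> + res k \<omega> = (\<Sum>i=1..k. N i *\<^sub>R (x (Suc i) \<omega> - xs))"
        unfolding averaged_decomposition[OF S \<omega>] H_def res_def Z_def
        by (simp add: matrix_vector_mult_def vec_eq_iff sum_negf)
      also have "\<dots> = (\<Sum>i=1..k. N i *\<^sub>R x (Suc i) \<omega>) - T k *\<^sub>R xs"
        by (simp add: T_def scaleR_diff_right sum_subtractf scaleR_sum_left)
      finally have "H k \<omega> + res k \<omega> = (\<Sum>i=1..k. N i *\<^sub>R x (Suc i) \<omega>) - T k *\<^sub>R xs" .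
      then show ?thesis unfolding weighted_avg_def T_eq using Tk by (simp add: scaleR_diff_right)
    qed
    then have "(\<integral>\<omega>. outer (weighted_avg N x k \<omega> - xs) (weighted_avg N x k \<omega> - xs) \<partial>P)
       = (\<integral>\<omega>. (1 / (T k)\<^sup>2) *\<^sub>R outer (H k \<omega> + res k \<omega>) (H k \<omega> + res k \<omega>) \<partial>P)"
      by (intro Bochner_Integration.integral_cong) (auto simp: O.scaleR_left O.scaleR_right power2_eq_square)
    also have "\<dots> = (1 / (T k)\<^sup>2) *\<^sub>R (\<integral>\<omega>. outer (H k \<omega> + res k \<omega>) (H k \<omega> + res k \<omega>) \<partial>P)" by simp
    finally show ?thesis
      unfolding L2_le_outer_add[OF HL resL[OF k]] T_eq err_def
      using Tk by (simp add: power2_eq_square algebra_simps)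
  qed
  then have "\<forall>\<^sub>F k in sequentially. (1 / T k) *\<^sub>R (\<integral>\<omega>. outer (H k \<omega>) (H k \<omega>) \<partial>P) + err k
     = (\<Sum>i=1..k. N i) *\<^sub>R (\<integral>\<omega>. outer (weighted_avg N x k \<omega> - xs) (weighted_avg N x k \<omega> - xs) \<partial>P)"
    by (intro eventually_mono[OF eventually_ge_at_top[of 1]]) (rule sym)
  from Lim_transform_eventually[OF main this] show ?thesis by simp
qed

end

theorem theorem7p5:
  fixes P :: "'a measure"
    and F :: "nat \<Rightarrow> 'a measure"
    and f :: "real ^ 'n \<Rightarrow> real"
    and x g \<E> :: "nat \<Rightarrow> 'a \<Rightarrow> real ^ 'n"
    and A :: "nat \<Rightarrow> real ^ 'n ^ 'n"
    and \<kappa> :: "nat \<Rightarrow> real ^ 'n \<Rightarrow> (real ^ 'n) measure"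
    and N a :: "nat \<Rightarrow> real"
    and M :: nat
    and D S \<Sigma>2 :: "real ^ 'n ^ 'n"
    and U :: "real ^ 'n \<Rightarrow> real ^ 'n ^ 'n"
    and V W :: "(real ^ 'n) set"
    and xs :: "real ^ 'n"
    and c \<alpha> q N1 :: real
  assumes prob: "prob_space P"
    and filt: "filtration (space P) F" "\<And>k. subalgebra P (F k)"
    and x1_meas: "x 1 \<in> borel_measurable (F 0)"
    and x1_sq: "integrable P (\<lambda>\<omega>. (norm (x 1 \<omega>))\<^sup>2)"
    and noise_meas: "\<And>k. k \<ge> 1 \<Longrightarrow> \<E> k \<in> borel_measurable (F k)"
    and noise_mean: "\<And>k i. k \<ge> 1 \<Longrightarrow>
          AE \<omega> in P. real_cond_exp P (F (k - 1)) (\<lambda>\<omega>. \<E> k \<omega> $ i) \<omega> = 0"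
    and noise_dep: "\<And>k (h :: real ^ 'n \<Rightarrow> real). k \<ge> 1 \<Longrightarrow> h \<in> borel_measurable borel \<Longrightarrow>
          integrable P (\<lambda>\<omega>. h (\<E> k \<omega>)) \<Longrightarrow>
          AE \<omega> in P. real_cond_exp P (F (k - 1)) (\<lambda>\<omega>. h (\<E> k \<omega>)) \<omega>
                    = real_cond_exp P (sigma_gen P (x k)) (\<lambda>\<omega>. h (\<E> k \<omega>)) \<omega>"
    and noise_law: "\<And>k. k \<ge> 1 \<Longrightarrow> cond_law P (x k) (\<E> k) (\<kappa> k)"
    and A_pd: "\<And>k. k \<ge> 1 \<Longrightarrow> pos_def (A k)"
    and g_eq: "\<And>k \<omega>. k \<ge> 1 \<Longrightarrow> \<omega> \<in> space P \<Longrightarrow> g k \<omega> = grad f (x k \<omega>) + \<E> k \<omega>"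
    and iter: "\<And>k \<omega>. k \<ge> 1 \<Longrightarrow> \<omega> \<in> space P \<Longrightarrow> x (Suc k) \<omega> = x k \<omega> - A k *v g k \<omega>"
    and f_diff: "\<And>y. f differentiable (at y)" "\<And>y. grad f differentiable (at y)"
    and crit: "\<And>y. grad f y = 0 \<longleftrightarrow> y = xs"
    and hess_pd: "\<And>y. pos_def (hessian f y)"
    and hess_bdd: "bdd_above (range (\<lambda>y. op_norm (hessian f y)))"
    and hess_inv_bdd: "bdd_above (range (\<lambda>y. op_norm (matrix_inv (hessian f y))))"
    and N_pos: "\<And>k. k \<ge> 1 \<Longrightarrow> 0 < N k"
    and N_mono: "\<And>k l. 1 \<le> k \<Longrightarrow> k \<le> l \<Longrightarrow> N k \<le> N l"
    and M_ge: "M \<ge> 3"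
    and noise_moments: "\<And>p. p \<in> {2..M} \<Longrightarrow>
          (SUP k\<in>{1..}. SUP y. ennreal (N k powr (real p / 2)) * (\<integral>\<^sup>+ e. ennreal (norm e ^ p) \<partial>\<kappa> k y)) < \<infinity>"
    and A_eq: "\<And>k. k \<ge> 1 \<Longrightarrow> A k = a k *\<^sub>R D"
    and a_eq: "\<And>k. k \<ge> 1 \<Longrightarrow> a k = (real k + c) powr (- \<alpha>)"
    and c: "c \<ge> 0"
    and alpha: "0 < \<alpha>" "\<alpha> < 1"
    and D_pd: "pos_def D"
    and N_asymp: "N \<sim>[sequentially] (\<lambda>k. N1 * real k powr q)"
    and N1: "N1 > 0"
    and q: "q \<ge> 0"
    and V: "open V" "xs \<in> V"
    and U_lim: "uniform_limit V (\<lambda>k y. N k *\<^sub>R (\<integral>e. outer e e \<partial>\<kappa> k y)) U sequentially"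
    and U_cont: "continuous_on V U"
    and U_xs: "U xs = \<Sigma>2"
    and Sigma2_pd: "pos_def \<Sigma>2"
    and W: "open W" "xs \<in> W"
    and f_C3: "Ck_on 3 f W"
    and alpha_q: "(1 - q) / 2 < \<alpha>"
    and M_ge1: "int M \<ge> 2 * \<lfloor>1 / (\<alpha> + q)\<rfloor> + 2"
    and M_ge2: "int M \<ge> 2 * \<lfloor>1 / (\<alpha> - (1 - q) / 2)\<rfloor> + 2"
    and S: "S = hessian f xs"
  shows "(\<lambda>k. (\<Sum>i=1..k. N i) *\<^sub>R
            (\<integral>\<omega>. outer (weighted_avg N x k \<omega> - xs) (weighted_avg N x k \<omega> - xs) \<partial>P))
         \<longlonglongrightarrow> matrix_inv S ** \<Sigma>2 ** matrix_inv S"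
proof -
  interpret prob_space P by (rule prob)
  note f_diff2 = f_diff(2)
  obtain L where L: "\<And>y. op_norm (hessian f y) \<le> L" using hess_bdd by (auto simp: bdd_above_def)
  have L0: "0 \<le> L" using L[of xs] op_norm_nonneg[of "hessian f xs"] by linarith
  obtain K0 where K0: "\<And>y. op_norm (matrix_inv (hessian f y)) \<le> K0" using hess_inv_bdd by (auto simp: bdd_above_def)
  \<comment> \<open>Enlarged by 1 so that it is visibly positive.\<close>
  define K where "K = K0 + 1"
  have K: "op_norm (matrix_inv (hessian f y)) \<le> K" "0 < K" for y
    using K0[of y] op_norm_nonneg[of "matrix_inv (hessian f y)"] by (simp_all add: K_def)
  have G0: "grad f xs = 0" using crit by simp
  obtain n0 n1 where n0: "0 < n0" "\<And>k. k \<ge> 1 \<Longrightarrow> n0 * real k powr q \<le> N k"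
    and n1: "\<And>k. k \<ge> 1 \<Longrightarrow> N k \<le> n1 * real k powr q"
    using asymp_equiv_powr_bounds[OF N_pos N_asymp N1] by blast
  \<comment> \<open>The one-step estimate accepts exponents from two to four, and the largest
    available one is taken. With p = 2 the second rate condition would read 1 < \<alpha>;
    \<open>M_ge\<close> secures at least p = 3.\<close>
  define p :: nat where "p = min M 4"
  have p: "2 \<le> p" "p \<le> 4" "p \<in> {2..M}" using M_ge by (auto simp: p_def)
  have "2 \<in> {2..M}" using M_ge by simp
  from scaled_moment_bound[OF n0 noise_moments[OF this]]
  obtain B where B: "0 \<le> B" "\<And>k y. k \<ge> 1 \<Longrightarrow>
    (\<integral>\<^sup>+ e. ennreal ((norm e)\<^sup>2) \<partial>\<kappa> k y) \<le> ennreal (B * real k powr (- q))"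
    by auto
  obtain Bp where Bp: "0 \<le> Bp" "\<And>k y. k \<ge> 1 \<Longrightarrow>
    (\<integral>\<^sup>+ e. ennreal (norm e ^ p) \<partial>\<kappa> k y) \<le> ennreal (Bp * real k powr (- (q * real p / 2)))"
    using scaled_moment_bound[OF n0 noise_moments[OF p(3)]] by blast
  obtain CR where CR: "0 < CR"
    "\<And>y. (norm (grad f y - grad f xs - hessian f xs *v (y - xs)))\<^sup>2
          \<le> CR * (((norm (y - xs))\<^sup>2)\<^sup>2 / (1 + (norm (y - xs))\<^sup>2))"
    using taylor_gradient_remainder[OF f_diff2 hessian_differentiable_C3[OF f_C3 W f_diff2] L] by blast
  text \<open>For \<open>M = 3\<close> the hypothesis on \<open>M\<close> forces \<open>2\<alpha> + q > 3\<close>, and then third moments suffice.\<close>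
  have rate1: "q + 1 < 2 * (\<alpha> + q)" using alpha_q by simp
  have rate2: "q + 1 < \<alpha> * (real p - 1) + q * real p / 2"
  proof (cases "M \<ge> 4")
    case True
    then show ?thesis using alpha_q alpha by (simp add: p_def)
  next
    case False
    then have M3: "M = 3" using M_ge by simp
    define z where "z = \<alpha> - (1 - q) / 2"
    have z: "0 < z" using alpha_q by (simp add: z_def)
    have "\<lfloor>1 / z\<rfloor> \<le> 0" using M_ge2 unfolding M3 z_def by linarith
    then have "1 / z < 1" by linarith
    then have "1 < z" using z by (simp add: divide_less_eq)
    then show ?thesis using alpha q M3 by (simp add: p_def z_def field_simps)
  qed
  \<comment> \<open>Because the gradient vanishes at \<open>xs\<close>, strong monotonicity and the
    Lipschitz bound, taken relative to that point, become the coercivity and the growth condition of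
    the locale.\<close>
  interpret stochastic_descent P F x \<E> \<kappa> "grad f" D xs a c \<alpha> q K L B
  proof
    show "subalgebra P (F k)" for k by (rule filt(2))
    show "sets (F i) \<subseteq> sets (F j)" if "i \<le> j" for i j
      by (rule filtration.sets_F_mono[OF filt(1) that])
    show "x (Suc k) \<omega> = x k \<omega> - a k *\<^sub>R (D *v (grad f (x k \<omega>) + \<E> k \<omega>))" if "k \<ge> 1" "\<omega> \<in> space P" for k \<omega>
      using iter[OF that] g_eq[OF that] A_eq[OF that(1)] by (simp add: scaleR_matrix_vector_assoc)
    show "continuous_on UNIV (grad f)"
      by (intro continuous_at_imp_continuous_on ballI differentiable_imp_continuous_within f_diff2)
    show "(norm (y - xs))\<^sup>2 \<le> K * ((y - xs) \<bullet> grad f y)" for y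
      using strong_monotone_gradient[OF f_diff2 hess_pd K, of y xs] G0 by simp
    show "norm (grad f y) \<le> L * norm (y - xs)" for y
      using lipschitz_gradient[OF f_diff2 L, of y xs] G0 by simp
  qed (fact x1_meas x1_sq noise_meas noise_mean noise_law K(2) L0 D_pd a_eq c alpha q B)+
  have "(\<lambda>k. (\<Sum>i=1..k. N i) *\<^sub>R
            (\<integral>\<omega>. outer (weighted_avg N x k \<omega> - xs) (weighted_avg N x k \<omega> - xs) \<partial>P))
         \<longlonglongrightarrow> matrix_inv S ** U xs ** matrix_inv S"
  proof (rule weighted_average_covariance[where ?n0.0 = n0 and ?n1.0 = n1 and p = p and Bp = Bp and CR = CR and V = V])
    show "N k \<le> N (Suc k)" if "k \<ge> 1" for k using N_mono that by simp
    show "(norm (grad f y - S *v (y - xs)))\<^sup>2 \<le> CR * damped_square ((norm (y - xs))\<^sup>2)" for y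
      using CR(2)[of y] G0 by (simp add: S damped_square_def)
    show "pos_def S" by (simp add: S hess_pd)
    show "0 \<le> CR" using CR(1) by simp
  qed (fact N_pos n1 n0 p Bp rate1 rate2 V U_lim U_cont)+
  then show ?thesis by (simp only: U_xs)
qed

end
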